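(* Let $k$ be a field with $\operatorname{char}(k)=0$, let $R=k[y_1,y_2,y_3]$ with the standard grading, and let $I\subset R$ be a homogeneous ideal such that $A:=R/I$ is a Gorenstein graded ring of dimension zero. Suppose that, for a general linear form $x_3\in R$, the minimal number of generators over $R$ of the module $0:_A x_3=\{a\in A\mid x_3a=0\}$ is at most $2$. Then $A$ has the weak Lefschetz property.
   Context: A graded ring $A=\bigoplus_i [A]_i$ (a graded quotient of $R$) has the weak Lefschetz property if there is an element $\ell\in[A]_1$ such that the multiplication map $\times\ell:[A]_i\to[A]_{i+1}$ has maximal rank (i.e. is injective or surjective) for every $i\in\mathbb{Z}$. "For a general linear form" means: for all linear forms in some nonempty Zariski open subset of $[R]_1$. *)

theory Defs
  imports
    "HOL-Library.Poly_Mapping"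
    "HOL-Library.Extended_Nat"
    "HOL-Library.Numeral_Type"
    "HOL-Algebra.Ideal"
    "HOL-Algebra.QuotRing"
    "HOL-Algebra.Module"
    "HOL-Algebra.Embedded_Algebras"
begin

section \<open>Commutative algebra\<close>

text \<open>\<open>N\<close> has Krull dimension \<open>n\<close> when \<open>n\<close> is the largest length of a strict chain of prime
  ideals. The zero ring, having no prime ideals, has no Krull dimension in this sense.\<close>

definition prime_chain :: "('a, 'b) ring_scheme \<Rightarrow> nat \<Rightarrow> (nat \<Rightarrow> 'a set) \<Rightarrow> bool"
  where "prime_chain N n P \<longleftrightarrow>
    (\<forall>i\<le>n. primeideal (P i) N) \<and> (\<forall>i<n. P i \<subset> P (Suc i))"

definition has_krull_dim :: "('a, 'b) ring_scheme \<Rightarrow> nat \<Rightarrow> bool"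
  where "has_krull_dim N n \<longleftrightarrow> (\<exists>P. prime_chain N n P) \<and> (\<forall>m P. prime_chain N m P \<longrightarrow> m \<le> n)"

definition generated_submodule ::
    "('r, 'c) ring_scheme \<Rightarrow> ('r, 'a, 'b) module_scheme \<Rightarrow> 'a set \<Rightarrow> 'a set"
  where "generated_submodule R M S = \<Inter>{H. submodule H R M \<and> S \<subseteq> H}"

text \<open>The value is \<open>\<infinity>\<close> when \<open>N\<close> is not finitely generated.\<close>

definition min_num_generators ::
    "('r, 'c) ring_scheme \<Rightarrow> ('r, 'a, 'b) module_scheme \<Rightarrow> 'a set \<Rightarrow> enat"
  where "min_num_generators R M N =
    (INF S\<in>{S. finite S \<and> S \<subseteq> carrier M \<and> generated_submodule R M S = N}. enat (card S))"

text \<open>The submodule \<open>0 :\<^sub>M x\<close> for a ring element \<open>x\<close> acting on \<open>M\<close>.\<close>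

definition annihilated :: "('r, 'a, 'b) module_scheme \<Rightarrow> 'r \<Rightarrow> 'a set"
  where "annihilated M x = {a \<in> carrier M. x \<odot>\<^bsub>M\<^esub> a = \<zero>\<^bsub>M\<^esub>}"


section \<open>Graded rings\<close>

text \<open>In this section \<open>gr i\<close> is the component \<open>[A]\<^sub>i\<close> of a graded ring \<open>A\<close>.\<close>

definition graded_socle :: "('a, 'b) ring_scheme \<Rightarrow> (int \<Rightarrow> 'a set) \<Rightarrow> 'a set"
  where "graded_socle A gr = {a \<in> carrier A. \<forall>i>0. \<forall>b\<in>gr i. b \<otimes>\<^bsub>A\<^esub> a = \<zero>\<^bsub>A\<^esub>}"

text \<open>Gorenstein means Cohen-Macaulay of type one. In dimension zero Cohen-Macaulayness is automatic
  and the type is the dimension of the socle over the residue field. For a standard graded algebra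
  over a field the residue field is \<open>[A]\<^sub>0\<close>, and the socle is the annihilator of the maximal ideal
  \<open>\<Oplus>\<^sub>i\<^sub>>\<^sub>0 [A]\<^sub>i\<close>.\<close>

definition gorenstein_dim_zero :: "('a, 'b) ring_scheme \<Rightarrow> (int \<Rightarrow> 'a set) \<Rightarrow> bool"
  where "gorenstein_dim_zero A gr \<longleftrightarrow>
    has_krull_dim A 0 \<and> ring.dimension A 1 (gr 0) (graded_socle A gr)"

definition weak_lefschetz :: "('a, 'b) ring_scheme \<Rightarrow> (int \<Rightarrow> 'a set) \<Rightarrow> bool"
  where "weak_lefschetz A gr \<longleftrightarrow>
    (\<exists>l\<in>gr 1. \<forall>i. inj_on (\<lambda>a. l \<otimes>\<^bsub>A\<^esub> a) (gr i) \<or> (\<lambda>a. l \<otimes>\<^bsub>A\<^esub> a) ` gr i = gr (i + 1))"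


section \<open>Polynomial rings and their graded quotients\<close>

text \<open>A monomial is its exponent vector, and a polynomial maps monomials to coefficients; the
  product on \<^typ>\<open>('x \<Rightarrow>\<^sub>0 nat) \<Rightarrow>\<^sub>0 'k\<close> is convolution. The variables are indexed by \<open>'x\<close>.\<close>

type_synonym ('x, 'k) mpoly = "('x \<Rightarrow>\<^sub>0 nat) \<Rightarrow>\<^sub>0 'k"

definition poly_ring :: "('x, 'k::field) mpoly ring"
  where "poly_ring = \<lparr>carrier = UNIV, mult = (*), one = 1, zero = 0, add = (+)\<rparr>"

definition monomial_degree :: "('x::finite \<Rightarrow>\<^sub>0 nat) \<Rightarrow> nat"
  where "monomial_degree m = (\<Sum>i\<in>UNIV. Poly_Mapping.lookup m i)"

definition forms :: "int \<Rightarrow> ('x::finite, 'k::field) mpoly set"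
  where "forms d = {p. \<forall>m\<in>Poly_Mapping.keys p. int (monomial_degree m) = d}"

definition homogeneous_ideal :: "('x::finite, 'k::field) mpoly set \<Rightarrow> bool"
  where "homogeneous_ideal I \<longleftrightarrow>
    ideal I poly_ring \<and> (\<exists>S\<subseteq>(\<Union>d. forms d). I = genideal poly_ring S)"

definition quot_algebra ::
    "('x, 'k::field) mpoly set \<Rightarrow> (('x, 'k) mpoly, ('x, 'k) mpoly set) module"
  where "quot_algebra I = ring.extend (poly_ring Quot I)
    (module.fields (\<lambda>p a. (I +>\<^bsub>poly_ring\<^esub> p) \<otimes>\<^bsub>poly_ring Quot I\<^esub> a))"

definition quot_component ::
    "('x::finite, 'k::field) mpoly set \<Rightarrow> int \<Rightarrow> ('x, 'k) mpoly set set"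
  where "quot_component I d = (\<lambda>p. I +>\<^bsub>poly_ring\<^esub> p) ` forms d"


section \<open>General linear forms\<close>

definition linear_form :: "('x::finite \<Rightarrow> 'k::field) \<Rightarrow> ('x, 'k) mpoly"
  where "linear_form c = (\<Sum>i\<in>UNIV. Poly_Mapping.single (Poly_Mapping.single i 1) (c i))"

definition eval_poly :: "('x::finite, 'k::field) mpoly \<Rightarrow> ('x \<Rightarrow> 'k) \<Rightarrow> 'k"
  where "eval_poly f c =
    (\<Sum>m\<in>Poly_Mapping.keys f. Poly_Mapping.lookup f m * (\<Prod>i\<in>UNIV. c i ^ Poly_Mapping.lookup m i))"

definition zariski_open :: "('x::finite \<Rightarrow> 'k::field) set \<Rightarrow> bool"
  where "zariski_open U \<longleftrightarrow> (\<exists>F :: ('x, 'k) mpoly set. U = {c. \<exists>f\<in>F. eval_poly f c \<noteq> 0})"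

text \<open>\<open>[R]\<^sub>1\<close> is identified with affine space through the coefficients of a linear form.\<close>

definition for_general_linear_form :: "(('x::finite, 'k::field) mpoly \<Rightarrow> bool) \<Rightarrow> bool"
  where "for_general_linear_form P \<longleftrightarrow>
    (\<exists>U. zariski_open U \<and> U \<noteq> {} \<and> (\<forall>c\<in>U. P (linear_form c)))"

end

theory Submission
  imports Defs
    "HOL-Library.Function_Algebras"
    "HOL-Computational_Algebra.Polynomial"
    "HOL-Computational_Algebra.Fraction_Field"
begin

text \<open>The algebra \<open>A\<close> has a socle degree \<open>e\<close>, and the product followed by a linear form on \<open>[A]\<^sub>e\<close> is a perfect pairing of
\<open>[A]\<^sub>j\<close> and \<open>[A]\<^bsub>e-j\<^esub>\<close> for which every multiplication is self-adjoint. So surjectivity of \<open>\<ell> : [A]\<^sub>j \<rightarrow> [A]\<^bsub>j+1\<^esub>\<close> is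
injectivity of \<open>\<ell>\<close> on \<open>[A]\<^bsub>e-j-1\<^esub>\<close>, and it suffices to find a linear form that is injective on \<open>[A]\<^sub>j\<close>
whenever \<open>2 j + 1 \<le> e\<close>. Let \<open>K\<close> be the field of rational functions in the coefficients of a linear form, and let \<open>L\<close> be the
generic linear form in \<open>A \<otimes> K\<close>. Injectivity of \<open>L\<close> is preserved by specialization to almost all linear forms
(\<open>specialize_injectivity\<close>). Also \<open>0 : L\<close> is dual to \<open>A/LA\<close>, so the bound on its number of generators says that
the socle of \<open>A/LA\<close> has dimension at most two; if it had three independent elements over \<open>K\<close>, then so it would have for
almost all linear forms over \<open>k\<close> (\<open>specialize_three_socle_elements\<close>). The claim is thus one about
\<open>L\<close>, the lemma \<open>lower_half_injective\<close>, and here the derivations of \<open>K\<close> with respect to the coefficients of \<open>L\<close> are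
available: they kill \<open>A\<close> and send \<open>L\<close> to the variables.

Suppose that \<open>d\<close> is the least degree in which \<open>L\<close> has a kernel, and that \<open>2 d + 1 \<le> e\<close>. Let \<open>p\<close> be maximal such that
\<open>L\<^sup>p\<close> divides the whole kernel in degree \<open>d\<close>, and choose \<open>L\<^sup>p h\<close> in this kernel that is not divisible by \<open>L\<^sup>p\<^sup>+\<^sup>1\<close>. Differentiating \<open>L\<^sup>p\<^sup>+\<^sup>1 h = 0\<close> with respect to the coefficient of the variable \<open>y\<close> and cancelling powers of \<open>L\<close> shows that
\<open>(p + 1) y h\<close> is divisible by \<open>L\<close>. Hence \<open>h\<close> gives a socle element of \<open>A/LA\<close> in degree \<open>d - p\<close>; this uses characteristic
zero. The component of \<open>A/LA\<close> of degree \<open>e - d > d\<close> is its last one, consists of socle elements, and is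
dual to the kernel of \<open>L\<close> in degree \<open>d\<close>. As there are no more than two independent socle elements, that kernel is a line, and outside the top
degree all socle elements are multiples of \<open>h\<close> modulo \<open>LA\<close> (\<open>kernel_line\<close>, \<open>soc_at_s\<close>).

So the relation above becomes \<open>(p + 1) y h + L (\<nabla>\<^sub>y h) = 0\<close> for a connection \<open>\<nabla>\<close> on the multiples of \<open>h\<close>, and the connection can be chosen such that
\<open>y \<nabla>\<^sub>z h - z \<nabla>\<^sub>y h\<close> is a multiple of \<open>L h\<close> (\<open>torsion_free_connection\<close>). Differentiating these two relations
repeatedly, one finds that the space \<open>V\<close> spanned by all derivatives of \<open>h\<close> satisfies \<open>y V \<subseteq> L V\<close> (\<open>Y_jet\<close>). Dividing by \<open>L\<close>, the variables
define operators \<open>M\<^sub>y\<close> on \<open>V\<close> with \<open>y v = L (M\<^sub>y v)\<close>. The image of their commutator is spanned by \<open>h\<close>. In characteristic zero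
the cyclicity of the trace then forces them to commute on the subspace that they generate from \<open>h\<close> (\<open>rank_one_commutator\<close>).

Every element of \<open>V\<close> is a socle element of \<open>A/LA\<close>, hence congruent to \<open>\<lambda>(v) h\<close> modulo \<open>LA\<close>. If \<open>\<lambda>\<close> kills \<open>M\<^sup>\<alpha> v\<close> for all
\<open>|\<alpha>| \<le> d - p\<close>, then \<open>v\<close> is divisible by more powers of \<open>L\<close> than its degree permits, and
\<open>v = 0\<close>. So \<open>\<lambda>(M\<^sup>\<alpha> M\<^sup>\<beta> h)\<close> is a Hankel form that is non-degenerate with few rows. On the other hand,
\<open>L\<^bsup>d+1\<^esup> M\<^sup>\<beta> h\<close> is zero for \<open>|\<beta>| \<le> d - p\<close> because \<open>L\<^sup>p\<^sup>+\<^sup>1 h = 0\<close>. The non-degeneracy extends this to all \<open>\<beta>\<close>. For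
\<open>|\<beta>| \<le> d + 1\<close> it says that every monomial of degree \<open>d + 1\<close> kills \<open>h\<close>, in degree \<open>2 d + 1 - p \<le> e\<close>. This is impossible, because
in a Gorenstein algebra every non-zero element has a non-zero multiple in each higher degree up to \<open>e\<close>.\<close>

section \<open>Functionals and traces on subspaces\<close>

locale linear_space = vector_space scale
  for scale :: "'a::field \<Rightarrow> 'b::ab_group_add \<Rightarrow> 'b"
begin

definition lin_functional_on :: "'b set \<Rightarrow> ('b \<Rightarrow> 'a) \<Rightarrow> bool"
  where "lin_functional_on W f \<longleftrightarrow>
    (\<forall>v\<in>W. \<forall>w\<in>W. f (v + w) = f v + f w) \<and> (\<forall>a. \<forall>v\<in>W. f (scale a v) = a * f v)"

lemma lin_functional_on_subset: "lin_functional_on W f \<Longrightarrow> W' \<subseteq> W \<Longrightarrow> lin_functional_on W' f"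
  unfolding lin_functional_on_def by blast

lemma lin_functional_on_lincomb:
  assumes "finite J" "\<And>j. j \<in> J \<Longrightarrow> lin_functional_on W (f j)"
  shows "lin_functional_on W (\<lambda>v. \<Sum>j\<in>J. c j * f j v)"
  unfolding lin_functional_on_def
proof (intro conjI ballI allI)
  fix v w assume "v \<in> W" "w \<in> W"
  then have "\<And>j. j \<in> J \<Longrightarrow> c j * f j (v + w) = c j * f j v + c j * f j w"
    using assms(2) unfolding lin_functional_on_def by (simp add: distrib_left)
  then show "(\<Sum>j\<in>J. c j * f j (v + w)) = (\<Sum>j\<in>J. c j * f j v) + (\<Sum>j\<in>J. c j * f j w)"
    by (simp add: sum.distrib)
next
  fix a v assume "v \<in> W"
  then have "\<And>j. j \<in> J \<Longrightarrow> c j * f j (scale a v) = a * (c j * f j v)"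
    using assms(2) unfolding lin_functional_on_def by (simp add: mult.left_commute)
  then show "(\<Sum>j\<in>J. c j * f j (scale a v)) = a * (\<Sum>j\<in>J. c j * f j v)"
    unfolding sum_distrib_left by (intro sum.cong refl)
qed

lemma lin_functional_on_diff:
  "lin_functional_on W f \<Longrightarrow> lin_functional_on W g \<Longrightarrow> lin_functional_on W (\<lambda>v. f v - g v)"
  unfolding lin_functional_on_def by (simp add: algebra_simps)

lemma lin_functional_on_sum:
  assumes "lin_functional_on W f" "subspace W" "finite S" "\<And>s. s \<in> S \<Longrightarrow> x s \<in> W"
  shows "f (\<Sum>s\<in>S. scale (a s) (x s)) = (\<Sum>s\<in>S. a s * f (x s))"
  using assms(3,4)
proof (induction S rule: finite_induct)
  case empty
  have "f (scale 0 0) = 0 * f 0" using assms(1) subspace_0[OF assms(2)] unfolding lin_functional_on_def by blast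
  then show ?case by simp
next
  case (insert s S)
  have "scale (a s) (x s) \<in> W" "(\<Sum>s\<in>S. scale (a s) (x s)) \<in> W"
    using insert assms(2) by (auto intro!: subspace_scale subspace_sum)
  then have "f (scale (a s) (x s) + (\<Sum>s\<in>S. scale (a s) (x s))) = a s * f (x s) + f (\<Sum>s\<in>S. scale (a s) (x s))"
    using assms(1) insert.prems unfolding lin_functional_on_def by simp
  then show ?case using insert by simp
qed

text \<open>Adding one functional at a time, the step replaces the space by the kernel of the new
  functional, on which the induction hypothesis applies; what is left is a functional that
  vanishes on a hyperplane.\<close>

lemma functional_in_span_of_kernels:
  assumes "finite J" "subspace W"
    and "\<And>j. j \<in> J \<Longrightarrow> lin_functional_on W (f j)" and "lin_functional_on W g"
    and "\<And>v. v \<in> W \<Longrightarrow> (\<And>j. j \<in> J \<Longrightarrow> f j v = 0) \<Longrightarrow> g v = 0"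
  shows "\<exists>c. \<forall>v\<in>W. g v = (\<Sum>j\<in>J. c j * f j v)"
  using assms
proof (induction J arbitrary: W g rule: finite_induct)
  case empty
  then show ?case by simp
next
  case (insert i J)
  define W' where "W' = {v\<in>W. f i v = 0}"
  have lini: "lin_functional_on W (f i)" using insert.prems(2) by simp
  have f0: "f i 0 = 0"
  proof -
    have "f i (scale 0 0) = 0 * f i 0" using lini subspace_0[OF insert.prems(1)] unfolding lin_functional_on_def by blast
    then show ?thesis by simp
  qed
  have W': "subspace W'"
    unfolding W'_def using insert.prems(1) lini f0
    by (auto simp: subspace_def lin_functional_on_def)
  have sub: "W' \<subseteq> W" unfolding W'_def by auto
  obtain c where c: "\<And>v. v \<in> W' \<Longrightarrow> g v = (\<Sum>j\<in>J. c j * f j v)"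
  proof -
    have "\<exists>c. \<forall>v\<in>W'. g v = (\<Sum>j\<in>J. c j * f j v)"
    proof (rule insert.IH[OF W'])
      show "\<And>j. j \<in> J \<Longrightarrow> lin_functional_on W' (f j)"
        using insert.prems(2) sub lin_functional_on_subset by blast
      show "lin_functional_on W' g" using insert.prems(3) sub lin_functional_on_subset by blast
      show "\<And>v. v \<in> W' \<Longrightarrow> (\<And>j. j \<in> J \<Longrightarrow> f j v = 0) \<Longrightarrow> g v = 0"
        using insert.prems(4) unfolding W'_def by auto
    qed
    then show thesis using that by blast
  qed
  define r where "r v = g v - (\<Sum>j\<in>J. c j * f j v)" for v
  have linr: "lin_functional_on W r"
    unfolding r_def using insert.prems(2,3) insert.hyps(1)
    by (intro lin_functional_on_diff lin_functional_on_lincomb) auto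
  have r0: "r v = 0" if "v \<in> W'" for v using c[OF that] unfolding r_def by simp
  show ?case
  proof (cases "\<exists>w\<in>W. f i w \<noteq> 0")
    case False
    then have "W' = W" unfolding W'_def by auto
    then have "\<forall>v\<in>W. g v = (\<Sum>j\<in>insert i J. (c(i := 0)) j * f j v)"
      using c insert.hyps by (auto intro!: sum.cong)
    then show ?thesis by blast
  next
    case True
    then obtain w where w: "w \<in> W" "f i w \<noteq> 0" by blast
    define a where "a = r w / f i w"
    have "r v = a * f i v" if v: "v \<in> W" for v
    proof -
      define b where "b = - (f i v / f i w)"
      have bw: "scale b w \<in> W" using w(1) insert.prems(1) by (rule subspace_scale[rotated])
      then have "v + scale b w \<in> W" using v insert.prems(1) by (simp add: subspace_add)
      moreover have "f i (v + scale b w) = 0"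
      proof -
        have "f i (v + scale b w) = f i v + b * f i w"
          using lini v w(1) bw unfolding lin_functional_on_def by simp
        then show ?thesis using w(2) unfolding b_def by simp
      qed
      ultimately have "r (v + scale b w) = 0" using r0 unfolding W'_def by simp
      then have "r v + b * r w = 0" using linr v w bw unfolding lin_functional_on_def by simp
      then show ?thesis unfolding b_def a_def by (simp add: field_simps)
    qed
    then have "\<forall>v\<in>W. g v = (\<Sum>j\<in>insert i J. (c(i := a)) j * f j v)"
      using insert.hyps unfolding r_def by (auto simp: algebra_simps intro!: sum.cong)
    then show ?thesis by blast
  qed
qed

lemma separating_vector:
  assumes W: "subspace W" and f: "lin_functional_on W f" and g: "lin_functional_on W g"
    and ind: "\<And>c. \<exists>v\<in>W. f v \<noteq> c * g v"
  shows "\<exists>v\<in>W. f v = 1 \<and> g v = 0"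
proof (rule ccontr)
  assume no: "\<not> ?thesis"
  have "\<exists>c. \<forall>v\<in>W. f v = (\<Sum>j\<in>{()}. c j * g v)"
  proof (rule functional_in_span_of_kernels[OF _ W])
    fix v assume v: "v \<in> W" and "\<And>j. j \<in> {()} \<Longrightarrow> g v = 0"
    then have gv: "g v = 0" by simp
    show "f v = 0"
    proof (rule ccontr)
      assume nz: "f v \<noteq> 0"
      have "scale (1 / f v) v \<in> W" using W v by (rule subspace_scale)
      moreover have "f (scale (1 / f v) v) = 1" "g (scale (1 / f v) v) = 0"
        using f g v nz gv unfolding lin_functional_on_def by auto
      ultimately show False using no by blast
    qed
  qed (use f g in auto)
  then show False using ind by auto
qed

definition lin_endo_on :: "'b set \<Rightarrow> ('b \<Rightarrow> 'b) \<Rightarrow> bool"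
  where "lin_endo_on V f \<longleftrightarrow> (\<forall>v\<in>V. f v \<in> V) \<and>
    (\<forall>v\<in>V. \<forall>w\<in>V. f (v + w) = f v + f w) \<and> (\<forall>a. \<forall>v\<in>V. f (scale a v) = scale a (f v))"

lemma lin_endo_on_comp: "lin_endo_on V f \<Longrightarrow> lin_endo_on V g \<Longrightarrow> lin_endo_on V (\<lambda>v. f (g v))"
  unfolding lin_endo_on_def by (auto)

lemma lin_endo_on_funpow: "lin_endo_on V f \<Longrightarrow> lin_endo_on V (f ^^ n)"
  by (induction n) (auto simp: lin_endo_on_def)

lemma lin_endo_on_sum:
  assumes "lin_endo_on V f" "subspace V" "finite S" "\<And>s. s \<in> S \<Longrightarrow> x s \<in> V"
  shows "f (\<Sum>s\<in>S. scale (a s) (x s)) = (\<Sum>s\<in>S. scale (a s) (f (x s)))"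
  using assms(3,4)
proof (induction S rule: finite_induct)
  case empty
  have "f (scale 0 0) = scale 0 (f 0)" using assms(1) subspace_0[OF assms(2)] unfolding lin_endo_on_def by blast
  then show ?case by simp
next
  case (insert s S)
  have "scale (a s) (x s) \<in> V" "(\<Sum>s\<in>S. scale (a s) (x s)) \<in> V"
    using insert assms(2) by (auto intro!: subspace_scale subspace_sum)
  then have "f (scale (a s) (x s) + (\<Sum>s\<in>S. scale (a s) (x s))) = scale (a s) (f (x s)) + f (\<Sum>s\<in>S. scale (a s) (x s))"
    using assms(1) insert.prems unfolding lin_endo_on_def by simp
  then show ?case using insert by simp
qed

definition trace_wrt :: "'b set \<Rightarrow> ('b \<Rightarrow> 'b) \<Rightarrow> 'a"
  where "trace_wrt B f = (\<Sum>b\<in>B. representation B (f b) b)"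

lemma trace_wrt_cong: "(\<And>v. v \<in> span B \<Longrightarrow> f v = g v) \<Longrightarrow> trace_wrt B f = trace_wrt B g"
  unfolding trace_wrt_def by (intro sum.cong) (auto simp: span_base)

lemma trace_wrt_diff:
  assumes "independent B" "lin_endo_on (span B) f" "lin_endo_on (span B) g"
  shows "trace_wrt B (\<lambda>v. f v - g v) = trace_wrt B f - trace_wrt B g"
  unfolding trace_wrt_def sum_subtractf[symmetric]
proof (rule sum.cong)
  fix b assume "b \<in> B"
  then have "f b \<in> span B" "g b \<in> span B"
    using assms(2,3) by (auto simp: lin_endo_on_def span_base)
  then show "representation B (f b - g b) b = representation B (f b) b - representation B (g b) b"
    using representation_diff[OF assms(1)] by simp
qed simp

lemma trace_wrt_commute:
  assumes "finite B" "independent B" "lin_endo_on (span B) f" "lin_endo_on (span B) g"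
  shows "trace_wrt B (\<lambda>v. f (g v)) = trace_wrt B (\<lambda>v. g (f v))"
proof -
  have expand: "representation B (f (g b)) b
      = (\<Sum>c\<in>B. representation B (g b) c * representation B (f c) b)"
    if "b \<in> B" "lin_endo_on (span B) f" "lin_endo_on (span B) g" for f g b
  proof -
    have gb: "g b \<in> span B" using that by (auto simp: lin_endo_on_def span_base)
    have "g b = (\<Sum>c\<in>B. scale (representation B (g b) c) c)"
      using sum_representation_eq[OF assms(2) gb assms(1)] by simp
    then have "f (g b) = (\<Sum>c\<in>B. scale (representation B (g b) c) (f c))"
      using lin_endo_on_sum[OF that(2) subspace_span assms(1), of "\<lambda>c. c"] by (metis span_base)
    moreover have fc: "\<And>c. c \<in> B \<Longrightarrow> f c \<in> span B"
      using that by (auto simp: lin_endo_on_def span_base)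
    ultimately show ?thesis
      using representation_sum[OF assms(2), of B "\<lambda>c. scale (representation B (g b) c) (f c)"]
      by (simp add: span_scale representation_scale[OF assms(2)])
  qed
  have "trace_wrt B (\<lambda>v. f (g v))
      = (\<Sum>b\<in>B. \<Sum>c\<in>B. representation B (g b) c * representation B (f c) b)"
    unfolding trace_wrt_def using expand assms(3,4) by simp
  also have "\<dots> = (\<Sum>b\<in>B. \<Sum>c\<in>B. representation B (f b) c * representation B (g c) b)"
    by (subst sum.swap) (simp add: mult.commute)
  also have "\<dots> = trace_wrt B (\<lambda>v. g (f v))"
    unfolding trace_wrt_def using expand assms(3,4) by simp
  finally show ?thesis .
qed

lemma trace_wrt_rank_one:
  assumes "finite B" "independent B" "lin_functional_on (span B) \<phi>" "w \<in> span B"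
  shows "trace_wrt B (\<lambda>v. scale (\<phi> v) w) = \<phi> w"
proof -
  have "trace_wrt B (\<lambda>v. scale (\<phi> v) w) = (\<Sum>b\<in>B. representation B w b * \<phi> b)"
    unfolding trace_wrt_def by (simp add: representation_scale[OF assms(2,4)] mult.commute)
  also have "\<dots> = \<phi> (\<Sum>b\<in>B. scale (representation B w b) b)"
    using lin_functional_on_sum[OF assms(3) subspace_span assms(1), of "\<lambda>b. b"] by (simp add: span_base)
  also have "\<dots> = \<phi> w" using sum_representation_eq[OF assms(2,4,1)] by simp
  finally show ?thesis .
qed

lemma trace_wrt_sum:
  assumes "independent B" "finite S" "\<And>s b. s \<in> S \<Longrightarrow> b \<in> B \<Longrightarrow> f s b \<in> span B"
  shows "trace_wrt B (\<lambda>v. \<Sum>s\<in>S. f s v) = (\<Sum>s\<in>S. trace_wrt B (f s))"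
proof -
  have "trace_wrt B (\<lambda>v. \<Sum>s\<in>S. f s v) = (\<Sum>b\<in>B. \<Sum>s\<in>S. representation B (f s b) b)"
    unfolding trace_wrt_def
    using representation_sum[OF assms(1), of S] assms(3) by (intro sum.cong) simp_all
  then show ?thesis unfolding trace_wrt_def by (simp add: sum.swap[of _ S])
qed

text \<open>Comparing the two ways to compute the trace of
  \<open>[X, Y] X\<^sup>a Y\<^sup>b\<close> gives \<open>c (X\<^sup>a Y\<^sup>b u) = - a * c (X\<^sup>a Y\<^sup>b u)\<close>, by induction on \<open>a + b\<close>: the shorter
  monomials are already known to be killed by \<open>c\<close>, so that the order of the
  factors is irrelevant when monomials of the current length act on \<open>u\<close>.\<close>

lemma rank_one_commutator:
  assumes char0: "\<And>n. of_nat (Suc n) \<noteq> (0::'a)"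
    and B: "finite B" "independent B"
    and X: "lin_endo_on (span B) X" and Y: "lin_endo_on (span B) Y"
    and c: "lin_functional_on (span B) c" and u: "u \<in> span B"
    and comm: "\<And>v. v \<in> span B \<Longrightarrow> X (Y v) - Y (X v) = scale (c v) u"
  shows "Y ((X ^^ a) ((Y ^^ b) u)) = (X ^^ a) ((Y ^^ Suc b) u)"
proof -
  let ?V = "span B"
  have XV: "\<And>v. v \<in> ?V \<Longrightarrow> X v \<in> ?V" and YV: "\<And>v. v \<in> ?V \<Longrightarrow> Y v \<in> ?V"
    using X Y unfolding lin_endo_on_def by auto
  have XnV: "(X ^^ n) v \<in> ?V" if "v \<in> ?V" for n v using that XV by (induction n) auto
  have YnV: "(Y ^^ n) v \<in> ?V" if "v \<in> ?V" for n v using that YV by (induction n) auto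
  have Xdiff: "X (v - w) = X v - X w" if "v \<in> ?V" "w \<in> ?V" for v w
  proof -
    have "X (v - w + w) = X (v - w) + X w"
      using that X unfolding lin_endo_on_def by (meson span_diff)
    then show ?thesis by (simp add: algebra_simps)
  qed
  have YX: "Y (X v) = X (Y v) - scale (c v) u" if "v \<in> ?V" for v
    using comm[OF that] by (simp add: algebra_simps)
  have vanish: "c ((X ^^ a) ((Y ^^ b) u)) = 0" if "a + b = n" for n a b
    using that
  proof (induction n arbitrary: a b rule: less_induct)
    case (less n)
    have swap1: "Y ((X ^^ r) ((Y ^^ q) u)) = (X ^^ r) ((Y ^^ Suc q) u)" if "r + q \<le> n" for r q
      using that
    proof (induction r)
      case (Suc r)
      have "Y ((X ^^ Suc r) ((Y ^^ q) u)) = X (Y ((X ^^ r) ((Y ^^ q) u)))"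
        using YX[of "(X ^^ r) ((Y ^^ q) u)"] less.IH[of "r + q" r q] Suc.prems XnV YnV u by simp
      then show ?case using Suc by simp
    qed simp
    have swap: "(Y ^^ q) ((X ^^ m) u) = (X ^^ m) ((Y ^^ q) u)" if "m + q \<le> Suc n" for m q
      using that by (induction q) (use swap1 in auto)
    have push: "Y ((X ^^ m) w) - (X ^^ m) (Y w)
        = - (\<Sum>r<m. scale (c ((X ^^ (m - 1 - r)) w)) ((X ^^ r) u))" if w: "w \<in> ?V" for m w
    proof (induction m)
      case (Suc m)
      let ?S = "\<Sum>r<m. scale (c ((X ^^ (m - 1 - r)) w)) ((X ^^ r) u)"
      have SV: "?S \<in> ?V" using XnV u by (intro span_sum span_scale) auto
      have "Y ((X ^^ Suc m) w) = X (Y ((X ^^ m) w)) - scale (c ((X ^^ m) w)) u"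
        using YX XnV w by simp
      also have "Y ((X ^^ m) w) = (X ^^ m) (Y w) - ?S" using Suc.IH by (simp add: algebra_simps)
      also have "X ((X ^^ m) (Y w) - ?S) = (X ^^ Suc m) (Y w) - X ?S"
        using Xdiff XnV YV w SV by simp
      also have "X ?S = (\<Sum>r<m. scale (c ((X ^^ (m - 1 - r)) w)) ((X ^^ Suc r) u))"
        using lin_endo_on_sum[OF X subspace_span, of "{..<m}" "\<lambda>r. (X ^^ r) u"] XnV u by simp
      finally have "Y ((X ^^ Suc m) w) - (X ^^ Suc m) (Y w) = - (scale (c ((X ^^ m) w)) u
          + (\<Sum>r<m. scale (c ((X ^^ (m - 1 - r)) w)) ((X ^^ Suc r) u)))"
        by (simp add: algebra_simps)
      moreover have "(\<Sum>r<Suc m. scale (c ((X ^^ (Suc m - 1 - r)) w)) ((X ^^ r) u))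
          = scale (c ((X ^^ m) w)) u
            + (\<Sum>r<m. scale (c ((X ^^ (m - 1 - r)) w)) ((X ^^ Suc r) u))"
        by (subst sum.lessThan_Suc_shift) simp
      ultimately show ?case by (simp only:)
    qed simp
    define W where "W v = (X ^^ a) ((Y ^^ b) v)" for v
    have linW: "lin_endo_on ?V W"
      unfolding W_def
      by (rule lin_endo_on_comp[OF lin_endo_on_funpow[OF X] lin_endo_on_funpow[OF Y]])
    have linXW: "lin_endo_on ?V (\<lambda>v. X (W v))" by (rule lin_endo_on_comp[OF X linW])
    have linYW: "lin_endo_on ?V (\<lambda>v. Y (W v))" by (rule lin_endo_on_comp[OF Y linW])
    have linWY: "lin_endo_on ?V (\<lambda>v. W (Y v))" by (rule lin_endo_on_comp[OF linW Y])
    have WV: "\<And>v. v \<in> ?V \<Longrightarrow> W v \<in> ?V" unfolding W_def using XnV YnV by blast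
    have lincW: "lin_functional_on ?V (\<lambda>v. c (W v))"
      using c linW WV unfolding lin_functional_on_def lin_endo_on_def by simp
    have "trace_wrt B (\<lambda>v. X (Y (W v)) - Y (X (W v))) = trace_wrt B (\<lambda>v. scale (c (W v)) u)"
      by (rule trace_wrt_cong) (use comm WV in simp)
    also have "\<dots> = c (W u)" by (rule trace_wrt_rank_one[OF B lincW u])
    finally have e1: "trace_wrt B (\<lambda>v. X (Y (W v)) - Y (X (W v))) = c (W u)" .
    have "trace_wrt B (\<lambda>v. X (Y (W v)) - Y (X (W v)))
        = trace_wrt B (\<lambda>v. X (Y (W v))) - trace_wrt B (\<lambda>v. Y (X (W v)))"
      by (rule trace_wrt_diff[OF B(2) lin_endo_on_comp[OF X linYW] lin_endo_on_comp[OF Y linXW]])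
    also have "trace_wrt B (\<lambda>v. Y (X (W v))) = trace_wrt B (\<lambda>v. X (W (Y v)))"
      by (rule trace_wrt_commute[OF B Y linXW])
    also have "trace_wrt B (\<lambda>v. X (Y (W v))) - trace_wrt B (\<lambda>v. X (W (Y v)))
        = trace_wrt B (\<lambda>v. X (Y (W v)) - X (W (Y v)))"
      by (rule trace_wrt_diff[OF B(2) lin_endo_on_comp[OF X linYW] lin_endo_on_comp[OF X linWY], symmetric])
    also have "\<dots> = trace_wrt B (\<lambda>v. \<Sum>r<a. scale (- c ((X ^^ (a - 1 - r)) ((Y ^^ b) v))) ((X ^^ Suc r) u))"
    proof (rule trace_wrt_cong)
      fix v assume v: "v \<in> ?V"
      have "X (Y (W v)) - X (W (Y v)) = X (Y (W v) - W (Y v))" using Xdiff YV WV v by simp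
      also have "Y (W v) - W (Y v)
          = (\<Sum>r<a. scale (- c ((X ^^ (a - 1 - r)) ((Y ^^ b) v))) ((X ^^ r) u))"
        using push[of "(Y ^^ b) v" a] YnV[OF v] unfolding W_def
        by (simp add: sum_negf funpow_swap1[of Y b v])
      also have "X \<dots> = (\<Sum>r<a. scale (- c ((X ^^ (a - 1 - r)) ((Y ^^ b) v))) ((X ^^ Suc r) u))"
        using lin_endo_on_sum[OF X subspace_span, of "{..<a}" "\<lambda>r. (X ^^ r) u"
          "\<lambda>r. - c ((X ^^ (a - 1 - r)) ((Y ^^ b) v))"] XnV u by simp
      finally show "X (Y (W v)) - X (W (Y v))
        = (\<Sum>r<a. scale (- c ((X ^^ (a - 1 - r)) ((Y ^^ b) v))) ((X ^^ Suc r) u))" .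
    qed
    also have "\<dots> = (\<Sum>r<a. trace_wrt B (\<lambda>v. scale (- c ((X ^^ (a - 1 - r)) ((Y ^^ b) v))) ((X ^^ Suc r) u)))"
      by (rule trace_wrt_sum[OF B(2)]) (use XnV[OF u] in \<open>auto intro!: span_neg span_scale simp del: funpow.simps\<close>)
    also have "\<dots> = (\<Sum>r<a. - c (W u))"
    proof (rule sum.cong)
      fix r assume r: "r \<in> {..<a}"
      define Z where "Z v = (X ^^ (a - 1 - r)) ((Y ^^ b) v)" for v
      have linZ: "lin_endo_on ?V Z"
        unfolding Z_def
        by (rule lin_endo_on_comp[OF lin_endo_on_funpow[OF X] lin_endo_on_funpow[OF Y]])
      then have "lin_functional_on ?V (\<lambda>v. - c (Z v))"
        using c unfolding lin_functional_on_def lin_endo_on_def by (auto)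
      then have "trace_wrt B (\<lambda>v. scale (- c (Z v)) ((X ^^ Suc r) u)) = - c (Z ((X ^^ Suc r) u))"
        by (rule trace_wrt_rank_one[OF B]) (rule XnV[OF u])
      moreover have "Z ((X ^^ Suc r) u) = W u"
      proof -
        have "Z ((X ^^ Suc r) u) = (X ^^ (a - 1 - r)) ((X ^^ Suc r) ((Y ^^ b) u))"
          unfolding Z_def using swap[of "Suc r" b] r less.prems by (simp only: lessThan_iff)
        also have "\<dots> = (X ^^ (a - 1 - r + Suc r)) ((Y ^^ b) u)"
          by (simp only: funpow_add o_apply)
        also have "a - 1 - r + Suc r = a" using r by simp
        finally show ?thesis unfolding W_def .
      qed
      ultimately show "trace_wrt B (\<lambda>v. scale (- c ((X ^^ (a - 1 - r)) ((Y ^^ b) v))) ((X ^^ Suc r) u)) = - c (W u)"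
        unfolding Z_def by simp
    qed simp
    finally have "c (W u) = - (of_nat a * c (W u))" using e1 by simp
    then have "c (W u) + of_nat a * c (W u) = 0" by (simp only: eq_neg_iff_add_eq_0)
    then have "of_nat (Suc a) * c (W u) = 0" by (simp add: distrib_right)
    then show ?case using char0[of a] unfolding W_def by (simp del: of_nat_Suc)
  qed
  show ?thesis
  proof (induction a)
    case (Suc a)
    then show ?case using YX[of "(X ^^ a) ((Y ^^ b) u)"] vanish[of a b] XnV YnV u by simp
  qed simp
qed

end

section \<open>Graded modules with a duality\<close>

text \<open>An abstract form of \<open>A \<otimes> K\<close> for a graded Gorenstein algebra \<open>A\<close> over \<open>k\<close> with socle degree \<open>N - 2\<close>, over
the field \<open>K\<close> of rational functions in the coefficients of a linear form. The operator \<open>L\<close> is the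
multiplication by the generic linear form, \<open>Y False\<close> and \<open>Y True\<close> are the multiplications by two
variables, and \<open>D m\<close> is the derivation with respect to the coefficient in \<open>L\<close> of the variable
\<open>Y m\<close>; this is the meaning of the rule for \<open>D m (L v)\<close>. The variables are killed by the
derivations because they have coefficients in \<open>k\<close>. A third variable is not mentioned: it
is a combination of \<open>L\<close> and the other two.

Degrees are shifted by one, so that \<open>A j\<close> stands for the component of degree \<open>j - 1\<close> and the component
below the lowest degree, \<open>A 0\<close>, is zero. Statements about \<open>L ` A (j - 1)\<close> then need no special case.\<close>

locale graded_duality = linear_space scale
  for scale :: "'k::field \<Rightarrow> 'v::ab_group_add \<Rightarrow> 'v" +
  fixes N :: nat and A :: "nat \<Rightarrow> 'v set"
    and L :: "'v \<Rightarrow> 'v" and Y :: "bool \<Rightarrow> 'v \<Rightarrow> 'v"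
    and pair :: "nat \<Rightarrow> 'v \<Rightarrow> 'v \<Rightarrow> 'k"
    and D :: "bool \<Rightarrow> 'v \<Rightarrow> 'v" and d :: "bool \<Rightarrow> 'k \<Rightarrow> 'k"
  assumes char0: "of_nat (Suc n) \<noteq> (0::'k)"
    and A_sub: "subspace (A j)" and A_fin: "\<exists>B. finite B \<and> A j = span B" and A_0: "A 0 = {0}"
    and L_lin: "Vector_Spaces.linear scale scale L" and Y_lin: "Vector_Spaces.linear scale scale (Y m)"
    and L_closed: "v \<in> A j \<Longrightarrow> L v \<in> A (Suc j)" and Y_closed: "v \<in> A j \<Longrightarrow> Y m v \<in> A (Suc j)"
    and YL: "Y m (L v) = L (Y m v)" and YY: "Y m (Y m' v) = Y m' (Y m v)"
    and D_add: "D m (v + w) = D m v + D m w"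
    and D_scale: "D m (scale c v) = scale c (D m v) + scale (d m c) v"
    and d_of_nat: "d m (of_nat n) = 0"
    and D_closed: "v \<in> A j \<Longrightarrow> D m v \<in> A j"
    and DD: "D m (D m' v) = D m' (D m v)" and DY: "D m (Y m' v) = Y m' (D m v)"
    and DL: "D m (L v) = L (D m v) + Y m v"
    and pair_lin: "j \<le> N \<Longrightarrow> b \<in> A (N - j) \<Longrightarrow> lin_functional_on (A j) (\<lambda>a. pair j a b)"
    and pair_sym: "j \<le> N \<Longrightarrow> a \<in> A j \<Longrightarrow> b \<in> A (N - j) \<Longrightarrow> pair j a b = pair (N - j) b a"
    and pair_L: "Suc j \<le> N \<Longrightarrow> a \<in> A j \<Longrightarrow> b \<in> A (N - Suc j) \<Longrightarrow> pair (Suc j) (L a) b = pair j a (L b)"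
    and pair_Y: "Suc j \<le> N \<Longrightarrow> a \<in> A j \<Longrightarrow> b \<in> A (N - Suc j) \<Longrightarrow> pair (Suc j) (Y m a) b = pair j a (Y m b)"
    and nondeg: "j \<le> N \<Longrightarrow> a \<in> A j \<Longrightarrow> (\<And>b. b \<in> A (N - j) \<Longrightarrow> pair j a b = 0) \<Longrightarrow> a = 0"
    and socle: "Suc j < N \<Longrightarrow> a \<in> A j \<Longrightarrow> L a = 0 \<Longrightarrow> (\<And>m. Y m a = 0) \<Longrightarrow> a = 0"
begin

sublocale L: Vector_Spaces.linear scale scale L by (rule L_lin)
sublocale Y: Vector_Spaces.linear scale scale "Y m" for m by (rule Y_lin)

lemma A_zero [simp]: "0 \<in> A j" using A_sub subspace_0 by blast
lemma A_add: "v \<in> A j \<Longrightarrow> w \<in> A j \<Longrightarrow> v + w \<in> A j" using A_sub subspace_add by blast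
lemma A_diff: "v \<in> A j \<Longrightarrow> w \<in> A j \<Longrightarrow> v - w \<in> A j" using A_sub subspace_diff by blast
lemma A_scale: "v \<in> A j \<Longrightarrow> scale a v \<in> A j" using A_sub subspace_scale by blast
lemma A_sum: "(\<And>s. s \<in> S \<Longrightarrow> f s \<in> A j) \<Longrightarrow> sum f S \<in> A j" using A_sub subspace_sum by blast

lemmas A_intros = A_zero A_add A_diff A_scale A_sum L_closed Y_closed D_closed

lemma pair_add: "j \<le> N \<Longrightarrow> b \<in> A (N - j) \<Longrightarrow> v \<in> A j \<Longrightarrow> w \<in> A j \<Longrightarrow> pair j (v + w) b = pair j v b + pair j w b"
  using pair_lin unfolding lin_functional_on_def by blast

lemma pair_scale: "j \<le> N \<Longrightarrow> b \<in> A (N - j) \<Longrightarrow> v \<in> A j \<Longrightarrow> pair j (scale c v) b = c * pair j v b"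
  using pair_lin unfolding lin_functional_on_def by blast

lemma pair_diff: "j \<le> N \<Longrightarrow> b \<in> A (N - j) \<Longrightarrow> v \<in> A j \<Longrightarrow> w \<in> A j \<Longrightarrow> pair j (v - w) b = pair j v b - pair j w b"
  using pair_add[of j b "v - w" w] A_diff[of v j w] by (simp add: algebra_simps)

lemma pair_zero: "j \<le> N \<Longrightarrow> b \<in> A (N - j) \<Longrightarrow> pair j 0 b = 0"
  using pair_diff[of j b 0 0] by simp

lemma pair_lin_right:
  assumes "j \<le> N" "a \<in> A j" shows "lin_functional_on (A (N - j)) (pair j a)"
proof -
  have "lin_functional_on (A (N - j)) (\<lambda>b. pair (N - j) b a)" using assms pair_lin[of "N - j" a] by simp
  moreover have "\<And>b. b \<in> A (N - j) \<Longrightarrow> pair j a b = pair (N - j) b a" using assms pair_sym by blast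
  ultimately show ?thesis unfolding lin_functional_on_def by (simp add: A_intros)
qed

lemma Lpow_closed: "v \<in> A j \<Longrightarrow> (L ^^ n) v \<in> A (j + n)"
  by (induction n) (auto intro: L_closed)

lemma Lpow_add: "(L ^^ n) (v + w) = (L ^^ n) v + (L ^^ n) w" by (induction n) (auto simp: L.add)
lemma Lpow_diff: "(L ^^ n) (v - w) = (L ^^ n) v - (L ^^ n) w" by (induction n) (auto simp: L.diff)
lemma Lpow_scale: "(L ^^ n) (scale c v) = scale c ((L ^^ n) v)" by (induction n) (auto simp: L.scale)
lemma Lpow_zero: "(L ^^ n) 0 = 0" by (induction n) (auto simp: L.zero)

lemma YLpow: "Y m ((L ^^ n) v) = (L ^^ n) (Y m v)"
  by (induction n) (auto simp: YL)

lemma DLpow: "D m ((L ^^ Suc n) v) = (L ^^ Suc n) (D m v) + scale (of_nat (Suc n)) ((L ^^ n) (Y m v))"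
proof (induction n)
  case 0
  then show ?case by (simp add: DL)
next
  case (Suc n)
  have "D m ((L ^^ Suc (Suc n)) v) = L (D m ((L ^^ Suc n) v)) + (L ^^ Suc n) (Y m v)"
    using DL[of m "(L ^^ Suc n) v"] YLpow[of m "Suc n" v] by simp
  moreover have "(of_nat (Suc (Suc n)) :: 'k) = of_nat (Suc n) + 1" by simp
  ultimately show ?case unfolding Suc.IH by (simp add: L.add L.scale scale_left_distrib add.assoc del: of_nat_Suc)
qed

lemma D_zero: "D m 0 = 0" using D_add[of m 0 0] by simp
lemma D_diff: "D m (v - w) = D m v - D m w" using D_add[of m "v - w" w] by (simp add: algebra_simps)

lemma vanish_on_span:
  assumes "finite B" "lin_functional_on (span B) f" "\<And>b. b \<in> B \<Longrightarrow> f b = 0" "v \<in> span B"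
  shows "f v = 0"
proof -
  obtain u where "v = (\<Sum>b\<in>B. scale (u b) b)" using assms(4) span_finite[OF assms(1)] by auto
  then have "f v = (\<Sum>b\<in>B. u b * f b)"
    using lin_functional_on_sum[OF assms(2) subspace_span assms(1), of "\<lambda>b. b" u] by (simp add: span_base)
  then show ?thesis using assms(3) by simp
qed

text \<open>The image of \<open>L\<close> is the orthogonal complement of the kernel of \<open>L\<close>: a functional that
  vanishes on the kernel is a combination of the functionals \<open>\<langle>L b, \<cdot>\<rangle>\<close>, which cut it out.\<close>

lemma in_image_L:
  assumes j: "1 \<le> j" "j \<le> N" and z: "z \<in> A j"
    and perp: "\<And>\<kappa>. \<kappa> \<in> A (N - j) \<Longrightarrow> L \<kappa> = 0 \<Longrightarrow> pair j z \<kappa> = 0"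
  shows "z \<in> L ` A (j - 1)"
proof -
  obtain B where B: "finite B" "A (j - 1) = span B" using A_fin by blast
  have BA: "b \<in> A (j - 1)" if "b \<in> B" for b using that B(2) span_base by blast
  have LB: "L b \<in> A j" if "b \<in> A (j - 1)" for b using L_closed[OF that] j by simp
  have "\<exists>c. \<forall>\<kappa>\<in>A (N - j). pair j z \<kappa> = (\<Sum>b\<in>B. c b * pair j (L b) \<kappa>)"
  proof (rule functional_in_span_of_kernels[OF B(1) A_sub])
    show "\<And>b. b \<in> B \<Longrightarrow> lin_functional_on (A (N - j)) (pair j (L b))"
      using pair_lin_right j LB BA by blast
    show "lin_functional_on (A (N - j)) (pair j z)" using pair_lin_right j z by blast
    fix \<kappa> assume \<kappa>: "\<kappa> \<in> A (N - j)" and 0: "\<And>b. b \<in> B \<Longrightarrow> pair j (L b) \<kappa> = 0"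
    have L\<kappa>: "L \<kappa> \<in> A (N - (j - 1))" using L_closed[OF \<kappa>] j by (simp add: Suc_diff_le)
    have "pair (j - 1) b (L \<kappa>) = 0" if "b \<in> B" for b
      using pair_L[of "j - 1" b \<kappa>] j BA[OF that] \<kappa> 0[OF that] by simp
    then have z0: "pair (j - 1) b (L \<kappa>) = 0" if "b \<in> A (j - 1)" for b
      using vanish_on_span[OF B(1), of "\<lambda>b. pair (j - 1) b (L \<kappa>)" b] pair_lin[of "j - 1" "L \<kappa>"] L\<kappa> j that
      unfolding B(2) by simp
    have "L \<kappa> = 0"
    proof (rule nondeg[of "N - (j - 1)", OF _ L\<kappa>])
      fix b assume "b \<in> A (N - (N - (j - 1)))"
      then have b: "b \<in> A (j - 1)" using j by simp
      then show "pair (N - (j - 1)) (L \<kappa>) b = 0"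
        using z0[OF b] pair_sym[of "j - 1" b "L \<kappa>"] j L\<kappa> by simp
    qed simp
    then show "pair j z \<kappa> = 0" using perp[OF \<kappa>] by simp
  qed
  then obtain c where c: "\<And>\<kappa>. \<kappa> \<in> A (N - j) \<Longrightarrow> pair j z \<kappa> = (\<Sum>b\<in>B. c b * pair j (L b) \<kappa>)" by blast
  define w where "w = (\<Sum>b\<in>B. scale (c b) b)"
  have w: "w \<in> A (j - 1)" unfolding w_def using BA by (intro A_sum A_scale) auto
  have Lw: "L w = (\<Sum>b\<in>B. scale (c b) (L b))" unfolding w_def by (simp add: L.sum L.scale)
  have "z - L w = 0"
  proof (rule nondeg[OF j(2)])
    show "z - L w \<in> A j" using z w LB by (intro A_diff)
    fix \<kappa> assume \<kappa>: "\<kappa> \<in> A (N - j)"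
    have "pair j (L w) \<kappa> = (\<Sum>b\<in>B. c b * pair j (L b) \<kappa>)"
      unfolding Lw using lin_functional_on_sum[OF pair_lin[OF j(2) \<kappa>] A_sub B(1), of "\<lambda>b. L b" c] BA LB by auto
    then show "pair j (z - L w) \<kappa> = 0" using pair_diff[OF j(2) \<kappa> z] LB[OF w] c[OF \<kappa>] by simp
  qed
  then show ?thesis using w by auto
qed

lemma separating_kernel_element:
  assumes j: "1 \<le> j" "j \<le> N" and z: "z \<in> A j" "w \<in> A j"
    and ind: "\<And>c. z - scale c w \<notin> L ` A (j - 1)"
  shows "\<exists>\<kappa>\<in>A (N - j). L \<kappa> = 0 \<and> pair j z \<kappa> = 1 \<and> pair j w \<kappa> = 0"
proof -
  define W where "W = {\<kappa> \<in> A (N - j). L \<kappa> = 0}"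
  have W: "subspace W" unfolding W_def subspace_def by (auto simp: A_intros L.add L.scale L.zero)
  have lin: "lin_functional_on W (pair j x)" if "x \<in> A j" for x
    using lin_functional_on_subset[OF pair_lin_right[OF j(2) that]] unfolding W_def by auto
  have "\<exists>\<kappa>\<in>W. pair j z \<kappa> \<noteq> c * pair j w \<kappa>" for c
  proof (rule ccontr)
    assume c: "\<not> ?thesis"
    have "z - scale c w \<in> L ` A (j - 1)"
    proof (rule in_image_L[OF j])
      fix \<kappa> assume "\<kappa> \<in> A (N - j)" "L \<kappa> = 0"
      then show "pair j (z - scale c w) \<kappa> = 0"
        using c j z by (auto simp: W_def pair_diff pair_scale A_scale)
    qed (use z in \<open>auto intro: A_intros\<close>)
    then show False using ind by blast
  qed
  then show ?thesis using separating_vector[OF W lin[OF z(1)] lin[OF z(2)]] unfolding W_def by blast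
qed

lemma separating_dual_element:
  assumes j: "j \<le> N" and z: "z \<in> A j" "w \<in> A j" and ind: "\<And>c. z \<noteq> scale c w"
  shows "\<exists>x\<in>A (N - j). pair j z x = 1 \<and> pair j w x = 0"
proof -
  have "\<exists>x\<in>A (N - j). pair j z x \<noteq> c * pair j w x" for c
  proof (rule ccontr)
    assume c: "\<not> ?thesis"
    have "z - scale c w = 0"
      by (rule nondeg[OF j]) (use c j z in \<open>auto simp: pair_diff pair_scale A_intros\<close>)
    then show False using ind[of c] by simp
  qed
  then show ?thesis
    using separating_vector[OF A_sub pair_lin_right[OF j z(1)] pair_lin_right[OF j z(2)]] by blast
qed

text \<open>Representatives of the socle elements of \<open>A/LA\<close>: modulo the image of \<open>L\<close>, they are killed by \<open>Y False\<close> and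
\<open>Y True\<close>.\<close>

definition soc :: "nat \<Rightarrow> 'v \<Rightarrow> bool"
  where "soc j z \<longleftrightarrow> z \<in> A j \<and> (\<forall>m. Y m z \<in> L ` A j)"

end

text \<open>The socle of \<open>A/LA\<close> has dimension at most two. Independence of three socle elements modulo the image of
\<open>L\<close> is expressed by a dual triple in the kernel of \<open>L\<close>, a system of equations that survives
the specialization of the coefficients of \<open>L\<close>. Elements in different degrees pair to zero, hence the condition
on the degrees in the orthogonality relations.\<close>

locale graded_duality_type_two = graded_duality +
  assumes type_le_two: "\<not> (\<exists>a z \<kappa>. \<forall>r<3::nat. a r \<le> N \<and> soc (a r) (z r) \<and> \<kappa> r \<in> A (N - a r) \<and> L (\<kappa> r) = 0
    \<and> (\<forall>q<3. a q = a r \<longrightarrow> pair (a r) (z r) (\<kappa> q) = (if q = r then 1 else 0)))"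
begin

lemma no_three_socle_elements:
  assumes "a0 \<le> N" "a1 \<le> N" "a2 \<le> N" "soc a0 z0" "soc a1 z1" "soc a2 z2"
    and "k0 \<in> A (N - a0)" "k1 \<in> A (N - a1)" "k2 \<in> A (N - a2)" "L k0 = 0" "L k1 = 0" "L k2 = 0"
    and "pair a0 z0 k0 = 1" "pair a1 z1 k1 = 1" "pair a2 z2 k2 = 1"
    and "a0 = a1 \<Longrightarrow> pair a0 z0 k1 = 0 \<and> pair a1 z1 k0 = 0" "a0 \<noteq> a2" "a1 \<noteq> a2"
  shows False
proof -
  define a where "a = (\<lambda>r::nat. if r = 0 then a0 else if r = 1 then a1 else a2)"
  define z where "z = (\<lambda>r::nat. if r = 0 then z0 else if r = 1 then z1 else z2)"
  define k where "k = (\<lambda>r::nat. if r = 0 then k0 else if r = 1 then k1 else k2)"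
  have "\<forall>r<3::nat. a r \<le> N \<and> soc (a r) (z r) \<and> k r \<in> A (N - a r) \<and> L (k r) = 0
    \<and> (\<forall>q<3. a q = a r \<longrightarrow> pair (a r) (z r) (k q) = (if q = r then 1 else 0))"
    using assms by (auto simp: a_def z_def k_def numeral_3_eq_3 less_Suc_eq)
  then show False using type_le_two by blast
qed

end

section \<open>A kernel in the lower half of the degrees\<close>

text \<open>The injectivity of \<open>L\<close> fails in the lower half of the degrees, and \<open>i\<close> is the least degree in which it
fails. This situation will be contradictory.\<close>

locale lefschetz_failure = graded_duality_type_two +
  fixes i :: nat
  assumes i_low: "2 * i + 1 \<le> N"
    and inj_below: "j < i \<Longrightarrow> x \<in> A j \<Longrightarrow> L x = 0 \<Longrightarrow> x = 0"
    and kernel: "\<exists>x\<in>A i. x \<noteq> 0 \<and> L x = 0"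
begin

lemma i_pos: "1 \<le> i"
  using kernel A_0 by (cases i) auto

lemma Lpow_inj: "v \<in> A j \<Longrightarrow> j + n \<le> i \<Longrightarrow> (L ^^ n) v = 0 \<Longrightarrow> v = 0"
proof (induction n)
  case (Suc n)
  then show ?case using inj_below[of "j + n" "(L ^^ n) v"] Lpow_closed[of v j n] by simp
qed simp

text \<open>Take \<open>p\<close> maximal such that every kernel element of degree \<open>i\<close> is divisible by \<open>L\<^sup>p\<close>, and a kernel element
\<open>L\<^sup>p h\<close> that is not divisible by \<open>L\<^sup>p\<^sup>+\<^sup>1\<close>. It is the divisibility of all kernel elements that makes the
derivative of the equation \<open>L\<^sup>p\<^sup>+\<^sup>1 h = 0\<close> useful.\<close>

lemma ex_generator:
  "\<exists>s p h. s + p = i \<and> 1 \<le> s \<and> h \<in> A s \<and> h \<notin> L ` A (s - 1) \<and> L ((L ^^ p) h) = 0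
    \<and> (\<forall>g\<in>A i. L g = 0 \<longrightarrow> g \<in> (L ^^ p) ` A s)"
proof -
  define Q where "Q p \<longleftrightarrow> (\<forall>g\<in>A i. L g = 0 \<longrightarrow> g \<in> (L ^^ p) ` A (i - p))" for p
  have "Q 0" unfolding Q_def by auto
  have nQi: "\<not> Q i" unfolding Q_def using kernel A_0 Lpow_zero by auto
  obtain p where p: "p < i" "Q p" "\<not> Q (Suc p)"
  proof -
    have "\<exists>p<i. Q p \<and> \<not> Q (Suc p)"
    proof (rule ccontr)
      assume no: "\<not> ?thesis"
      have "Q n" if "n \<le> i" for n using that by (induction n) (use \<open>Q 0\<close> no in auto)
      then show False using nQi by blast
    qed
    then show thesis using that by blast
  qed
  obtain g where g: "g \<in> A i" "L g = 0" "g \<notin> (L ^^ Suc p) ` A (i - Suc p)"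
    using p(3) unfolding Q_def by blast
  obtain h where h: "h \<in> A (i - p)" "g = (L ^^ p) h" using p(2) g unfolding Q_def by blast
  have "h \<notin> L ` A (i - p - 1)"
  proof
    assume "h \<in> L ` A (i - p - 1)"
    then obtain w where "w \<in> A (i - Suc p)" "h = L w" by auto
    moreover then have "g = (L ^^ Suc p) w" using h(2) by (simp add: funpow_swap1)
    ultimately show False using g(3) by blast
  qed
  then show ?thesis using p h g(2) unfolding Q_def
    by (intro exI[of _ "i - p"] exI[of _ p] exI[of _ h]) auto
qed

end

locale lefschetz_failure_witness = lefschetz_failure +
  fixes s p :: nat and h
  assumes sp: "s + p = i" and s_pos: "1 \<le> s" and hA: "h \<in> A s" and h_notin: "h \<notin> L ` A (s - 1)"
    and Lgh: "L ((L ^^ p) h) = 0"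
    and kernel_powers: "g \<in> A i \<Longrightarrow> L g = 0 \<Longrightarrow> g \<in> (L ^^ p) ` A s"
begin

abbreviation "g \<equiv> (L ^^ p) h"

lemma gA: "g \<in> A i" using Lpow_closed[OF hA, of p] sp by simp

lemma h_nz: "h \<noteq> 0" using h_notin L.zero A_zero by (metis imageI)

lemma g_nz: "g \<noteq> 0" using Lpow_inj[OF hA, of p] sp h_nz by auto

lemma s_le: "s \<le> i" and s_less: "s < N - i" and i_le: "i \<le> N" "N - i \<le> N" "s \<le> N" "1 \<le> N - i"
  using sp i_low by auto

text \<open>The derivative of \<open>L\<^sup>p\<^sup>+\<^sup>1 h = 0\<close> is \<open>L\<^sup>p u = 0\<close> for the element \<open>u\<close> on the left-hand side. Hence \<open>L\<^sup>p\<^sup>-\<^sup>1 u\<close> is a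
kernel element of degree \<open>i\<close>, so it is divisible by \<open>L\<^sup>p\<close>, and \<open>L\<^sup>p\<^sup>-\<^sup>1\<close> can be cancelled below degree \<open>i\<close>.\<close>

lemma derivative_relation:
  "\<exists>h'\<in>A s. L ((L ^^ p) h') = 0 \<and> scale (of_nat (Suc p)) (Y m h) + L (D m h) = L h'"
proof -
  define u where "u = scale (of_nat (Suc p)) (Y m h) + L (D m h)"
  have uA: "u \<in> A (Suc s)" unfolding u_def by (intro A_intros hA)
  have "0 = D m ((L ^^ Suc p) h)" using Lgh D_zero by simp
  also have "\<dots> = (L ^^ p) u"
    unfolding DLpow u_def Lpow_add Lpow_scale by (simp add: funpow_swap1 add.commute)
  finally have Lu: "(L ^^ p) u = 0" by simp
  show ?thesis
  proof (cases p)
    case 0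
    then show ?thesis using Lu A_zero L.zero unfolding u_def by (intro bexI[of _ 0]) auto
  next
    case (Suc q)
    have "(L ^^ q) u \<in> A i" using Lpow_closed[OF uA, of q] sp Suc by simp
    moreover have "L ((L ^^ q) u) = 0" using Lu Suc by simp
    ultimately obtain h' where h': "h' \<in> A s" "(L ^^ q) u = (L ^^ p) h'" using kernel_powers by blast
    have "(L ^^ q) (u - L h') = 0" using h'(2) Suc by (simp add: Lpow_diff funpow_swap1)
    then have "u - L h' = 0"
      using Lpow_inj[of "u - L h'" "Suc s" q] uA h'(1) sp Suc by (simp add: A_intros)
    then show ?thesis using h' \<open>L ((L ^^ q) u) = 0\<close> unfolding u_def
      by (intro bexI[of _ h']) auto
  qed
qed

lemma soc_h: "soc s h"
  unfolding soc_def
proof (intro conjI allI hA)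
  fix m
  obtain h' where h': "h' \<in> A s" "scale (of_nat (Suc p)) (Y m h) + L (D m h) = L h'"
    using derivative_relation by blast
  define w where "w = scale (1 / of_nat (Suc p)) (h' - D m h)"
  have "scale (of_nat (Suc p)) (Y m h) = L (h' - D m h)" using h'(2) by (simp add: L.diff algebra_simps)
  then have "L w = scale (1 / of_nat (Suc p)) (scale (of_nat (Suc p)) (Y m h))"
    unfolding w_def by (simp only: L.scale)
  then have "L w = Y m h" using char0[of p] by (simp del: of_nat_Suc)
  moreover have "w \<in> A s" unfolding w_def by (intro A_intros h' hA)
  ultimately show "Y m h \<in> L ` A s" by force
qed

text \<open>Since \<open>L\<close> is injective in degree \<open>i - 1\<close>, it is surjective in the dual degree. So the component of degree \<open>N - i\<close> of
\<open>A/LA\<close> is the last one that is non-zero, and it consists of socle elements.\<close>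

lemma top_in_image: "z \<in> A (Suc (N - i)) \<Longrightarrow> z \<in> L ` A (N - i)"
proof -
  assume z: "z \<in> A (Suc (N - i))"
  have "z \<in> L ` A (Suc (N - i) - 1)"
  proof (rule in_image_L[OF _ _ z])
    show "Suc (N - i) \<le> N" using i_low i_pos by simp
    fix \<kappa> assume \<kappa>: "\<kappa> \<in> A (N - Suc (N - i))" "L \<kappa> = 0"
    have "\<kappa> = 0" using inj_below[OF _ \<kappa>] i_low i_pos by simp
    then show "pair (Suc (N - i)) z \<kappa> = 0"
      using pair_lin_right[of "Suc (N - i)" z] z i_low i_pos \<kappa>(1) lin_functional_on_sum[of _ _ "{}"] A_sub
      by fastforce
  qed simp
  then show ?thesis by simp
qed

lemma soc_top: "x \<in> A (N - i) \<Longrightarrow> soc (N - i) x"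
  unfolding soc_def using top_in_image Y_closed by blast

lemma ex_top: "\<exists>x\<in>A (N - i). pair i g x = 1"
  using separating_dual_element[of i g 0] gA g_nz i_le by auto

lemma ex_dual_h: "\<exists>\<kappa>\<in>A (N - s). L \<kappa> = 0 \<and> pair s h \<kappa> = 1"
  using separating_kernel_element[of s h 0] hA h_notin s_pos i_le by auto

text \<open>The element \<open>h\<close> is a socle element of \<open>A/LA\<close> in a degree below \<open>N - i\<close>, and the top degree \<open>N - i\<close> is dual to the kernel of
\<open>L\<close> in degree \<open>i\<close>. As there are at most two independent socle elements, this kernel is a line, and there are no socle elements
but those in the top degree and the multiples of \<open>h\<close>.\<close>

lemma kernel_line:
  assumes k: "k \<in> A i" "L k = 0"
  shows "\<exists>c. k = scale c g"
proof (rule ccontr)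
  assume no: "\<not> ?thesis"
  then have ind: "\<And>c. k \<noteq> scale c g" by blast
  have ind': "g \<noteq> scale c k" for c
  proof
    assume e: "g = scale c k"
    then have "c \<noteq> 0" using g_nz by auto
    then have "k = scale (1 / c) g" unfolding e by simp
    then show False using ind by blast
  qed
  obtain x1 where x1: "x1 \<in> A (N - i)" "pair i k x1 = 1" "pair i g x1 = 0"
    using separating_dual_element[OF i_le(1) k(1) gA ind] by blast
  obtain x2 where x2: "x2 \<in> A (N - i)" "pair i g x2 = 1" "pair i k x2 = 0"
    using separating_dual_element[OF i_le(1) gA k(1) ind'] by blast
  obtain \<kappa> where \<kappa>: "\<kappa> \<in> A (N - s)" "L \<kappa> = 0" "pair s h \<kappa> = 1" using ex_dual_h by blast
  have sym: "pair (N - i) x y = pair i y x" if "x \<in> A (N - i)" "y \<in> A i" for x y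
    using pair_sym[of i y x] that i_le by simp
  show False
    by (rule no_three_socle_elements[of "N - i" "N - i" s x1 x2 h k g \<kappa>])
      (use x1 x2 \<kappa> k gA Lgh i_le s_less sym in \<open>auto intro: soc_top soc_h\<close>)
qed

lemma image_subspace: "subspace (L ` A j)"
  using A_sub L.subspace_image by blast

lemma soc_at_s:
  assumes z: "soc s z"
  shows "\<exists>c. z - scale c h \<in> L ` A (s - 1)"
proof (rule ccontr)
  assume no: "\<not> ?thesis"
  then have ind: "\<And>c. z - scale c h \<notin> L ` A (s - 1)" by blast
  have ind': "h - scale c z \<notin> L ` A (s - 1)" for c
  proof
    assume e: "h - scale c z \<in> L ` A (s - 1)"
    then have c: "c \<noteq> 0" using h_notin by auto
    have "scale (- 1 / c) (h - scale c z) \<in> L ` A (s - 1)"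
      using e image_subspace subspace_scale by blast
    also have "scale (- 1 / c) (h - scale c z) = z - scale (1 / c) h"
      using c by (simp add: scale_right_diff_distrib)
    finally show False using ind by blast
  qed
  have zA: "z \<in> A s" using z unfolding soc_def by blast
  obtain k0 where k0: "k0 \<in> A (N - s)" "L k0 = 0" "pair s z k0 = 1" "pair s h k0 = 0"
    using separating_kernel_element[OF s_pos i_le(3) zA hA ind] by blast
  obtain k1 where k1: "k1 \<in> A (N - s)" "L k1 = 0" "pair s h k1 = 1" "pair s z k1 = 0"
    using separating_kernel_element[OF s_pos i_le(3) hA zA ind'] by blast
  obtain x where x: "x \<in> A (N - i)" "pair i g x = 1" using ex_top by blast
  have "pair (N - i) x g = 1" using pair_sym[of i g x] x gA i_le by simp
  then show False
    using no_three_socle_elements[of s s "N - i" z h x k0 k1 g]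
      x k0 k1 z gA Lgh i_le s_less soc_top soc_h by auto
qed

lemma soc_elsewhere:
  assumes z: "soc j z" and j: "1 \<le> j" "j \<le> N" "j \<noteq> s" "j \<noteq> N - i"
  shows "z \<in> L ` A (j - 1)"
proof (rule ccontr)
  assume no: "\<not> ?thesis"
  have zA: "z \<in> A j" using z unfolding soc_def by blast
  obtain k0 where k0: "k0 \<in> A (N - j)" "L k0 = 0" "pair j z k0 = 1"
    using separating_kernel_element[OF j(1,2) zA A_zero] no by auto
  obtain k1 where k1: "k1 \<in> A (N - s)" "L k1 = 0" "pair s h k1 = 1" using ex_dual_h by blast
  obtain x where x: "x \<in> A (N - i)" "pair i g x = 1" using ex_top by blast
  have "pair (N - i) x g = 1" using pair_sym[of i g x] x gA i_le by simp
  then show False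
    using no_three_socle_elements[of j s "N - i" z h x k0 k1 g]
      x k0 k1 z j gA Lgh i_le s_less soc_top soc_h by auto
qed

lemma kernel_at_s:
  assumes "v \<in> A s" "L v = 0"
  shows "\<exists>c. v = scale c h"
proof (cases "s < i")
  case True
  then have "v = 0" using inj_below assms by blast
  then show ?thesis by (intro exI[of _ 0]) simp
next
  case False
  then have "s = i" "p = 0" using sp by auto
  then show ?thesis using kernel_line[of v] assms by simp
qed

text \<open>Now the element \<open>h'\<close> in the derivative relation is a multiple of \<open>h\<close>, because \<open>L\<^sup>p h'\<close> lies on the kernel line. The
coefficients \<open>c\<close> appear because \<open>h\<close> is determined only up to a scalar function: \<open>D m - c m\<close> is a
connection on the line of its multiples.\<close>

lemma connection_form:
  "\<exists>c. scale (of_nat (Suc p)) (Y m h) + L (D m h - scale c h) = 0"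
proof -
  obtain h' where h': "h' \<in> A s" "L ((L ^^ p) h') = 0"
      "scale (of_nat (Suc p)) (Y m h) + L (D m h) = L h'"
    using derivative_relation by blast
  have "(L ^^ p) h' \<in> A i" using Lpow_closed[OF h'(1), of p] sp by simp
  then obtain c where "(L ^^ p) h' = scale c g" using kernel_line h'(2) by blast
  then have "(L ^^ p) (h' - scale c h) = 0" by (simp add: Lpow_diff Lpow_scale)
  then have "h' - scale c h = 0" using Lpow_inj[of "h' - scale c h" s p] h'(1) hA sp by (simp add: A_intros)
  then have "h' = scale c h" by simp
  then have "scale (of_nat (Suc p)) (Y m h) + L (D m h - scale c h) = 0"
    using h'(3) by (simp add: L.diff algebra_simps)
  then show ?thesis by blast
qed

lemma pair_L_symmetric:
  assumes "N = 2 * i + 1" "a \<in> A i" "b \<in> A i"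
  shows "pair i a (L b) = pair i b (L a)"
proof -
  have "N - Suc i = i" using assms(1) by simp
  then have "pair i a (L b) = pair (Suc i) (L a) b" using pair_L[of i a b] assms i_low by simp
  also have "\<dots> = pair i b (L a)"
    using pair_sym[of "Suc i" "L a" b] assms \<open>N - Suc i = i\<close> by (simp add: L_closed)
  finally show ?thesis .
qed

text \<open>For \<open>p > 0\<close> the second relation comes from comparing the two mixed derivatives of the first one. For \<open>p = 0\<close> these derivatives only
say that \<open>H = Y\<^sub>1 D\<^sub>2 h - Y\<^sub>2 D\<^sub>1 h\<close> is killed by \<open>L\<close>. By duality \<open>H\<close> is a combination of \<open>Y\<^sub>1 h\<close> and \<open>Y\<^sub>2 h\<close>: if \<open>x\<close> is
orthogonal to both, then \<open>x\<close> is a socle element of \<open>A/LA\<close>, hence \<open>x = c h + L w\<close>, and \<open>H\<close> is orthogonal to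
\<open>h\<close> by the symmetry of \<open>\<langle>a, L b\<rangle>\<close>. As \<open>L h = 0\<close> in this case, the connection may be changed to absorb the combination.\<close>

lemma torsion_free_connection:
  "\<exists>c \<kappa>. (\<forall>m. scale (of_nat (Suc p)) (Y m h) + L (D m h - scale (c m) h) = 0)
    \<and> Y False (D True h - scale (c True) h) - Y True (D False h - scale (c False) h) = scale \<kappa> (L h)"
proof (cases p)
  case (Suc q)
  \<comment> \<open>\<open>\<kappa>\<close> below is the curvature of the connection.\<close>
  obtain c where c: "\<And>m. scale (of_nat (Suc p)) (Y m h) + L (D m h - scale (c m) h) = 0"
    using connection_form by metis
  let ?P = "of_nat p :: 'a"
  have c': "Y m h + scale ?P (Y m h) + L (D m h) - scale (c m) (L h) = 0" for m
    using c[of m] by (simp add: L.diff L.scale scale_left_distrib algebra_simps)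
  have e: "Y m (D m' h) + scale ?P (Y m (D m' h)) + L (D m' (D m h)) + Y m' (D m h)
      - scale (c m) (L (D m' h)) - scale (c m) (Y m' h) - scale (d m' (c m)) (L h) = 0" for m m'
  proof -
    have "0 = D m' (Y m h + scale ?P (Y m h) + L (D m h) - scale (c m) (L h))" using c' D_zero by simp
    then show ?thesis
      by (simp add: D_add D_diff D_scale DL DY d_of_nat scale_right_distrib algebra_simps)
  qed
  define \<kappa> where "\<kappa> = d False (c True) - d True (c False)"
  let ?T = "Y False (D True h - scale (c True) h) - Y True (D False h - scale (c False) h)"
  have "scale ?P ?T + scale \<kappa> (L h)
     = (Y False (D True h) + scale ?P (Y False (D True h)) + L (D True (D False h)) + Y True (D False h)
      - scale (c False) (L (D True h)) - scale (c False) (Y True h) - scale (d True (c False)) (L h))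
     - (Y True (D False h) + scale ?P (Y True (D False h)) + L (D False (D True h)) + Y False (D True h)
      - scale (c True) (L (D False h)) - scale (c True) (Y False h) - scale (d False (c True)) (L h))
     - scale (c True) (Y False h + scale ?P (Y False h) + L (D False h) - scale (c False) (L h))
     + scale (c False) (Y True h + scale ?P (Y True h) + L (D True h) - scale (c True) (L h))"
    unfolding \<kappa>_def DD[of True False]
    by (simp add: Y.diff Y.scale scale_right_distrib scale_right_diff_distrib scale_left_diff_distrib
        algebra_simps)
  also have "\<dots> = 0" unfolding c' e by simp
  finally have "scale ?P ?T = scale (- \<kappa>) (L h)" by (simp add: eq_neg_iff_add_eq_0)
  then have "scale (1 / ?P) (scale ?P ?T) = scale (1 / ?P) (scale (- \<kappa>) (L h))" by simp
  then have "?T = scale (- \<kappa> / ?P) (L h)" using char0[of q] Suc by (simp del: of_nat_Suc)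
  then show ?thesis using c by blast
next
  case 0
  then have s_i: "s = i" and Lh: "L h = 0" and hi: "h \<in> A i" using sp Lgh hA by auto
  have Yh: "Y m h = - L (D m h)" for m
  proof -
    obtain c where "scale (of_nat (Suc p)) (Y m h) + L (D m h - scale c h) = 0" using connection_form by blast
    then show ?thesis using 0 Lh by (simp add: L.diff L.scale eq_neg_iff_add_eq_0)
  qed
  define H where "H = Y False (D True h) - Y True (D False h)"
  have HA: "H \<in> A (Suc i)" unfolding H_def by (intro A_intros hi)
  have LYD: "L (Y m (D m' h)) = - Y m (Y m' h)" for m m'
    using YL[of m "D m' h"] Yh[of m'] Y.neg[of m "L (D m' h)"] by simp
  have LH: "L H = 0" unfolding H_def by (simp add: L.diff LYD YY[of True False])
  have deg: "Suc i \<le> N" "Suc (Suc i) \<le> N" using i_low i_pos by auto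
  have "\<exists>c. \<forall>x\<in>A (N - Suc i). pair (Suc i) H x = (\<Sum>m\<in>UNIV. c m * pair (Suc i) (Y m h) x)"
  proof (rule functional_in_span_of_kernels[OF _ A_sub])
    show "\<And>m. lin_functional_on (A (N - Suc i)) (pair (Suc i) (Y m h))"
      using pair_lin_right deg Y_closed hi by blast
    show "lin_functional_on (A (N - Suc i)) (pair (Suc i) H)" using pair_lin_right deg HA by blast
    fix x assume x: "x \<in> A (N - Suc i)" and perp: "\<And>m. m \<in> UNIV \<Longrightarrow> pair (Suc i) (Y m h) x = 0"
    have Yx: "Y m x \<in> A (N - i)" for m using Y_closed[OF x] deg by (simp add: Suc_diff_le flip: Suc_diff_Suc)
    have soc: "soc (N - Suc i) x"
      unfolding soc_def
    proof (intro conjI allI x)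
      fix m
      have "Y m x \<in> L ` A (N - i - 1)"
      proof (rule in_image_L[OF _ _ Yx])
        fix k assume k: "k \<in> A (N - (N - i))" "L k = 0"
        then have "k \<in> A i" using i_le by simp
        then obtain a where a: "k = scale a h" using kernel_line k(2) 0 by auto
        have "pair (N - i) (Y m x) k = pair i k (Y m x)"
          using pair_sym[of i k "Y m x"] \<open>k \<in> A i\<close> Yx i_le by simp
        also have "\<dots> = a * pair (Suc i) (Y m h) x"
          unfolding a using pair_scale[of i "Y m x" h a] pair_Y[of i h x m] Yx hi x deg i_le by simp
        finally show "pair (N - i) (Y m x) k = 0" using perp by simp
      qed (use i_le in auto)
      then show "Y m x \<in> L ` A (N - Suc i)" by simp
    qed
    have "\<exists>c. \<exists>w\<in>A (N - Suc (Suc i)). x = scale c h + L w \<and> (c = 0 \<or> N - Suc i = i)"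
    proof (cases "N - Suc i = i")
      case True
      then have "soc s x" using soc s_i by simp
      then obtain c where "x - scale c h \<in> L ` A (s - 1)" using soc_at_s by blast
      then obtain w where "w \<in> A (s - 1)" "x - scale c h = L w" by blast
      moreover have "N - Suc (Suc i) = s - 1" using True s_i by simp
      ultimately have "w \<in> A (N - Suc (Suc i))" "x = scale c h + L w"
        by (simp_all add: algebra_simps)
      then show ?thesis using True by blast
    next
      case False
      then have "x \<in> L ` A (N - Suc i - 1)" using soc_elsewhere[OF soc] s_i i_low i_pos by simp
      then obtain w where "w \<in> A (N - Suc (Suc i))" "x = L w" by auto
      then show ?thesis by (intro exI[of _ 0] bexI[of _ w]) auto
    qed
    then obtain c w where w: "w \<in> A (N - Suc (Suc i))" and xw: "x = scale c h + L w"
      and c: "c = 0 \<or> N - Suc i = i" by blast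
    have LwA: "L w \<in> A (N - Suc i)" using L_closed[OF w] deg by (simp add: Suc_diff_Suc)
    have 1: "pair (Suc i) H (L w) = 0"
      using pair_L[of "Suc i" H w] deg HA w LH pair_zero[of "Suc (Suc i)" w] by simp
    show "pair (Suc i) H x = 0"
    proof (cases "c = 0")
      case True
      then show ?thesis using 1 xw by simp
    next
      case False
      then have Ni: "N - Suc i = i" "N = 2 * i + 1" using c deg by auto
      have Dh: "D m h \<in> A i" for m using D_closed hi by blast
      have neg: "pair i a (- b) = - pair i a b" if "a \<in> A i" "b \<in> A (N - i)" for a b
      proof -
        have "pair i a (scale (-1) b) = -1 * pair i a b"
          using pair_lin_right[OF i_le(1) that(1)] that(2) unfolding lin_functional_on_def by blast
        then show ?thesis by simp
      qed
      have LDh: "L (D m h) \<in> A (N - i)" for m using L_closed[OF Dh] Ni by simp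
      have YD: "pair (Suc i) (Y m (D m' h)) h = - pair i (D m' h) (L (D m h))" for m m'
        using pair_Y[of i "D m' h" h m] deg hi Ni Dh neg LDh by (simp add: Yh)
      have "pair (Suc i) H h = 0"
        unfolding H_def using pair_diff[of "Suc i" h "Y False (D True h)" "Y True (D False h)"]
          YD pair_L_symmetric[OF Ni(2) Dh Dh, of True False] hi Ni deg Y_closed[OF Dh] by simp
      then show ?thesis
        using 1 pair_lin_right[of "Suc i" H] deg HA hi Ni(1) LwA unfolding xw lin_functional_on_def
        by (simp add: A_scale)
    qed
  qed simp
  then obtain a where a: "\<And>x. x \<in> A (N - Suc i) \<Longrightarrow>
      pair (Suc i) H x = (\<Sum>m\<in>UNIV. a m * pair (Suc i) (Y m h) x)" by blast
  have Yhi: "Y m h \<in> A (Suc i)" for m using Y_closed hi by blast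
  have H: "H - scale (a True) (Y True h) - scale (a False) (Y False h) = 0"
  proof (rule nondeg[of "Suc i"])
    fix x assume x: "x \<in> A (N - Suc i)"
    show "pair (Suc i) (H - scale (a True) (Y True h) - scale (a False) (Y False h)) x = 0"
      using x a[OF x] deg HA Yhi by (simp add: pair_diff pair_scale A_intros UNIV_bool)
  qed (use deg HA Yhi in \<open>auto intro!: A_diff A_scale\<close>)
  define c where "c m = (if m then a False else - a True)" for m
  have "Y False (D True h - scale (c True) h) - Y True (D False h - scale (c False) h) = 0"
    using H unfolding H_def c_def by (simp add: Y.diff Y.scale Y.add algebra_simps)
  moreover have "scale (of_nat (Suc p)) (Y m h) + L (D m h - scale (c m) h) = 0" for m
    using 0 Yh[of m] Lh by (simp add: L.diff L.scale)
  ultimately show ?thesis by (intro exI[of _ c] exI[of _ 0]) auto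
qed

end

section \<open>The derivatives of the kernel element\<close>

locale lefschetz_failure_connection = lefschetz_failure_witness +
  fixes c :: "bool \<Rightarrow> 'a" and \<kappa> :: 'a
  assumes connection: "scale (of_nat (Suc p)) (Y m h) + L (D m h - scale (c m) h) = 0"
    and torsion: "Y False (D True h - scale (c True) h) - Y True (D False h - scale (c False) h) = scale \<kappa> (L h)"
begin

definition jet :: "nat \<Rightarrow> nat \<Rightarrow> 'b"
  where "jet a b = (D False ^^ a) ((D True ^^ b) h)"

lemma D_commute_pow: "D m ((D m' ^^ n) v) = (D m' ^^ n) (D m v)"
  by (induction n) (auto simp: DD[of m m'])

lemma D_jet [simp]: "D False (jet a b) = jet (Suc a) b" "D True (jet a b) = jet a (Suc b)"
  unfolding jet_def by (simp_all add: D_commute_pow)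

lemma jet_0 [simp]: "jet 0 0 = h" unfolding jet_def by simp

lemma D_of_nat: "D m (scale (of_nat n) v) = scale (of_nat n) (D m v)"
  using D_scale d_of_nat by simp

text \<open>The goal of this part is \<open>Y m ` V \<subseteq> L ` V\<close>. It is proved by induction on the order of the
derivative. The space \<open>G n\<close> contains the error terms that are under control when the derivatives of
order less than \<open>n\<close> have been treated, and a derivation maps \<open>G n\<close> into \<open>G (n + 1)\<close>.\<close>

definition V where "V = span {jet a b | a b. True}"

definition G where "G n = span ({L (jet a b) | a b. a + b \<le> n} \<union> {Y m (jet a b) | m a b. a + b < n})"

lemma jet_V: "jet a b \<in> V" unfolding V_def by (intro span_base) blast
lemma V_sub: "subspace V" unfolding V_def by (rule subspace_span)
lemma jet_A: "jet a b \<in> A s"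
proof -
  have "(D True ^^ b) h \<in> A s" by (induction b) (auto intro: D_closed hA)
  then show ?thesis unfolding jet_def by (induction a) (auto intro: D_closed)
qed
lemma V_A: "V \<subseteq> A s" unfolding V_def using jet_A A_sub by (intro span_minimal) auto
lemma hV: "h \<in> V" using jet_V[of 0 0] by simp

lemma G_sub: "subspace (G n)" unfolding G_def by (rule subspace_span)
lemma L_G: "a + b \<le> n \<Longrightarrow> L (jet a b) \<in> G n" unfolding G_def by (intro span_base) blast
lemma Y_G: "a + b < n \<Longrightarrow> Y m (jet a b) \<in> G n" unfolding G_def by (intro span_base) blast

lemma D_G:
  assumes "v \<in> G n" shows "D m v \<in> G (Suc n)"
proof -
  have "D m v \<in> G (Suc n) \<and> v \<in> G (Suc n)"
    using assms unfolding G_def[of n]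
  proof (rule span_induct)
    show "subspace {v. D m v \<in> G (Suc n) \<and> v \<in> G (Suc n)}"
      using G_sub[of "Suc n"] unfolding subspace_def by (auto simp: D_zero D_add D_scale)
    fix v assume v: "v \<in> {L (jet a b) | a b. a + b \<le> n} \<union> {Y m (jet a b) | m a b. a + b < n}"
    show "D m v \<in> G (Suc n) \<and> v \<in> G (Suc n)"
    proof (cases "\<exists>a b. v = L (jet a b) \<and> a + b \<le> n")
      case True
      then obtain a b where ab: "v = L (jet a b)" "a + b \<le> n" by blast
      have "L (D m (jet a b)) \<in> G (Suc n)" using ab L_G by (cases m) auto
      moreover have "Y m (jet a b) \<in> G (Suc n)" using ab Y_G by auto
      ultimately show ?thesis using ab L_G[of a b "Suc n"] subspace_add[OF G_sub] by (simp add: DL)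
    next
      case False
      then obtain a b k where ab: "v = Y k (jet a b)" "a + b < n" using v by blast
      have "Y k (D m (jet a b)) \<in> G (Suc n)" using ab Y_G by (cases m) auto
      then show ?thesis using ab Y_G[of a b "Suc n" k] by (simp add: DY)
    qed
  qed
  then show ?thesis by simp
qed

text \<open>The derivatives of the two relations of the connection. Where a relation is differentiated \<open>b\<close> times with respect to the variable
\<open>m\<close>, the product rule for \<open>L\<close> contributes \<open>b\<close> times a term with \<open>Y m\<close> and one derivative less; for \<open>b = 0\<close> the
index \<open>b - 1\<close> is meaningless, but its coefficient vanishes.\<close>

lemma first_relation:
  "scale (of_nat (Suc p)) (Y False (jet a b)) + L (jet (Suc a) b)
    + scale (of_nat a) (Y False (jet a b)) + scale (of_nat b) (Y True (jet (Suc a) (b - 1))) \<in> G (a + b)"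
proof (induction b)
  case 0
  show ?case
  proof (induction a)
    case 0
    have "scale (of_nat (Suc p)) (Y False h) + L (D False h) = scale (c False) (L h)"
      using connection[of False] by (simp add: L.diff L.scale algebra_simps)
    moreover have "L h \<in> G 0" using L_G[of 0 0 0] by simp
    ultimately show ?case using D_jet(1)[of 0 0] subspace_scale[OF G_sub] by simp
  next
    case (Suc a)
    from D_G[OF this, of False] show ?case
      by (simp add: D_add D_of_nat DL DY scale_left_distrib algebra_simps del: of_nat_Suc) (simp add: scale_left_distrib algebra_simps)
  qed
next
  case (Suc b)
  note step = D_G[OF Suc, of True]
  show ?case
  proof (cases b)
    case 0
    with step show ?thesis
      by (simp add: D_add D_of_nat DL DY scale_left_distrib algebra_simps)
  next
    case (Suc b')
    then have "Suc (b - Suc 0) = b" by simp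
    with step show ?thesis
      by (simp add: D_add D_of_nat DL DY scale_left_distrib algebra_simps)
  qed
qed

lemma second_relation:
  "scale (of_nat (Suc p)) (Y True (jet 0 b)) + L (jet 0 (Suc b)) + scale (of_nat b) (Y True (jet 0 b)) \<in> G b"
proof (induction b)
  case 0
  have "scale (of_nat (Suc p)) (Y True h) + L (D True h) = scale (c True) (L h)"
    using connection[of True] by (simp add: L.diff L.scale algebra_simps)
  moreover have "L h \<in> G 0" using L_G[of 0 0 0] by simp
  ultimately show ?case using D_jet(2)[of 0 0] subspace_scale[OF G_sub] by simp
next
  case (Suc b)
  from D_G[OF this, of True] show ?case
    by (simp add: D_add D_of_nat DL DY scale_left_distrib algebra_simps del: of_nat_Suc)
      (simp add: scale_left_distrib algebra_simps)
qed

lemma third_relation: "Y False (jet a (Suc b)) - Y True (jet (Suc a) b) \<in> G (Suc (a + b))"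
proof (induction a)
  case 0
  show ?case
  proof (induction b)
    case 0
    have "Y False (jet 0 1) - Y True (jet 1 0)
        = scale \<kappa> (L h) + scale (c True) (Y False h) - scale (c False) (Y True h)"
      using torsion D_jet[of 0 0] by (simp add: Y.diff Y.scale algebra_simps)
    also have "\<dots> \<in> G 1"
      using L_G[of 0 0 1] Y_G[of 0 0 1] by (intro subspace_add subspace_diff subspace_scale G_sub) auto
    finally show ?case by simp
  next
    case (Suc b)
    from D_G[OF this, of True] show ?case by (simp add: D_diff DY)
  qed
next
  case (Suc a)
  from D_G[OF this, of False] show ?case by (simp add: D_diff DY)
qed

lemma LV_sub: "subspace (L ` V)" using V_sub L.subspace_image by blast

text \<open>Modulo the terms under control, the first and the third relation are linear equations for \<open>Y\<^sub>1 (jet a b)\<close> and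
\<open>Y\<^sub>2 (jet (a + 1) (b - 1))\<close> with determinant \<open>p + 1 + a + b\<close>, up to sign, which is not zero in characteristic zero.\<close>

lemma Y_jet: "Y m (jet a b) \<in> L ` V"
proof (induction "a + b" arbitrary: a b m rule: less_induct)
  case less
  define n where "n = a + b"
  have G_LV: "G (a + b) \<subseteq> L ` V"
    unfolding G_def using less jet_V by (intro span_minimal LV_sub) auto
  have L_LV: "L (jet a b) \<in> L ` V" for a b using jet_V by blast
  have cancel: "v \<in> L ` V" if "scale (of_nat (Suc k)) v \<in> L ` V" for k v
  proof -
    have "scale (1 / of_nat (Suc k)) (scale (of_nat (Suc k)) v) \<in> L ` V"
      using that subspace_scale[OF LV_sub] by blast
    then show ?thesis using char0[of k] by (simp del: of_nat_Suc)
  qed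
  have F: "Y False (jet a' b') \<in> L ` V" if ab': "a' + b' = a + b" for a' b'
  proof -
    have 1: "scale (of_nat (Suc p)) (Y False (jet a' b')) + L (jet (Suc a') b')
      + scale (of_nat a') (Y False (jet a' b')) + scale (of_nat b') (Y True (jet (Suc a') (b' - 1))) \<in> L ` V"
      using first_relation[of a' b'] ab' G_LV by auto
    have 2: "scale (of_nat b') (Y False (jet a' b') - Y True (jet (Suc a') (b' - 1))) \<in> L ` V"
    proof (cases b')
      case 0
      then show ?thesis using subspace_0[OF LV_sub] by simp
    next
      case (Suc b'')
      then show ?thesis
        using third_relation[of a' b''] G_LV ab' subspace_scale[OF LV_sub] by auto
    qed
    have "scale (of_nat (Suc (p + a' + b'))) (Y False (jet a' b'))
        = (scale (of_nat (Suc p)) (Y False (jet a' b')) + L (jet (Suc a') b')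
          + scale (of_nat a') (Y False (jet a' b')) + scale (of_nat b') (Y True (jet (Suc a') (b' - 1))))
        + scale (of_nat b') (Y False (jet a' b') - Y True (jet (Suc a') (b' - 1))) - L (jet (Suc a') b')"
      by (simp add: scale_left_distrib scale_right_diff_distrib algebra_simps)
    also have "\<dots> \<in> L ` V" by (intro subspace_add subspace_diff LV_sub 1 2 L_LV)
    finally show ?thesis by (rule cancel)
  qed
  show ?case
  proof (cases m)
    case False
    then show ?thesis using F by simp
  next
    case True
    show ?thesis
    proof (cases a)
      case 0
      have 1: "scale (of_nat (Suc p)) (Y True (jet 0 b)) + L (jet 0 (Suc b)) + scale (of_nat b) (Y True (jet 0 b)) \<in> L ` V"
        using second_relation[of b] 0 G_LV by auto
      have "scale (of_nat (Suc (p + b))) (Y True (jet 0 b))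
        = scale (of_nat (Suc p)) (Y True (jet 0 b)) + L (jet 0 (Suc b)) + scale (of_nat b) (Y True (jet 0 b))
          - L (jet 0 (Suc b))"
        by (simp add: scale_left_distrib algebra_simps)
      also have "\<dots> \<in> L ` V" by (intro subspace_diff LV_sub 1 L_LV)
      finally have "Y True (jet 0 b) \<in> L ` V" by (rule cancel)
      then show ?thesis using 0 True by simp
    next
      case (Suc a')
      have "Y True (jet a b) = Y False (jet a' (Suc b)) - (Y False (jet a' (Suc b)) - Y True (jet (Suc a') b))"
        using Suc by simp
      also have "\<dots> \<in> L ` V"
        by (rule subspace_diff[OF LV_sub F]) (use third_relation[of a' b] G_LV Suc in auto)
      finally show ?thesis using True by simp
    qed
  qed
qed

lemma Y_V:
  assumes "v \<in> V" shows "Y m v \<in> L ` V"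
proof (rule span_induct[OF assms[unfolded V_def], of "\<lambda>v. Y m v \<in> L ` V"])
  show "subspace {v. Y m v \<in> L ` V}"
    using LV_sub unfolding subspace_def by (auto simp: Y.zero Y.add Y.scale)
qed (use Y_jet in auto)

end

section \<open>Commuting multiplication operators\<close>

context lefschetz_failure_connection
begin

text \<open>Every \<open>v\<close> in \<open>V\<close> is a socle element of \<open>A/LA\<close>, so \<open>v = \<lambda>(v) h + L u\<close> for a unique scalar \<open>\<lambda>(v)\<close> and a unique \<open>u\<close>.\<close>

definition lam :: "'b \<Rightarrow> 'a" where "lam v = (SOME a. v - scale a h \<in> L ` A (s - 1))"

lemma V_soc: "v \<in> V \<Longrightarrow> soc s v"
  unfolding soc_def using V_A Y_V by blast

lemma lam_mem: "v \<in> V \<Longrightarrow> v - scale (lam v) h \<in> L ` A (s - 1)"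
  unfolding lam_def using soc_at_s[OF V_soc] by (rule someI_ex)

lemma lam_unique:
  assumes "v - scale a h \<in> L ` A (s - 1)" "v \<in> V" shows "lam v = a"
proof (rule ccontr)
  assume ne: "lam v \<noteq> a"
  have "(v - scale a h) - (v - scale (lam v) h) \<in> L ` A (s - 1)"
    by (rule subspace_diff[OF image_subspace assms(1) lam_mem[OF assms(2)]])
  then have "scale (lam v - a) h \<in> L ` A (s - 1)" by (simp add: scale_left_diff_distrib)
  then have "scale (1 / (lam v - a)) (scale (lam v - a) h) \<in> L ` A (s - 1)"
    using subspace_scale[OF image_subspace] by blast
  then show False using ne h_notin by simp
qed

lemma lam_lin: "lin_functional_on V lam"
  unfolding lin_functional_on_def
proof (intro conjI ballI allI)
  fix v w assume v: "v \<in> V" and w: "w \<in> V"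
  have "(v - scale (lam v) h) + (w - scale (lam w) h) \<in> L ` A (s - 1)"
    by (rule subspace_add[OF image_subspace lam_mem[OF v] lam_mem[OF w]])
  then have "(v + w) - scale (lam v + lam w) h \<in> L ` A (s - 1)"
    by (simp add: scale_left_distrib algebra_simps)
  then show "lam (v + w) = lam v + lam w"
    by (rule lam_unique) (rule subspace_add[OF V_sub v w])
next
  fix a v assume v: "v \<in> V"
  have "scale a (v - scale (lam v) h) \<in> L ` A (s - 1)"
    by (rule subspace_scale[OF image_subspace lam_mem[OF v]])
  then have "scale a v - scale (a * lam v) h \<in> L ` A (s - 1)"
    by (simp add: scale_right_diff_distrib)
  then show "lam (scale a v) = a * lam v"
    by (rule lam_unique) (rule subspace_scale[OF V_sub v])
qed

definition quo :: "'b \<Rightarrow> 'b" where "quo v = (SOME u. u \<in> A (s - 1) \<and> v - scale (lam v) h = L u)"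

lemma quo: "v \<in> V \<Longrightarrow> quo v \<in> A (s - 1)" "v \<in> V \<Longrightarrow> L (quo v) = v - scale (lam v) h"
proof -
  assume v: "v \<in> V"
  then have "\<exists>u. u \<in> A (s - 1) \<and> v - scale (lam v) h = L u" using lam_mem[OF v] by blast
  then have "quo v \<in> A (s - 1) \<and> v - scale (lam v) h = L (quo v)" unfolding quo_def by (rule someI_ex)
  then show "quo v \<in> A (s - 1)" "L (quo v) = v - scale (lam v) h" by simp_all
qed

lemma quo_unique:
  assumes "v \<in> V" "u \<in> A (s - 1)" "L u = v - scale (lam v) h" shows "quo v = u"
proof -
  have "L (quo v - u) = 0" using quo(2)[OF assms(1)] assms(3) by (simp add: L.diff)
  then have "quo v - u = 0"
    using inj_below[of "s - 1" "quo v - u"] quo(1)[OF assms(1)] assms(2) s_pos s_le by (simp add: A_diff)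
  then show ?thesis by simp
qed

text \<open>The operators \<open>M m\<close> stand for the division of \<open>Y m\<close> by \<open>L\<close>. The condition \<open>L (M m v) = Y m v\<close> alone does not define them
when \<open>p = 0\<close>, since then \<open>L h = 0\<close>. On \<open>L u\<close> there is the canonical choice \<open>Y m u\<close>, and for \<open>h\<close> the connection makes
the choice.\<close>

definition mh :: "bool \<Rightarrow> 'b" where "mh m = scale (- 1 / of_nat (Suc p)) (D m h - scale (c m) h)"

definition M :: "bool \<Rightarrow> 'b \<Rightarrow> 'b" where "M m v = scale (lam v) (mh m) + Y m (quo v)"

lemma Dh_V: "D m h \<in> V"
  using jet_V[of 1 0] jet_V[of 0 1] D_jet[of 0 0] by (cases m) auto

lemma mh_V: "mh m \<in> V"
  unfolding mh_def by (intro subspace_scale subspace_diff V_sub Dh_V hV)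

lemma L_mh: "L (mh m) = Y m h"
proof -
  have "L (D m h - scale (c m) h) = - scale (of_nat (Suc p)) (Y m h)"
    using connection[of m] by (simp only: eq_neg_iff_add_eq_0 add.commute)
  then have "L (mh m) = scale (- 1 / of_nat (Suc p)) (- scale (of_nat (Suc p)) (Y m h))"
    unfolding mh_def by (simp only: L.scale)
  then show ?thesis using char0[of p] by (simp del: of_nat_Suc)
qed

lemma L_M: "v \<in> V \<Longrightarrow> L (M m v) = Y m v"
  using YL[of m "quo v"] quo(2)[of v]
  by (simp add: M_def L.add L.scale L_mh Y.diff Y.scale) (metis diff_add_cancel add.commute)

lemma kernel_V: "v \<in> A s \<Longrightarrow> L v = 0 \<Longrightarrow> v \<in> V"
  using kernel_at_s[of v] subspace_scale[OF V_sub hV] by auto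

lemma M_V: assumes v: "v \<in> V" shows "M m v \<in> V"
proof -
  have "Suc (s - 1) = s" using s_pos by simp
  then have YA: "Y m (quo v) \<in> A s" using Y_closed[OF quo(1)[OF v], of m] by simp
  obtain w where w: "w \<in> V" "Y m v = L w" using Y_V[OF v] by blast
  have MA: "M m v \<in> A s" unfolding M_def using YA mh_V V_A by (intro A_add A_scale) auto
  have "M m v - w \<in> V"
    using MA w V_A L_M[OF v, of m] by (intro kernel_V A_diff) (auto simp: L.diff)
  then have "(M m v - w) + w \<in> V" using w subspace_add[OF V_sub] by blast
  then show ?thesis by simp
qed

lemma M_lin: "lin_endo_on V (M m)"
  unfolding lin_endo_on_def
proof (intro conjI ballI allI M_V)
  fix v w assume v: "v \<in> V" and w: "w \<in> V"
  have vw: "v + w \<in> V" by (rule subspace_add[OF V_sub v w])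
  have l: "lam (v + w) = lam v + lam w" using lam_lin v w unfolding lin_functional_on_def by blast
  have "quo (v + w) = quo v + quo w"
    by (rule quo_unique[OF vw])
      (use quo v w l in \<open>auto simp: L.add scale_left_distrib algebra_simps intro: A_add\<close>)
  then show "M m (v + w) = M m v + M m w"
    unfolding M_def by (simp add: l Y.add scale_left_distrib algebra_simps)
next
  fix a v assume v: "v \<in> V"
  have av: "scale a v \<in> V" by (rule subspace_scale[OF V_sub v])
  have l: "lam (scale a v) = a * lam v" using lam_lin v unfolding lin_functional_on_def by blast
  have "quo (scale a v) = scale a (quo v)"
    by (rule quo_unique[OF av])
      (use quo v l in \<open>auto simp: L.scale scale_right_diff_distrib intro: A_scale\<close>)
  then show "M m (scale a v) = scale a (M m v)"
    unfolding M_def by (simp add: l Y.scale scale_right_distrib)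
qed

lemma M_L: assumes "u \<in> A (s - 1)" "L u \<in> V" shows "lam (L u) = 0" "M m (L u) = Y m u"
proof -
  show l: "lam (L u) = 0" by (rule lam_unique[OF _ assms(2)]) (use assms(1) in simp)
  have "quo (L u) = u" by (rule quo_unique[OF assms(2,1)]) (use l in simp)
  then show "M m (L u) = Y m u" unfolding M_def l by simp
qed

text \<open>\<open>L\<close> maps the commutator of \<open>M False\<close> and \<open>M True\<close> at \<open>v = \<lambda>(v) h + L u\<close> to a multiple of \<open>L h\<close>: the contribution of \<open>u\<close> cancels because
the variables commute, and that of \<open>h\<close> is the torsion relation. Hence the commutator has rank at most one, with image spanned by \<open>h\<close>.\<close>

lemma M_commutator:
  assumes v: "v \<in> V"
  shows "M False (M True v) - M True (M False v)
    = scale (lam (M False (M True v) - M True (M False v))) h"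
proof -
  let ?C = "M False (M True v) - M True (M False v)"
  have C: "?C \<in> V" using v by (intro subspace_diff V_sub M_V)
  have "L (mh True) = Y True h" "L (mh False) = Y False h" by (rule L_mh)+
  have YM: "Y m (M m' v) = scale (lam v) (Y m (mh m')) + Y m (Y m' (quo v))" for m m'
    unfolding M_def by (simp add: Y.add Y.scale)
  let ?q = "- 1 / of_nat (Suc p)"
  have t: "Y False (mh True) - Y True (mh False) = L (scale (?q * \<kappa>) h)"
  proof -
    have "Y False (mh True) - Y True (mh False)
      = scale ?q (Y False (D True h - scale (c True) h) - Y True (D False h - scale (c False) h))"
      unfolding mh_def Y.scale by (rule scale_right_diff_distrib[symmetric])
    then show ?thesis unfolding torsion by (simp only: L.scale scale_scale)
  qed
  have "L ?C = Y False (M True v) - Y True (M False v)" using v by (simp add: L.diff L_M M_V)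
  also have "\<dots> = scale (lam v) (Y False (mh True) - Y True (mh False))"
    unfolding YM by (simp add: YY[of True False] scale_right_diff_distrib)
  also have "\<dots> = L (scale (lam v * (?q * \<kappa>)) h)" unfolding t by (simp only: L.scale scale_scale)
  finally have "L (?C - scale (lam v * (?q * \<kappa>)) h) = 0" by (simp only: L.diff[of ?C] diff_self)
  moreover have "?C - scale (lam v * (?q * \<kappa>)) h \<in> A s" using C V_A hA A_diff A_scale by blast
  ultimately obtain a where "?C - scale (lam v * (?q * \<kappa>)) h = scale a h" using kernel_at_s by blast
  then have e: "?C = scale (a + lam v * (?q * \<kappa>)) h" by (simp add: scale_left_distrib algebra_simps)
  have "lam ?C = a + lam v * (?q * \<kappa>)"
    by (rule lam_unique[OF _ C]) (use e subspace_0[OF image_subspace] in simp)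
  then show ?thesis using e by simp
qed

definition H :: "nat \<Rightarrow> nat \<Rightarrow> 'b" where "H a b = (M False ^^ a) ((M True ^^ b) h)"

lemma H_V: "H a b \<in> V"
proof -
  have "(M True ^^ b) h \<in> V" by (induction b) (auto intro: M_V hV)
  then show ?thesis unfolding H_def by (induction a) (auto intro: M_V)
qed

text \<open>By the trace argument for commutators of rank one, the two operators commute on everything that they generate from \<open>h\<close>.\<close>

lemma M_H: "M False (H a b) = H (Suc a) b" "M True (H a b) = H a (Suc b)"
proof -
  show "M False (H a b) = H (Suc a) b" unfolding H_def by simp
  obtain B where B: "B \<subseteq> V" "independent B" "V \<subseteq> span B" "card B = dim V"
    by (rule basis_exists)
  have spanB: "span B = V" using span_minimal[OF B(1) V_sub] B(3) by (rule subset_antisym)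
  obtain B0 where B0: "finite B0" "A s = span B0" using A_fin by blast
  have "B \<subseteq> span B0" using subset_trans[OF B(1) V_A] unfolding B0(2) .
  then have finB: "finite B" using independent_span_bound[OF B0(1) B(2)] by simp
  have "M True ((M False ^^ a) ((M True ^^ b) h)) = (M False ^^ a) ((M True ^^ Suc b) h)"
  proof (rule rank_one_commutator[where X = "M False" and Y = "M True" and u = h and B = B
        and c = "\<lambda>v. lam (M False (M True v) - M True (M False v))", OF char0 finB B(2)])
    show "lin_endo_on (span B) (M False)" "lin_endo_on (span B) (M True)"
      unfolding spanB by (rule M_lin)+
    show "h \<in> span B" unfolding spanB by (rule hV)
    show "\<And>v. v \<in> span B \<Longrightarrow> M False (M True v) - M True (M False v)
      = scale (lam (M False (M True v) - M True (M False v))) h"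
      unfolding spanB by (rule M_commutator)
    show "lin_functional_on (span B) (\<lambda>v. lam (M False (M True v) - M True (M False v)))"
      unfolding spanB lin_functional_on_def
    proof (intro conjI ballI allI)
      have M_add: "M m (v + w) = M m v + M m w" if "v \<in> V" "w \<in> V" for m v w
        using M_lin that unfolding lin_endo_on_def by blast
      have M_scale: "M m (scale a v) = scale a (M m v)" if "v \<in> V" for m a v
        using M_lin that unfolding lin_endo_on_def by blast
      have lam_add: "lam (v + w) = lam v + lam w" if "v \<in> V" "w \<in> V" for v w
        using lam_lin that unfolding lin_functional_on_def by blast
      have lam_scale: "lam (scale a v) = a * lam v" if "v \<in> V" for a v
        using lam_lin that unfolding lin_functional_on_def by blast
      have CV: "M False (M True v) - M True (M False v) \<in> V" if "v \<in> V" for v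
        using that by (intro subspace_diff V_sub M_V)
      fix v assume v: "v \<in> V"
      {
        fix w assume w: "w \<in> V"
        have "M False (M True (v + w)) - M True (M False (v + w))
          = (M False (M True v) - M True (M False v)) + (M False (M True w) - M True (M False w))"
          using v w by (simp add: M_add M_V algebra_simps)
        then show "lam (M False (M True (v + w)) - M True (M False (v + w)))
          = lam (M False (M True v) - M True (M False v)) + lam (M False (M True w) - M True (M False w))"
          using lam_add[OF CV[OF v] CV[OF w]] by simp
      }
      fix a
      have "M False (M True (scale a v)) - M True (M False (scale a v))
          = scale a (M False (M True v) - M True (M False v))"
        using v by (simp add: M_scale M_V scale_right_diff_distrib)
      then show "lam (M False (M True (scale a v)) - M True (M False (scale a v)))
          = a * lam (M False (M True v) - M True (M False v))"
        using lam_scale[OF CV[OF v]] by simp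
    qed
  qed
  then show "M True (H a b) = H a (Suc b)" unfolding H_def .
qed

definition pw :: "nat \<Rightarrow> nat \<Rightarrow> 'b \<Rightarrow> 'b" where "pw a b v = (M False ^^ a) ((M True ^^ b) v)"

lemma pw_H: "pw a b (H a' b') = H (a + a') (b + b')"
proof -
  have "(M True ^^ b) (H a' b') = H a' (b + b')" by (induction b) (auto simp: M_H)
  then show ?thesis unfolding pw_def by (induction a) (auto simp: M_H)
qed

lemma pw_lin: "lin_endo_on V (pw a b)"
  unfolding pw_def by (rule lin_endo_on_comp[OF lin_endo_on_funpow[OF M_lin] lin_endo_on_funpow[OF M_lin]])

lemma pw_V: "v \<in> V \<Longrightarrow> pw a b v \<in> V"
  using pw_lin unfolding lin_endo_on_def by blast

definition Yw :: "nat \<Rightarrow> nat \<Rightarrow> 'b \<Rightarrow> 'b" where "Yw a b v = (Y False ^^ a) ((Y True ^^ b) v)"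

lemma Yw_closed: "v \<in> A j \<Longrightarrow> Yw a b v \<in> A (j + (a + b))"
proof -
  assume v: "v \<in> A j"
  have "(Y True ^^ b) v \<in> A (j + b)" using v by (induction b) (auto intro: Y_closed)
  then have "Yw a b v \<in> A (j + b + a)" unfolding Yw_def by (induction a) (auto intro: Y_closed)
  then show ?thesis by (simp add: add.assoc add.commute[of b a])
qed

lemma Y_Ypow: "Y m ((Y m' ^^ n) v) = (Y m' ^^ n) (Y m v)"
  by (induction n) (auto simp: YY[of m m'])

lemma Yw_Y: "Yw a b (Y False v) = Yw (Suc a) b v" "Yw a b (Y True v) = Yw a (Suc b) v"
  unfolding Yw_def Y_Ypow[where m = False and m' = True, symmetric] by (simp_all only: funpow_Suc_right o_apply)

lemma Y_Yw: "Y False (Yw a b v) = Yw (Suc a) b v" "Y True (Yw a b v) = Yw a (Suc b) v"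
  unfolding Yw_def by (simp_all add: Y_Ypow)

lemma Yw_L: "Yw a b (L v) = L (Yw a b v)"
proof -
  have "(Y m ^^ n) (L v) = L ((Y m ^^ n) v)" for m n v by (induction n) (auto simp: YL)
  then show ?thesis unfolding Yw_def by simp
qed

lemma Yw_Lpow: "Yw a b ((L ^^ n) v) = (L ^^ n) (Yw a b v)"
  by (induction n) (auto simp: Yw_L)

lemma Yw_zero: "Yw a b 0 = 0"
proof -
  have "(Y m ^^ n) 0 = 0" for m n by (induction n) (auto simp: Y.zero)
  then show ?thesis unfolding Yw_def by simp
qed

text \<open>Below degree \<open>s\<close> there are no socle elements of \<open>A/LA\<close>. So an element of degree \<open>s - n\<close> is divisible by \<open>L\<close> as soon as its products with
all monomials of degree \<open>n\<close> are.\<close>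

lemma divisible_below:
  "n < s \<Longrightarrow> u \<in> A (s - n) \<Longrightarrow> (\<And>a b. a + b = n \<Longrightarrow> Yw a b u \<in> L ` A (s - 1))
    \<Longrightarrow> u \<in> L ` A (s - n - 1)"
proof (induction n arbitrary: u)
  case 0
  then show ?case using "0.prems"(3)[of 0 0] by (simp add: Yw_def)
next
  case (Suc n)
  have YA: "Y m u \<in> A (s - n)" for m
    using Y_closed[OF Suc.prems(2), of m] Suc.prems(1) by (simp add: Suc_diff_Suc)
  have "Y m u \<in> L ` A (s - n - 1)" for m
  proof (rule Suc.IH[OF _ YA])
    show "n < s" using Suc.prems(1) by simp
    fix a b assume "a + b = n"
    then show "Yw a b (Y m u) \<in> L ` A (s - 1)"
      using Suc.prems(3)[of "Suc a" b] Suc.prems(3)[of a "Suc b"] by (cases m) (auto simp: Yw_Y)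
  qed
  then have "soc (s - Suc n) u" unfolding soc_def using Suc.prems(2) by simp
  then show ?case using soc_elsewhere[of "s - Suc n" u] Suc.prems(1) s_less i_le by simp
qed

lemma division:
  assumes v: "v \<in> V"
  shows "n \<le> s \<Longrightarrow> (\<And>a b. a + b < n \<Longrightarrow> lam (pw a b v) = 0) \<Longrightarrow>
    \<exists>u\<in>A (s - n). \<forall>a b. a + b \<le> n \<longrightarrow> pw a b v = (L ^^ (n - (a + b))) (Yw a b u)"
proof (induction n)
  case 0
  then show ?case using v V_A by (intro bexI[of _ v]) (auto simp: pw_def Yw_def)
next
  case (Suc n)
  then obtain u where u: "u \<in> A (s - n)"
    and pw: "\<And>a b. a + b \<le> n \<Longrightarrow> pw a b v = (L ^^ (n - (a + b))) (Yw a b u)"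
    by (metis Suc_leD less_SucI)
  have "u \<in> L ` A (s - n - 1)"
  proof (rule divisible_below[OF _ u])
    show "n < s" using Suc.prems(1) by simp
    fix a b assume ab: "a + b = n"
    then have "Yw a b u = pw a b v" using pw[of a b] by simp
    moreover have "pw a b v \<in> L ` A (s - 1)"
      using lam_mem[OF pw_V[OF v, of a b]] Suc.prems(2)[of a b] ab by simp
    ultimately show "Yw a b u \<in> L ` A (s - 1)" by simp
  qed
  then obtain u' where u': "u' \<in> A (s - Suc n)" "u = L u'" by auto
  have pw': "pw a b v = (L ^^ (Suc n - (a + b))) (Yw a b u')" if "a + b \<le> n" for a b
    using pw[OF that] that u'(2) by (simp add: Yw_L Suc_diff_le funpow_swap1)
  have top: "M m (pw a b v) = Y m (Yw a b u')" if ab: "a + b = n" for m a b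
  proof -
    have e: "pw a b v = L (Yw a b u')" using pw'[of a b] ab by simp
    have "Yw a b u' \<in> A (s - 1)"
      using Yw_closed[OF u'(1), of a b] ab Suc.prems(1) by (simp add: Suc_diff_Suc)
    then show ?thesis using M_L(2)[of "Yw a b u'" m] pw_V[OF v, of a b] unfolding e by simp
  qed
  have "pw a b v = (L ^^ (Suc n - (a + b))) (Yw a b u')" if "a + b \<le> Suc n" for a b
  proof (cases "a + b \<le> n")
    case True
    then show ?thesis by (rule pw')
  next
    case False
    then have ab: "a + b = Suc n" using that by simp
    show ?thesis
    proof (cases a)
      case 0
      then obtain b' where "b = Suc b'" using ab by (cases b) auto
      then show ?thesis using top[of 0 b' True] 0 ab by (simp add: pw_def Y_Yw)
    next
      case (Suc a')
      then show ?thesis using top[of a' b False] ab by (simp add: pw_def Y_Yw)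
    qed
  qed
  then show ?case using u'(1) by blast
qed

text \<open>By the previous lemma \<open>v\<close> is divisible by \<open>L\<close> as often as monomials in the operators are killed by \<open>\<lambda>\<close>; divisibility by \<open>L\<^sup>s\<close>
leads to \<open>A 0 = {0}\<close>. In other words, the Hankel form \<open>\<lambda>(M\<^sup>\<alpha> M\<^sup>\<beta> h)\<close> is non-degenerate already with the monomials of degree
less than \<open>s\<close>.\<close>

lemma lam_nondegenerate:
  assumes "v \<in> V" "\<And>a b. a + b < s \<Longrightarrow> lam (pw a b v) = 0" shows "v = 0"
proof -
  obtain u where "u \<in> A (s - s)" "\<And>a b. a + b \<le> s \<Longrightarrow> pw a b v = (L ^^ (s - (a + b))) (Yw a b u)"
    using division[OF assms(1) order_refl] assms(2) by blast
  moreover then have "u = 0" using A_0 by simp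
  ultimately have "pw 0 0 v = 0" using Yw_zero Lpow_zero by simp
  then show ?thesis by (simp add: pw_def)
qed

lemma L_H: "(L ^^ (a + b)) (H a b) = Yw a b h"
proof (induction a)
  case 0
  show ?case
  proof (induction b)
    case 0
    show ?case by (simp add: H_def Yw_def)
  next
    case (Suc b)
    have "(L ^^ (0 + Suc b)) (H 0 (Suc b)) = (L ^^ b) (L (M True (H 0 b)))" by (simp add: M_H funpow_swap1)
    also have "\<dots> = Y True ((L ^^ b) (H 0 b))" using H_V by (simp add: L_M YLpow)
    finally show ?case using Suc by (simp add: Y_Yw)
  qed
next
  case (Suc a)
  have "(L ^^ (Suc a + b)) (H (Suc a) b) = (L ^^ (a + b)) (L (M False (H a b)))" by (simp add: M_H funpow_swap1)
  also have "\<dots> = Y False ((L ^^ (a + b)) (H a b))" using H_V by (simp add: L_M YLpow)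
  finally show ?case using Suc by (simp add: Y_Yw)
qed

lemma Lpow_h: "n > p \<Longrightarrow> (L ^^ n) h = 0"
proof -
  assume "n > p"
  then have "n = (n - Suc p) + Suc p" by simp
  then have "(L ^^ n) h = (L ^^ (n - Suc p)) ((L ^^ Suc p) h)" by (metis funpow_add comp_apply)
  then show ?thesis using Lgh Lpow_zero by simp
qed

lemma Lpow_H: assumes "a + b \<le> n" shows "(L ^^ n) (H a b) = (L ^^ (n - (a + b))) (Yw a b h)"
proof -
  have "n = (n - (a + b)) + (a + b)" using assms by simp
  then have "(L ^^ n) (H a b) = (L ^^ (n - (a + b))) ((L ^^ (a + b)) (H a b))" by (metis funpow_add comp_apply)
  then show ?thesis using L_H by simp
qed

text \<open>The socle of \<open>A\<close> lies in degree \<open>N - 1\<close>, so a non-zero element of degree \<open>j\<close> has a non-zero multiple in every degree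
from \<open>j\<close> to \<open>N - 1\<close>.\<close>

lemma killed_imp_zero:
  "j + n < N \<Longrightarrow> x \<in> A j \<Longrightarrow> (\<And>a b. a + b \<le> n \<Longrightarrow> (L ^^ (n - (a + b))) (Yw a b x) = 0) \<Longrightarrow> x = 0"
proof (induction n arbitrary: j x)
  case 0
  then show ?case using "0.prems"(3)[of 0 0] by (simp add: Yw_def)
next
  case (Suc n)
  have "L x = 0"
  proof (rule Suc.IH[of "Suc j"])
    fix a b assume "a + b \<le> n"
    then show "(L ^^ (n - (a + b))) (Yw a b (L x)) = 0"
      using Suc.prems(3)[of a b] by (simp add: Yw_L Suc_diff_le funpow_swap1)
  qed (use Suc.prems in \<open>auto intro: L_closed\<close>)
  moreover have "Y m x = 0" for m
  proof (rule Suc.IH[of "Suc j"])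
    fix a b assume "a + b \<le> n"
    then show "(L ^^ (n - (a + b))) (Yw a b (Y m x)) = 0"
      using Suc.prems(3)[of "Suc a" b] Suc.prems(3)[of a "Suc b"] by (cases m) (auto simp: Yw_Y)
  qed (use Suc.prems in \<open>auto intro: Y_closed\<close>)
  ultimately show ?case using socle[of j x] Suc.prems by simp
qed

text \<open>For \<open>z\<close> in the degree dual to \<open>s + i\<close>, the functional \<open>\<xi>(v) = \<langle>L\<^sup>i v, z\<rangle>\<close> kills \<open>M\<^sup>\<beta> h\<close> for \<open>|\<beta>| < s\<close>, since
\<open>L\<^sup>i M\<^sup>\<beta> h = L\<^sup>i\<^sup>-\<^sup>|\<^sup>\<beta>\<^sup>| Y\<^sup>\<beta> h\<close> involves \<open>L\<^sup>p\<^sup>+\<^sup>1 h = 0\<close>. By the non-degeneracy of the Hankel form, \<open>\<xi>(M\<^sup>\<beta> h) = \<lambda>(M\<^sup>\<beta> q)\<close> for some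
combination \<open>q\<close> of the \<open>M\<^sup>\<alpha> h\<close> with \<open>|\<alpha>| < s\<close>, and the same non-degeneracy yields \<open>q = 0\<close>. So \<open>\<xi>\<close> kills
all \<open>M\<^sup>\<beta> h\<close>, and all monomials of degree \<open>i\<close> in \<open>L\<close> and the \<open>Y m\<close> kill \<open>h\<close>. This is impossible because \<open>s + i \<le> 2 i < N\<close>.\<close>

lemma contradiction: False
proof -
  define V' where "V' = span {H a b | a b. True}"
  have V'V: "V' \<subseteq> V" unfolding V'_def using H_V by (intro span_minimal V_sub) auto
  have V'_sub: "subspace V'" unfolding V'_def by (rule subspace_span)
  have HV': "H a b \<in> V'" for a b unfolding V'_def by (intro span_base) blast
  define J where "J = {(a, b). a + b < s}"
  have finJ: "finite J"
    by (rule finite_subset[of _ "{..s} \<times> {..s}"]) (auto simp: J_def)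
  have siN: "s + i \<le> N" "s + i < N" using s_le i_low by auto
  have all0: "(L ^^ i) (H a b) = 0" for a b
  proof (rule nondeg[OF siN(1)])
    show "(L ^^ i) (H a b) \<in> A (s + i)" using H_V V_A Lpow_closed by blast
    fix z assume z: "z \<in> A (N - (s + i))"
    define \<xi> where "\<xi> v = pair (s + i) ((L ^^ i) v) z" for v
    have "\<exists>f. \<forall>v\<in>V'. \<xi> v = (\<Sum>j\<in>J. f j * lam (pw (fst j) (snd j) v))"
    proof (rule functional_in_span_of_kernels[OF finJ V'_sub])
      fix j assume "j \<in> J"
      have "lin_functional_on V (\<lambda>v. lam (pw (fst j) (snd j) v))"
        using lam_lin pw_lin[of "fst j" "snd j"] unfolding lin_functional_on_def lin_endo_on_def by simp
      then show "lin_functional_on V' (\<lambda>v. lam (pw (fst j) (snd j) v))"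
        using V'V by (rule lin_functional_on_subset)
    next
      have "(L ^^ i) v \<in> A (s + i)" if "v \<in> V'" for v using that V'V V_A Lpow_closed by blast
      then show "lin_functional_on V' \<xi>"
        unfolding \<xi>_def lin_functional_on_def using siN z
        by (auto simp: Lpow_add Lpow_scale pair_add pair_scale)
    next
      fix v assume v: "v \<in> V'" and 0: "\<And>j. j \<in> J \<Longrightarrow> lam (pw (fst j) (snd j) v) = 0"
      have "v = 0"
      proof (rule lam_nondegenerate)
        show "v \<in> V" using v V'V by blast
        fix a b assume "a + b < s"
        then show "lam (pw a b v) = 0" using 0[of "(a, b)"] unfolding J_def by simp
      qed
      then show "\<xi> v = 0" unfolding \<xi>_def using pair_zero siN z Lpow_zero by simp
    qed
    then obtain f where f: "\<And>v. v \<in> V' \<Longrightarrow> \<xi> v = (\<Sum>j\<in>J. f j * lam (pw (fst j) (snd j) v))" by blast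
    define q where "q = (\<Sum>j\<in>J. scale (f j) (H (fst j) (snd j)))"
    have qV: "q \<in> V" unfolding q_def using H_V by (intro subspace_sum subspace_scale V_sub) auto
    have pq: "lam (pw a' b' q) = \<xi> (H a' b')" for a' b'
    proof -
      have "pw a' b' q = (\<Sum>j\<in>J. scale (f j) (pw a' b' (H (fst j) (snd j))))"
        unfolding q_def by (rule lin_endo_on_sum[OF pw_lin V_sub finJ H_V])
      then have "lam (pw a' b' q) = (\<Sum>j\<in>J. f j * lam (pw a' b' (H (fst j) (snd j))))"
        using lin_functional_on_sum[OF lam_lin V_sub finJ pw_V[OF H_V]] by simp
      also have "\<dots> = (\<Sum>j\<in>J. f j * lam (pw (fst j) (snd j) (H a' b')))"
        by (simp add: pw_H add.commute)
      finally show ?thesis using f[OF HV'] by simp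
    qed
    have "q = 0"
    proof (rule lam_nondegenerate[OF qV])
      fix a' b' assume ab: "a' + b' < s"
      then have "(L ^^ i) (H a' b') = Yw a' b' ((L ^^ (i - (a' + b'))) h)"
        using Lpow_H[of a' b' i] s_le by (simp add: Yw_Lpow)
      also have "\<dots> = 0" using Lpow_h[of "i - (a' + b')"] ab sp Yw_zero by simp
      finally show "lam (pw a' b' q) = 0"
        unfolding pq \<xi>_def using pair_zero siN z by simp
    qed
    then have "lam (pw a b q) = 0"
      using lin_endo_on_sum[OF pw_lin V_sub, of "{}"] lin_functional_on_sum[OF lam_lin V_sub, of "{}"] by simp
    then show "pair (s + i) ((L ^^ i) (H a b)) z = 0" using pq[of a b] unfolding \<xi>_def by simp
  qed
  have "h = 0"
  proof (rule killed_imp_zero[OF siN(2) hA])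
    fix a b assume "a + b \<le> i"
    then show "(L ^^ (i - (a + b))) (Yw a b h) = 0" using all0[of a b] Lpow_H by simp
  qed
  then show False using h_nz by blast
qed

end

context graded_duality_type_two
begin

theorem lower_half_injective:
  assumes "2 * i + 1 \<le> N" "x \<in> A i" "L x = 0" shows "x = 0"
proof (rule ccontr)
  assume x: "x \<noteq> 0"
  define P where "P j \<longleftrightarrow> (\<exists>x\<in>A j. x \<noteq> 0 \<and> L x = 0)" for j
  define k where "k = (LEAST j. P j)"
  have "P i" using assms x unfolding P_def by blast
  then have k: "P k" "k \<le> i" unfolding k_def by (auto intro: LeastI Least_le)
  have below: "\<not> P j" if "j < k" for j using that not_less_Least unfolding k_def by blast
  interpret lefschetz_failure scale N A L Y pair D d k
    by unfold_locales (use k below assms(1) in \<open>auto simp: P_def\<close>)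
  obtain s p h where w: "s + p = k" "1 \<le> s" "h \<in> A s" "h \<notin> L ` A (s - 1)" "L ((L ^^ p) h) = 0"
    "\<And>g. g \<in> A k \<Longrightarrow> L g = 0 \<Longrightarrow> g \<in> (L ^^ p) ` A s" using ex_generator by blast
  interpret lefschetz_failure_witness scale N A L Y pair D d k s p h
    by unfold_locales (use w in auto)
  obtain c \<kappa> where c: "\<And>m. scale (of_nat (Suc p)) (Y m h) + L (D m h - scale (c m) h) = 0"
    "Y False (D True h - scale (c True) h) - Y True (D False h - scale (c False) h) = scale \<kappa> (L h)"
    using torsion_free_connection by blast
  interpret lefschetz_failure_connection scale N A L Y pair D d k s p h c \<kappa>
    by unfold_locales (use c in auto)
  show False by (rule contradiction)
qed

end

section \<open>Inverse systems in three variables\<close>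

type_synonym mon = "3 \<Rightarrow>\<^sub>0 nat"

abbreviation var :: "3 \<Rightarrow> mon" where "var i \<equiv> Poly_Mapping.single i 1"

definition mons :: "nat \<Rightarrow> mon set" where "mons j = {m. monomial_degree m = j}"

lemma UNIV_three: "(UNIV :: 3 set) = {0, 1, 2}"
proof (rule card_subset_eq[symmetric])
  have "(0::3) \<noteq> 1" "(0::3) \<noteq> 2" "(1::3) \<noteq> 2" by simp_all
  then show "card {0, 1, 2 :: 3} = card (UNIV :: 3 set)" by simp
qed simp_all

lemma sum_three: "(\<Sum>i\<in>UNIV. f i) = f (0::3) + f 1 + f 2"
  unfolding UNIV_three by (simp add: add.assoc)

lemma exhaust_three: "(i::3) = 0 \<or> i = 1 \<or> i = 2"
  using UNIV_three by auto

lemma monomial_degree_add: "monomial_degree (m + m') = monomial_degree m + monomial_degree m'"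
  unfolding monomial_degree_def by (simp add: lookup_add sum.distrib)

lemma monomial_degree_var: "monomial_degree (var i) = 1"
  unfolding monomial_degree_def by (simp add: lookup_single when_def)

lemma monomial_degree_zero: "monomial_degree m = 0 \<longleftrightarrow> m = 0"
  unfolding monomial_degree_def by (auto intro: poly_mapping_eqI)

lemma finite_mons: "finite (mons j)"
proof (rule finite_imageD[of Poly_Mapping.lookup])
  have "Poly_Mapping.lookup m i \<le> j" if "m \<in> mons j" for m i
    using that member_le_sum[of i UNIV "Poly_Mapping.lookup m"] unfolding mons_def monomial_degree_def by auto
  then have "Poly_Mapping.lookup ` mons j \<subseteq> PiE UNIV (\<lambda>_. {..j})" by (auto simp: PiE_UNIV_domain)
  then show "finite (Poly_Mapping.lookup ` mons j)"
    by (rule finite_subset) (intro finite_PiE, auto)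
  show "inj_on Poly_Mapping.lookup (mons j)" by (simp add: inj_on_def poly_mapping.lookup_inject)
qed

lemma split_var:
  assumes "m \<in> mons (Suc j)" shows "\<exists>i. \<exists>m'\<in>mons j. m = m' + var i"
proof -
  have "m \<noteq> 0" using assms monomial_degree_zero[of m] unfolding mons_def by auto
  then obtain i where i: "Poly_Mapping.lookup m i \<noteq> 0" by (auto simp: poly_mapping_eq_iff fun_eq_iff)
  have e: "m = (m - var i) + var i"
    by (rule poly_mapping_eqI) (use i in \<open>auto simp: lookup_add lookup_minus lookup_single when_def\<close>)
  have "monomial_degree m = monomial_degree (m - var i) + 1"
    using monomial_degree_add[of "m - var i" "var i"] monomial_degree_var[of i] e by simp
  then show ?thesis using e assms unfolding mons_def by auto
qed

lemma mons_var: "m \<in> mons a \<Longrightarrow> m + var i \<in> mons (Suc a)"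
  unfolding mons_def by (simp add: monomial_degree_add monomial_degree_var[unfolded One_nat_def])

definition sc :: "'f::field \<Rightarrow> (mon \<Rightarrow> 'f) \<Rightarrow> (mon \<Rightarrow> 'f)" where "sc c F = (\<lambda>m. c * F m)"

interpretation inv: linear_space sc
  by unfold_locales (auto simp: sc_def plus_fun_def distrib_left distrib_right mult.assoc)

lemma sum_sc_apply: "(\<Sum>s\<in>S. sc (c s) (F s)) m = (\<Sum>s\<in>S. c s * F s m)"
  by (induction S rule: infinite_finite_induct) (auto simp: sc_def plus_fun_def zero_fun_def)

text \<open>A function \<open>\<tau>\<close> on the monomials of degree \<open>e\<close> is a linear form on the polynomials of degree \<open>e\<close>. It determines a
Gorenstein algebra: the quotient of the polynomial ring by the polynomials \<open>f\<close> with \<open>\<tau>(f g) = 0\<close> for all \<open>g\<close> (Macaulay).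
Here the class of \<open>f\<close> is represented by the function \<open>m \<mapsto> \<tau>(f m)\<close>, so that congruences become equations of functions, and the
multiplication by a variable is a shift. The derivations act on the field and kill the values of \<open>\<tau>\<close>.\<close>

locale inverse_system =
  fixes \<tau> :: "mon \<Rightarrow> 'f::field" and e :: nat and t :: "3 \<Rightarrow> 'f" and d :: "bool \<Rightarrow> 'f \<Rightarrow> 'f"
  assumes tau_deg: "monomial_degree m \<noteq> e \<Longrightarrow> \<tau> m = 0"
    and d_add: "d k (x + y) = d k x + d k y" and d_mult: "d k (x * y) = x * d k y + d k x * y"
    and d_tau: "d k (\<tau> m) = 0" and d_comm: "d False (d True x) = d True (d False x)"
    and d_t: "d False (t 0) = 1" "d False (t 1) = 0" "d False (t 2) = 0"
      "d True (t 0) = 0" "d True (t 1) = 1" "d True (t 2) = 0"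
    and t2: "t 2 \<noteq> 0" and char_zero: "of_nat (Suc n) \<noteq> (0::'f)"
begin

definition sh :: "mon \<Rightarrow> mon \<Rightarrow> 'f" where "sh m = (\<lambda>m'. \<tau> (m + m'))"

definition lincomb :: "nat \<Rightarrow> (mon \<Rightarrow> 'f) \<Rightarrow> mon \<Rightarrow> 'f" where "lincomb j c = (\<Sum>m\<in>mons j. sc (c m) (sh m))"

fun A :: "nat \<Rightarrow> (mon \<Rightarrow> 'f) set" where
  "A 0 = {0}" | "A (Suc j) = inv.span (sh ` mons j)"

definition mv :: "3 \<Rightarrow> (mon \<Rightarrow> 'f) \<Rightarrow> mon \<Rightarrow> 'f" where "mv i F = (\<lambda>m. F (m + var i))"

definition L :: "(mon \<Rightarrow> 'f) \<Rightarrow> mon \<Rightarrow> 'f" where "L F = (\<lambda>m. \<Sum>i\<in>UNIV. t i * F (m + var i))"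

definition Y :: "bool \<Rightarrow> (mon \<Rightarrow> 'f) \<Rightarrow> mon \<Rightarrow> 'f" where "Y k = mv (if k then 1 else 0)"

definition D :: "bool \<Rightarrow> (mon \<Rightarrow> 'f) \<Rightarrow> mon \<Rightarrow> 'f" where "D k F = (\<lambda>m. d k (F m))"

lemma lincomb_apply: "lincomb j c m' = (\<Sum>m\<in>mons j. c m * \<tau> (m + m'))"
  unfolding lincomb_def sum_sc_apply sh_def by simp

lemma A_Suc_iff: "F \<in> A (Suc j) \<longleftrightarrow> (\<exists>c. F = lincomb j c)"
proof
  have "lincomb j c \<in> A (Suc j)" for c
    unfolding lincomb_def A.simps by (intro inv.span_sum inv.span_scale inv.span_base imageI)
  then show "\<exists>c. F = lincomb j c \<Longrightarrow> F \<in> A (Suc j)" by blast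
  assume "F \<in> A (Suc j)"
  then have "F \<in> inv.span (sh ` mons j)" by simp
  then show "\<exists>c. F = lincomb j c"
  proof (rule inv.span_induct)
    have z: "0 = lincomb j (\<lambda>_. 0)" by (auto simp: lincomb_apply fun_eq_iff)
    have a: "lincomb j c + lincomb j c' = lincomb j (\<lambda>m. c m + c' m)" for c c'
      by (auto simp: lincomb_apply fun_eq_iff plus_fun_def sum.distrib distrib_right)
    have s: "sc b (lincomb j c) = lincomb j (\<lambda>m. b * c m)" for b c
      by (auto simp: lincomb_apply fun_eq_iff sc_def sum_distrib_left mult.assoc)
    show "inv.subspace {F. \<exists>c. F = lincomb j c}"
      unfolding inv.subspace_def using z a s by blast
    fix F assume "F \<in> sh ` mons j"
    then obtain m where m: "m \<in> mons j" "F = sh m" by blast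
    have "F = lincomb j (\<lambda>m'. if m' = m then 1 else 0)"
      using m finite_mons[of j] by (auto simp: lincomb_apply sh_def fun_eq_iff if_distrib[of "\<lambda>x. x * _"] cong: if_cong)
    then show "\<exists>c. F = lincomb j c" by blast
  qed
qed

lemma sh_A: "m \<in> mons j \<Longrightarrow> sh m \<in> A (Suc j)"
  by (auto intro: inv.span_base)

lemma A_subspace: "inv.subspace (A j)"
  by (cases j) (auto simp: inv.subspace_def inv.span_zero inv.span_add inv.span_scale)

lemma mv_add: "mv i (F + G) = mv i F + mv i G" and mv_sc: "mv i (sc c F) = sc c (mv i F)"
  by (auto simp: mv_def sc_def plus_fun_def)

lemma mv_closed: "F \<in> A j \<Longrightarrow> mv i F \<in> A (Suc j)"
proof (cases j)
  case 0
  assume "F \<in> A j"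
  then have "mv i F = 0" using 0 by (auto simp: mv_def zero_fun_def)
  then show ?thesis using A_subspace inv.subspace_0 by metis
next
  case (Suc a)
  assume "F \<in> A j"
  then have "F \<in> inv.span (sh ` mons a)" using Suc by simp
  then have "mv i F \<in> A (Suc (Suc a))"
  proof (rule inv.span_induct)
    have z: "mv i 0 = 0" by (auto simp: mv_def zero_fun_def)
    show "inv.subspace {F. mv i F \<in> A (Suc (Suc a))}"
      using A_subspace[of "Suc (Suc a)"] unfolding inv.subspace_def
      by (auto simp: mv_add mv_sc z simp del: A.simps)
    fix F assume "F \<in> sh ` mons a"
    then obtain m where m: "m \<in> mons a" "F = sh m" by blast
    have "mv i F = sh (m + var i)" unfolding m mv_def sh_def by (simp add: ac_simps)
    then show "mv i F \<in> A (Suc (Suc a))" using sh_A[OF mons_var[OF m(1)]] by simp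
  qed
  then show ?thesis using Suc by simp
qed

lemma L_alt: "L F = (\<Sum>i\<in>UNIV. sc (t i) (mv i F))"
  unfolding L_def by (auto simp: sum_sc_apply mv_def fun_eq_iff)

lemma L_closed: "F \<in> A j \<Longrightarrow> L F \<in> A (Suc j)"
  unfolding L_alt
  by (intro inv.subspace_sum[OF A_subspace] inv.subspace_scale[OF A_subspace] mv_closed)

lemma d_zero: "d k 0 = 0"
proof -
  have "d k 0 + d k 0 = d k 0 + 0" using d_add[of k 0 0] by (metis add_0_right)
  then show ?thesis by (rule add_left_imp_eq)
qed
lemma d_one: "d k 1 = 0"
proof -
  have "d k 1 + d k 1 = d k 1 + 0" using d_mult[of k 1 1] by (metis add_0_right mult_1 mult_1_right)
  then show ?thesis by (rule add_left_imp_eq)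
qed
lemma d_nat: "d k (of_nat n) = 0" by (induction n) (auto simp: d_zero d_one d_add)
lemma d_sum: "d k (sum f S) = (\<Sum>s\<in>S. d k (f s))"
  by (induction S rule: infinite_finite_induct) (auto simp: d_zero d_add)

lemma D_closed: "F \<in> A j \<Longrightarrow> D k F \<in> A j"
proof (cases j)
  case 0
  assume "F \<in> A j"
  then show ?thesis using 0 by (auto simp: D_def zero_fun_def d_zero)
next
  case (Suc a)
  assume "F \<in> A j"
  then obtain c where c: "F = lincomb a c" using Suc A_Suc_iff by blast
  have "D k F = lincomb a (\<lambda>m. d k (c m))"
    unfolding c D_def by (auto simp: fun_eq_iff lincomb_apply d_sum d_mult d_tau)
  then show ?thesis using Suc A_Suc_iff by blast
qed

text \<open>The pairing \<open>\<langle>f, g\<rangle> = \<tau>(f g)\<close>, for a function \<open>F\<close> that represents \<open>f = \<Sum> c m m\<close> and a function \<open>G\<close> that represents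
\<open>g\<close>. The choice of the coefficients \<open>c\<close> is irrelevant by the symmetry of \<open>\<Sum> c m (c' m') \<tau>(m m')\<close>.\<close>

definition pair :: "nat \<Rightarrow> (mon \<Rightarrow> 'f) \<Rightarrow> (mon \<Rightarrow> 'f) \<Rightarrow> 'f"
  where "pair j F G = (if j = 0 then 0 else \<Sum>m\<in>mons (j - 1). (SOME c. F = lincomb (j - 1) c) m * G m)"

lemma swap_coeffs: "(\<Sum>m\<in>mons a. c m * lincomb b c' m) = (\<Sum>m\<in>mons b. c' m * lincomb a c m)"
  unfolding lincomb_apply sum_distrib_left
  by (subst sum.swap) (simp add: ac_simps)

lemma pair_right:
  assumes "F \<in> A (Suc a)" shows "pair (Suc a) F (lincomb b c') = (\<Sum>m\<in>mons b. c' m * F m)"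
proof -
  have "\<exists>c. F = lincomb a c" using assms A_Suc_iff by blast
  then have "F = lincomb a (SOME c. F = lincomb a c)" by (rule someI_ex)
  then show ?thesis using swap_coeffs[of "SOME c. F = lincomb a c" b c' a] unfolding pair_def by simp
qed

lemma pair_left:
  assumes "G = 0 \<or> (\<exists>b. G \<in> A (Suc b))" shows "pair (Suc a) (lincomb a c) G = (\<Sum>m\<in>mons a. c m * G m)"
proof (cases "G = 0")
  case True
  then show ?thesis unfolding pair_def by (simp add: zero_fun_def)
next
  case False
  then obtain b where b: "G \<in> A (Suc b)" using assms by auto
  then obtain c' where "G = lincomb b c'" using A_Suc_iff by blast
  then show ?thesis using pair_right[of "lincomb a c" a b c'] swap_coeffs[of c b c' a] A_Suc_iff by auto
qed

lemma A_cases: "G \<in> A j \<Longrightarrow> G = 0 \<or> (\<exists>b. G \<in> A (Suc b))"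
  by (cases j) auto

lemma pair_zero_right: "pair j F 0 = 0" unfolding pair_def by (simp add: zero_fun_def)

lemma pair_shift:
  assumes F: "F \<in> A j" and G: "G \<in> A n" shows "pair (Suc j) (mv i F) G = pair j F (mv i G)"
proof (cases j)
  case 0
  then have "mv i F = lincomb 0 (\<lambda>_. 0)" using F by (auto simp: mv_def zero_fun_def lincomb_apply)
  then show ?thesis using pair_left[OF A_cases[OF G], of 0 "\<lambda>_. 0"] 0 by (simp add: pair_def)
next
  case (Suc a)
  obtain c where c: "F = lincomb a c" using F Suc A_Suc_iff by blast
  show ?thesis
  proof (cases n)
    case 0
    then have "G = 0" "mv i G = 0" using G by (auto simp: mv_def zero_fun_def)
    then show ?thesis by (simp add: pair_zero_right)
  next
    case (Suc b)
    obtain c' where c': "G = lincomb b c'" using G Suc A_Suc_iff by blast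
    have "pair (Suc j) (mv i F) G = (\<Sum>m'\<in>mons b. \<Sum>m\<in>mons a. c' m' * (c m * \<tau> (m + (m' + var i))))"
      unfolding c' using mv_closed[OF F, of i] pair_right
      by (simp add: mv_def c lincomb_apply sum_distrib_left del: A.simps)
    also have "\<dots> = (\<Sum>m\<in>mons a. c m * mv i G m)"
      unfolding mv_def c' lincomb_apply sum_distrib_left
      by (subst sum.swap) (simp add: ac_simps)
    also have "\<dots> = pair j F (mv i G)"
      unfolding c \<open>j = Suc a\<close> using pair_left[OF A_cases[OF mv_closed[OF G]]] by simp
    finally show ?thesis .
  qed
qed

lemma pair_add_right: "pair j F (G + G') = pair j F G + pair j F G'"
  unfolding pair_def by (simp add: plus_fun_def distrib_left sum.distrib)

lemma pair_sc_right: "pair j F (sc c G) = c * pair j F G"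
  unfolding pair_def by (simp add: sc_def sum_distrib_left ac_simps)

lemma pair_lin_left:
  assumes "G \<in> A n" shows "inv.lin_functional_on (A j) (\<lambda>F. pair j F G)"
proof (cases j)
  case 0
  then show ?thesis by (simp add: inv.lin_functional_on_def pair_def)
next
  case (Suc a)
  have a: "lincomb a c + lincomb a c' = lincomb a (\<lambda>m. c m + c' m)" for c c'
    by (auto simp: lincomb_apply fun_eq_iff plus_fun_def sum.distrib distrib_right)
  have s: "sc b (lincomb a c) = lincomb a (\<lambda>m. b * c m)" for b c
    by (auto simp: lincomb_apply fun_eq_iff sc_def sum_distrib_left mult.assoc)
  show ?thesis
    unfolding Suc inv.lin_functional_on_def
  proof (intro conjI ballI allI)
    fix F F' assume "F \<in> A (Suc a)" "F' \<in> A (Suc a)"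
    then obtain c c' where "F = lincomb a c" "F' = lincomb a c'" using A_Suc_iff by blast
    then show "pair (Suc a) (F + F') G = pair (Suc a) F G + pair (Suc a) F' G"
      by (simp add: a pair_left[OF A_cases[OF assms]] distrib_right sum.distrib)
  next
    fix x F assume "F \<in> A (Suc a)"
    then obtain c where "F = lincomb a c" using A_Suc_iff by blast
    then show "pair (Suc a) (sc x F) G = x * pair (Suc a) F G"
      by (simp add: s pair_left[OF A_cases[OF assms]] sum_distrib_left mult.assoc)
  qed
qed

lemma pair_sum_left:
  assumes "G \<in> A n" "\<And>i. F i \<in> A j"
  shows "pair j (\<Sum>i\<in>(UNIV::3 set). sc (t i) (F i)) G = (\<Sum>i\<in>UNIV. t i * pair j (F i) G)"
  using inv.lin_functional_on_sum[OF pair_lin_left[OF assms(1)] A_subspace, where S = UNIV and x = F and a = t] assms(2) by simp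

lemma pair_sum_right: "pair j F (\<Sum>i\<in>S. sc (c i) (G i)) = (\<Sum>i\<in>S. c i * pair j F (G i))"
proof (induction S rule: infinite_finite_induct)
  case (insert x S)
  have "pair j F (\<Sum>i\<in>insert x S. sc (c i) (G i)) = pair j F (sc (c x) (G x) + (\<Sum>i\<in>S. sc (c i) (G i)))"
    by (simp only: sum.insert[OF insert.hyps(1,2)])
  then show ?case using insert by (simp add: pair_add_right pair_sc_right del: plus_fun_apply)
qed (simp_all only: sum.infinite sum.empty pair_zero_right not_False_eq_True)

lemma A_support:
  assumes "F \<in> A (Suc a)" "F m \<noteq> 0" shows "a + monomial_degree m = e"
proof -
  obtain c where "F = lincomb a c" using assms A_Suc_iff by blast
  then have "\<exists>m'\<in>mons a. \<tau> (m' + m) \<noteq> 0"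
    using assms(2) lincomb_apply[of a c m] by (metis (mono_tags, lifting) mult_zero_right sum.neutral)
  then obtain m' where "m' \<in> mons a" "monomial_degree (m' + m) = e" using tau_deg by blast
  then show ?thesis unfolding mons_def by (simp add: monomial_degree_add)
qed

sublocale graded_duality sc "e + 2" A L Y pair D d
proof unfold_locales
  show "of_nat (Suc n) \<noteq> (0::'f)" for n by (rule char_zero)
  show "inv.subspace (A j)" for j by (rule A_subspace)
  show "\<exists>B. finite B \<and> A j = inv.span B" for j
  proof (cases j)
    case 0
    then show ?thesis by (intro exI[of _ "{}"]) simp
  next
    case (Suc a)
    then show ?thesis by (intro exI[of _ "sh ` mons a"]) (simp add: finite_mons)
  qed
  show "A 0 = {0}" by simp
  show L_add: "L (b1 + b2) = L b1 + L b2" for b1 b2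
    by (auto simp: L_def plus_fun_def distrib_left sum.distrib)
  show "L (sc r b) = sc r (L b)" for r b
    by (auto simp: L_def sc_def sum_distrib_left ac_simps)
  show "Y k (b1 + b2) = Y k b1 + Y k b2" for k b1 b2 unfolding Y_def by (rule mv_add)
  show "Y k (sc r b) = sc r (Y k b)" for k r b unfolding Y_def by (rule mv_sc)
  show "v \<in> A j \<Longrightarrow> L v \<in> A (Suc j)" for v j by (rule L_closed)
  show "v \<in> A j \<Longrightarrow> Y m v \<in> A (Suc j)" for v j m unfolding Y_def by (rule mv_closed)
  show "Y m (L v) = L (Y m v)" for m v
    by (auto simp: Y_def mv_def L_def ac_simps)
  show "Y m (Y m' v) = Y m' (Y m v)" for m m' v
    by (auto simp: Y_def mv_def ac_simps)
  show "D m (v + w) = D m v + D m w" for m v w by (auto simp: D_def d_add plus_fun_def)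
  show "D m (sc c v) = sc c (D m v) + sc (d m c) v" for m c v
    by (auto simp: D_def d_mult plus_fun_def sc_def)
  show "d m (of_nat n) = 0" for m n by (rule d_nat)
  show "v \<in> A j \<Longrightarrow> D m v \<in> A j" for v j m by (rule D_closed)
  show "D m (D m' v) = D m' (D m v)" for m m' v
    using d_comm by (cases m; cases m') (auto simp: D_def)
  show "D m (Y m' v) = Y m' (D m v)" for m m' v by (auto simp: D_def Y_def mv_def)
  show "D m (L v) = L (D m v) + Y m v" for m v
  proof (rule ext)
    fix x
    have "D m (L v) x = (\<Sum>i\<in>UNIV. t i * d m (v (x + var i))) + (\<Sum>i\<in>UNIV. d m (t i) * v (x + var i))"
      by (simp add: D_def L_def d_sum d_mult sum.distrib)
    also have "(\<Sum>i\<in>UNIV. d m (t i) * v (x + var i)) = Y m v x"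
      unfolding sum_three by (cases m) (simp_all add: Y_def mv_def d_t)
    finally show "D m (L v) x = (L (D m v) + Y m v) x" by (simp add: L_def D_def plus_fun_def)
  qed
  show "inv.lin_functional_on (A j) (\<lambda>a. pair j a b)" if "b \<in> A (e + 2 - j)" for j b
    by (rule pair_lin_left[OF that])
  show "pair j a b = pair (e + 2 - j) b a" if j: "j \<le> e + 2" and a: "a \<in> A j" and b: "b \<in> A (e + 2 - j)" for j a b
  proof (cases "j = 0 \<or> e + 2 - j = 0")
    case True
    then have "a = 0 \<or> b = 0" using a b by (metis A.simps(1) singletonD)
    moreover have "pair i 0 G = 0" if "G \<in> A n" for i G n
      using pair_lin_left[OF that, of i] A_subspace[of i] inv.lin_functional_on_sum[of "A i" "\<lambda>F. pair i F G" "{}"] by simp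
    ultimately show ?thesis using a b by (auto simp: pair_zero_right)
  next
    case False
    then obtain x y where xy: "j = Suc x" "e + 2 - j = Suc y" by (cases j; cases "e + 2 - j") auto
    obtain c where "b = lincomb y c" using b xy A_Suc_iff by metis
    then show ?thesis
      using pair_right[of a x y c] pair_left[OF A_cases[OF a], of y c] a xy by simp
  qed
  show "pair (Suc j) (Y m a) b = pair j a (Y m b)"
    if "Suc j \<le> e + 2" "a \<in> A j" "b \<in> A (e + 2 - Suc j)" for j a b m
    unfolding Y_def using pair_shift that by blast
  show "pair (Suc j) (L a) b = pair j a (L b)"
    if "Suc j \<le> e + 2" "a \<in> A j" "b \<in> A (e + 2 - Suc j)" for j a b
    unfolding L_alt using that pair_sum_left[OF that(3), of "\<lambda>i. mv i a"] mv_closed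
    by (simp add: pair_sum_right pair_shift)
  show "a = 0" if j: "j \<le> e + 2" and a: "a \<in> A j" and z: "\<And>b. b \<in> A (e + 2 - j) \<Longrightarrow> pair j a b = 0" for j a
  proof (cases j)
    case 0
    then show ?thesis using a by simp
  next
    case (Suc x)
    have "a m = 0" for m
    proof (rule ccontr)
      assume "a m \<noteq> 0"
      then have deg: "x + monomial_degree m = e" using A_support a Suc by blast
      then have "e + 2 - j = Suc (monomial_degree m)" using Suc by simp
      moreover have "m \<in> mons (monomial_degree m)" unfolding mons_def by simp
      ultimately have "pair j a (sh m) = 0" using z[of "sh m"] sh_A by metis
      moreover have "sh m = lincomb (monomial_degree m) (\<lambda>m'. if m' = m then 1 else 0)"
        using \<open>m \<in> mons _\<close> finite_mons
        by (auto simp: lincomb_apply sh_def fun_eq_iff if_distrib[of "\<lambda>x. x * _"] cong: if_cong)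
      ultimately have "(\<Sum>m'\<in>mons (monomial_degree m). (if m' = m then 1 else 0) * a m') = 0"
        using pair_right[of a x "monomial_degree m" "\<lambda>m'. if m' = m then 1 else 0"] a Suc by simp
      then have "a m = 0" using \<open>m \<in> mons _\<close> finite_mons by (simp add: if_distrib[of "\<lambda>x. x * _"] cong: if_cong)
      then show False using \<open>a m \<noteq> 0\<close> by blast
    qed
    then show ?thesis by (auto simp: zero_fun_def)
  qed
  show "a = 0" if j: "Suc j < e + 2" and a: "a \<in> A j" and La: "L a = 0" and Ya: "\<And>m. Y m a = 0" for j a
  proof (cases j)
    case 0
    then show ?thesis using a by simp
  next
    case (Suc x)
    have y01: "a (m + var 0) = 0" "a (m + var 1) = 0" for m
      using fun_cong[OF Ya[of False], of m] fun_cong[OF Ya[of True], of m]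
      by (simp_all add: Y_def mv_def zero_fun_def)
    have "t 2 * a (m + var 2) = 0" for m
      using fun_cong[OF La, of m] y01 unfolding L_def sum_three by (simp add: zero_fun_def)
    then have y2: "a (m + var 2) = 0" for m using t2 by simp
    have "a m = 0" for m
    proof (rule ccontr)
      assume nz: "a m \<noteq> 0"
      then have "x + monomial_degree m = e" using A_support a Suc by blast
      then obtain b where "monomial_degree m = Suc b" using j Suc by (cases "monomial_degree m") auto
      then have "m \<in> mons (Suc b)" unfolding mons_def by simp
      then obtain i m' where "m = m' + var i" using split_var by blast
      then show False using nz y01 y2 exhaust_three[of i] by auto
    qed
    then show ?thesis by (auto simp: zero_fun_def)
  qed
qed

end

section \<open>The field of rational functions in three variables and its derivations\<close>

definition derivation :: "('a::comm_ring_1 \<Rightarrow> 'a) \<Rightarrow> bool"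
  where "derivation D \<longleftrightarrow> (\<forall>x y. D (x + y) = D x + D y) \<and> (\<forall>x y. D (x * y) = x * D y + D x * y)"

lemma derivation_add: "derivation D \<Longrightarrow> D (x + y) = D x + D y"
  and derivation_mult: "derivation D \<Longrightarrow> D (x * y) = x * D y + D x * y"
  unfolding derivation_def by auto

lemma derivation_zero: assumes "derivation D" shows "D 0 = 0"
proof -
  have "D 0 + D 0 = D 0 + 0" using derivation_add[OF assms, of 0 0] by (metis add_0_right)
  then show ?thesis by (rule add_left_imp_eq)
qed

lemma derivation_one: assumes "derivation D" shows "D 1 = 0"
proof -
  have "D 1 + D 1 = D 1 + 0" using derivation_mult[OF assms, of 1 1] by (metis add_0_right mult_1 mult_1_right)
  then show ?thesis by (rule add_left_imp_eq)
qed

lemma derivation_sum: "derivation D \<Longrightarrow> D (sum f S) = (\<Sum>s\<in>S. D (f s))"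
  by (induction S rule: infinite_finite_induct) (auto simp: derivation_zero derivation_add)

text \<open>The quotient rule, whose value is the same for all representations of the fraction when \<open>D\<close> is a derivation.\<close>

definition fract_derivation :: "('a::idom \<Rightarrow> 'a) \<Rightarrow> 'a fract \<Rightarrow> 'a fract"
  where "fract_derivation D q = (SOME r. \<exists>a b. b \<noteq> 0 \<and> q = Fract a b \<and> r = Fract (D a * b - a * D b) (b * b))"

lemma fract_derivation_Fract:
  assumes D: "derivation D" and b: "b \<noteq> 0"
  shows "fract_derivation D (Fract a b) = Fract (D a * b - a * D b) (b * b)"
proof -
  have "\<exists>r. \<exists>a' b'. b' \<noteq> 0 \<and> Fract a b = Fract a' b' \<and> r = Fract (D a' * b' - a' * D b') (b' * b')"
    using b by blast
  then have "\<exists>a' b'. b' \<noteq> 0 \<and> Fract a b = Fract a' b' \<and>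
      fract_derivation D (Fract a b) = Fract (D a' * b' - a' * D b') (b' * b')"
    unfolding fract_derivation_def by (rule someI_ex)
  then obtain a' b' where b': "b' \<noteq> 0" and eq: "Fract a b = Fract a' b'"
    and v: "fract_derivation D (Fract a b) = Fract (D a' * b' - a' * D b') (b' * b')" by blast
  have 1: "a * b' = a' * b" using eq b b' by (simp add: eq_fract)
  have 2: "a * D b' + D a * b' = a' * D b + D a' * b"
    using derivation_mult[OF D, of a b'] derivation_mult[OF D, of a' b] 1 by simp
  have "(D a' * b' - a' * D b') * (b * b) = (D a * b - a * D b) * (b' * b')"
  proof -
    have "(D a' * b' - a' * D b') * (b * b) = b * b' * (D a' * b) - (a' * b) * (b * D b')"
      by (simp add: algebra_simps)
    also have "D a' * b = a * D b' + D a * b' - a' * D b" using 2 by (simp add: algebra_simps)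
    also have "b * b' * (a * D b' + D a * b' - a' * D b) - (a' * b) * (b * D b')
      = b * b' * b' * D a - b' * D b * (a' * b) + (a * b' - a' * b) * (b * D b')"
      by (simp add: algebra_simps)
    also have "\<dots> = (D a * b - a * D b) * (b' * b')" unfolding 1[symmetric] by (simp add: algebra_simps)
    finally show ?thesis .
  qed
  then show ?thesis unfolding v using b b' by (simp add: eq_fract)
qed

definition emb :: "'a::idom \<Rightarrow> 'a fract" where "emb a = Fract a 1"

lemma emb_add: "emb (a + b) = emb a + emb b" and emb_mult: "emb (a * b) = emb a * emb b"
  and emb_zero: "emb 0 = 0" and emb_one: "emb 1 = 1"
  unfolding emb_def by (simp_all add: Zero_fract_def One_fract_def)

lemma emb_inject: "emb a = emb b \<longleftrightarrow> a = b"
  unfolding emb_def by (simp add: eq_fract)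

lemma emb_sum: "emb (sum f S) = (\<Sum>s\<in>S. emb (f s))"
  by (induction S rule: infinite_finite_induct) (auto simp: emb_zero emb_add)

lemma emb_of_nat: "emb (of_nat n) = of_nat n"
  by (induction n) (auto simp: emb_zero emb_one emb_add)

lemma fract_derivation_emb: "derivation D \<Longrightarrow> fract_derivation D (emb a) = emb (D a)"
  unfolding emb_def by (simp add: fract_derivation_Fract derivation_one)

lemma derivation_fract_derivation:
  fixes D :: "'a::idom \<Rightarrow> 'a"
  assumes D: "derivation D" shows "derivation (fract_derivation D)"
  unfolding derivation_def
proof (intro conjI allI)
  fix x y :: "'a fract"
  obtain a b where x: "x = Fract a b" "b \<noteq> 0" by (cases x) auto
  obtain a' b' where y: "y = Fract a' b'" "b' \<noteq> 0" by (cases y) auto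
  show "fract_derivation D (x + y) = fract_derivation D x + fract_derivation D y"
    unfolding x y using x(2) y(2)
    by (simp add: fract_derivation_Fract[OF D] eq_fract derivation_add[OF D] derivation_mult[OF D])
      (simp add: algebra_simps)
  show "fract_derivation D (x * y) = x * fract_derivation D y + fract_derivation D x * y"
    unfolding x y using x(2) y(2)
    by (simp add: fract_derivation_Fract[OF D] eq_fract derivation_add[OF D] derivation_mult[OF D])
      (simp add: algebra_simps)
qed

text \<open>The commutator of two derivations of the fraction field is a derivation; it vanishes on the
  fraction field if it vanishes on the ring.\<close>

lemma fract_derivation_commute:
  assumes D: "derivation D" and E: "derivation E" and comm: "\<And>a. D (E a) = E (D a)"
  shows "fract_derivation D (fract_derivation E x) = fract_derivation E (fract_derivation D x)"
proof -
  let ?D = "fract_derivation D" and ?E = "fract_derivation E"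
  note d = derivation_fract_derivation[OF D] and e = derivation_fract_derivation[OF E]
  obtain a b where x: "x = Fract a b" "b \<noteq> 0" by (cases x) auto
  have xb: "x * emb b = emb a" unfolding x emb_def using x(2) by (simp add: eq_fract)
  have on_ring: "?D (?E (emb a)) = ?E (?D (emb a))" for a
    by (simp add: fract_derivation_emb D E comm)
  have "?D (?E (x * emb b)) = ?E (?D (x * emb b))" unfolding xb by (rule on_ring)
  then have "x * ?D (?E (emb b)) + ?D (?E x) * emb b = x * ?E (?D (emb b)) + ?E (?D x) * emb b"
    by (simp add: derivation_add[OF d] derivation_mult[OF d] derivation_add[OF e] derivation_mult[OF e])
  then have "?D (?E x) * emb b = ?E (?D x) * emb b" using on_ring[of b] by simp
  moreover have "emb b \<noteq> 0" using x(2) emb_inject[of b 0] by (simp add: emb_zero)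
  ultimately show ?thesis by simp
qed

lemma common_denominator:
  "finite S \<Longrightarrow> \<exists>b. b \<noteq> 0 \<and> (\<forall>x\<in>S. \<exists>a. x * emb b = emb a)"
proof (induction S rule: finite_induct)
  case empty
  then show ?case by (intro exI[of _ 1]) simp
next
  case (insert x S)
  then obtain b where b: "b \<noteq> 0" "\<And>y. y \<in> S \<Longrightarrow> \<exists>a. y * emb b = emb a" by blast
  obtain c d where x: "x = Fract c d" "d \<noteq> 0" by (cases x) auto
  have xd: "x * emb d = emb c" unfolding x emb_def using x(2) by (simp add: eq_fract)
  have "\<exists>a. y * emb (b * d) = emb a" if "y \<in> insert x S" for y
  proof (cases "y = x")
    case True
    then have "y * emb (b * d) = emb (c * b)" using xd by (simp add: emb_mult ac_simps)
    then show ?thesis by blast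
  next
    case False
    then have "y \<in> S" using that by blast
    then obtain a where "y * emb b = emb a" using b(2) by blast
    then have "y * emb (b * d) = emb (a * d)" by (simp add: emb_mult mult.assoc[symmetric])
    then show ?thesis by blast
  qed
  then show ?case using b(1) x(2) by (intro exI[of _ "b * d"]) auto
qed

lemma derivation_pderiv: "derivation (pderiv :: 'a::idom poly \<Rightarrow> 'a poly)"
  unfolding derivation_def by (simp add: pderiv_add pderiv_mult mult.commute)

lemma derivation_map_poly:
  assumes D: "derivation D" shows "derivation (map_poly D)"
proof -
  have c: "coeff (map_poly D p) n = D (coeff p n)" for p n
    by (rule coeff_map_poly) (rule derivation_zero[OF D])
  show ?thesis
    unfolding derivation_def
    by (auto simp: poly_eq_iff c coeff_mult derivation_add[OF D] derivation_mult[OF D]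
        derivation_sum[OF D] sum.distrib)
qed

lemma pderiv_map_poly_pderiv: "pderiv (map_poly pderiv p) = map_poly pderiv (pderiv p)"
  for p :: "'a::idom poly poly"
proof (rule poly_eqI)
  fix n
  have "pderiv (of_nat (Suc n) * q) = of_nat (Suc n) * pderiv q" for q :: "'a poly"
    by (simp add: pderiv_mult pderiv_of_nat del: of_nat_Suc)
  then show "coeff (pderiv (map_poly pderiv p)) n = coeff (map_poly pderiv (pderiv p)) n"
    by (simp add: coeff_pderiv coeff_map_poly del: of_nat_Suc)
qed

text \<open>Polynomials in the three coefficients of a linear form. The outermost variable is the first one, and the partial derivatives with
respect to the first two suffice.\<close>

type_synonym 'k poly3 = "'k poly poly poly"

definition const3 :: "'k::field \<Rightarrow> 'k poly3" where "const3 x = [:[:[:x:]:]:]"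

lemma const3_zero: "const3 0 = 0"
  unfolding const3_def by simp

definition eval3 :: "'k \<Rightarrow> 'k \<Rightarrow> 'k \<Rightarrow> 'k::field poly3 \<Rightarrow> 'k"
  where "eval3 x y z p = poly (poly (poly p [:[:x:]:]) [:y:]) z"

lemma eval3_add: "eval3 x y z (p + q) = eval3 x y z p + eval3 x y z q"
  and eval3_mult: "eval3 x y z (p * q) = eval3 x y z p * eval3 x y z q"
  and eval3_zero: "eval3 x y z 0 = 0" and eval3_one: "eval3 x y z 1 = 1"
  and eval3_const: "eval3 x y z (const3 c) = c"
  unfolding eval3_def const3_def by simp_all

lemma eval3_sum: "eval3 x y z (sum f S) = (\<Sum>s\<in>S. eval3 x y z (f s))"
  by (induction S rule: infinite_finite_induct) (auto simp: eval3_zero eval3_add)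

lemma eval3_prod: "eval3 x y z (prod f S) = (\<Prod>s\<in>S. eval3 x y z (f s))"
  by (induction S rule: infinite_finite_induct) (auto simp: eval3_one eval3_mult)

lemma eval3_power: "eval3 x y z (p ^ n) = eval3 x y z p ^ n"
  by (induction n) (auto simp: eval3_one eval3_mult)

lemma ex_nonroot:
  fixes p :: "'a::idom poly" and f :: "'k::field_char_0 \<Rightarrow> 'a"
  assumes "p \<noteq> 0" "inj f" shows "\<exists>x. poly p (f x) \<noteq> 0"
proof (rule ccontr)
  assume "\<not> ?thesis"
  then have "range f \<subseteq> {x. poly p x = 0}" by auto
  then have "finite (range f)" using poly_roots_finite[OF assms(1)] finite_subset by blast
  then show False using assms(2) infinite_UNIV_char_0 finite_imageD by blast
qed

lemma ex_eval3_nonzero: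
  fixes p :: "'k::field_char_0 poly3"
  assumes "p \<noteq> 0" shows "\<exists>x y z. eval3 x y z p \<noteq> 0"
proof -
  obtain x where x: "poly p [:[:x:]:] \<noteq> 0" using ex_nonroot[OF assms, of "\<lambda>x. [:[:x:]:]"] by (auto simp: inj_def)
  obtain y where y: "poly (poly p [:[:x:]:]) [:y:] \<noteq> 0" using ex_nonroot[OF x, of "\<lambda>y. [:y:]"] by (auto simp: inj_def)
  obtain z where "poly (poly (poly p [:[:x:]:]) [:y:]) z \<noteq> 0" using ex_nonroot[OF y, of "\<lambda>z. z"] by (auto simp: inj_def)
  then show ?thesis unfolding eval3_def by blast
qed

definition ratvar :: "3 \<Rightarrow> 'k::field poly3"
  where "ratvar i = (if i = 0 then [:0, 1:] else if i = 1 then [:[:0, 1:]:] else [:[:[:0, 1:]:]:])"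

lemma eval3_ratvar: "eval3 x y z (ratvar 0) = x" "eval3 x y z (ratvar 1) = y" "eval3 x y z (ratvar 2) = z"
  unfolding eval3_def ratvar_def by simp_all

definition partial :: "bool \<Rightarrow> 'k::field poly3 \<Rightarrow> 'k poly3"
  where "partial k = (if k then map_poly pderiv else pderiv)"

lemma derivation_partial: "derivation (partial k)"
  unfolding partial_def by (simp add: derivation_pderiv derivation_map_poly)

lemma partial_commute: "partial False (partial True p) = partial True (partial False p)"
  unfolding partial_def by (simp add: pderiv_map_poly_pderiv)

lemma partial_const: "partial k (const3 x) = 0"
  unfolding partial_def const3_def by (cases k) (auto simp: map_poly_pCons)

lemma partial_ratvar: "partial False (ratvar 0) = 1" "partial False (ratvar 1) = 0" "partial False (ratvar 2) = 0"
  "partial True (ratvar 0) = 0" "partial True (ratvar 1) = 1" "partial True (ratvar 2) = 0"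
  unfolding partial_def ratvar_def by (simp_all add: map_poly_pCons pderiv_pCons one_pCons)

section \<open>Generic linear forms\<close>

text \<open>The entry \<open>\<tau>(m \<ell> m')\<close> of the matrix, with respect to the pairing of \<open>\<tau>\<close>, of the multiplication by
the linear form \<open>\<ell>\<close> with coefficients \<open>t\<close>.\<close>

definition Lrow :: "(3 \<Rightarrow> 'f::comm_ring_1) \<Rightarrow> (mon \<Rightarrow> 'f) \<Rightarrow> mon \<Rightarrow> mon \<Rightarrow> 'f"
  where "Lrow t \<tau> m m' = (\<Sum>j\<in>UNIV. t j * \<tau> (m + var j + m'))"

text \<open>Coefficients of three homogeneous elements \<open>z\<^sub>r = \<Sum> \<zeta> r m m\<close> with \<open>y\<^sub>k z\<^sub>r = \<ell> w\<^sub>r\<^sub>k\<close>, where \<open>w\<^sub>r\<^sub>k\<close> has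
coefficients \<open>\<omega> r k\<close>, and of three elements of the annihilator of \<open>\<ell>\<close>, with coefficients \<open>\<chi> r\<close>, that are dual to them up to
the factor \<open>u\<close>. These are polynomial equations in all coefficients and in \<open>t\<close>, so they can be moved between the ground field, the polynomial ring in
\<open>t\<close> and its field of fractions. The factor \<open>u\<close> absorbs common denominators.\<close>

definition three_socle_elements :: "(mon \<Rightarrow> 'f::comm_ring_1) \<Rightarrow> (3 \<Rightarrow> 'f) \<Rightarrow> nat \<Rightarrow> 'f \<Rightarrow> (nat \<Rightarrow> nat) \<Rightarrow>
    (nat \<Rightarrow> mon \<Rightarrow> 'f) \<Rightarrow> (nat \<Rightarrow> bool \<Rightarrow> mon \<Rightarrow> 'f) \<Rightarrow> (nat \<Rightarrow> mon \<Rightarrow> 'f) \<Rightarrow> bool"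
  where "three_socle_elements \<tau> t e u \<alpha> \<zeta> \<omega> \<chi> \<longleftrightarrow> (\<forall>r<3. \<alpha> r \<le> e
    \<and> (\<forall>k m'. (\<Sum>m\<in>mons (\<alpha> r). \<zeta> r m * \<tau> (m + var (if k then 1 else 0) + m'))
        = (\<Sum>m\<in>mons (\<alpha> r). \<omega> r k m * Lrow t \<tau> m m'))
    \<and> (\<forall>m'. (\<Sum>m\<in>mons (e - \<alpha> r). \<chi> r m * Lrow t \<tau> m m') = 0)
    \<and> (\<forall>q<3. \<alpha> q = \<alpha> r \<longrightarrow> (\<Sum>m\<in>mons (\<alpha> r). \<zeta> r m * (\<Sum>m'\<in>mons (e - \<alpha> q). \<chi> q m' * \<tau> (m' + m)))
        = (if q = r then u else 0)))"

definition eval_at :: "(3 \<Rightarrow> 'k) \<Rightarrow> 'k::field poly3 \<Rightarrow> 'k"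
  where "eval_at t p = eval3 (t 0) (t 1) (t 2) p"

lemma eval_at_simps:
  "eval_at t (p + q) = eval_at t p + eval_at t q" "eval_at t (p * q) = eval_at t p * eval_at t q"
  "eval_at t 0 = 0" "eval_at t 1 = 1" "eval_at t (const3 c) = c" "eval_at t (ratvar i) = t i"
  "eval_at t (sum f S) = (\<Sum>s\<in>S. eval_at t (f s))" "eval_at t (prod f S) = (\<Prod>s\<in>S. eval_at t (f s))"
  "eval_at t (p ^ n) = eval_at t p ^ n"
  unfolding eval_at_def using exhaust_three[of i]
  by (auto simp: eval3_add eval3_mult eval3_zero eval3_one eval3_const eval3_sum eval3_prod eval3_power eval3_ratvar)

lemma ex_eval_at_nonzero:
  assumes "p \<noteq> (0 :: 'k::field_char_0 poly3)" shows "\<exists>t. eval_at t p \<noteq> 0"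
proof -
  obtain x y z where xyz: "eval3 x y z p \<noteq> 0" using ex_eval3_nonzero[OF assms] by blast
  define t where "t = (\<lambda>i::3. if i = 0 then x else if i = 1 then y else z)"
  have "eval_at t p = eval3 x y z p" unfolding eval_at_def t_def by simp
  then show ?thesis using xyz by metis
qed

definition K_tau :: "(mon \<Rightarrow> 'k::field) \<Rightarrow> mon \<Rightarrow> 'k poly3 fract" where "K_tau \<tau> m = emb (const3 (\<tau> m))"
definition K_var :: "3 \<Rightarrow> 'k::field poly3 fract" where "K_var i = emb (ratvar i)"

text \<open>The algebra of \<open>\<tau>\<close> over the field of rational functions in the coefficients of a linear form, with the generic linear form.\<close>

locale generic_form =
  fixes \<tau> :: "mon \<Rightarrow> 'k::field_char_0" and e :: nat
  assumes tau_degree: "monomial_degree m \<noteq> e \<Longrightarrow> \<tau> m = 0"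
begin

sublocale inverse_system "K_tau \<tau>" e K_var "\<lambda>k. fract_derivation (partial k)"
proof unfold_locales
  note dp = derivation_fract_derivation[OF derivation_partial]
  show "K_tau \<tau> m = 0" if "monomial_degree m \<noteq> e" for m
    using tau_degree[OF that] by (simp add: K_tau_def const3_zero emb_zero)
  show "fract_derivation (partial k) (x + y) = fract_derivation (partial k) x + fract_derivation (partial k) y" for k and x y :: "'k poly3 fract"
    by (rule derivation_add[OF dp])
  show "fract_derivation (partial k) (x * y) = x * fract_derivation (partial k) y + fract_derivation (partial k) x * y" for k and x y :: "'k poly3 fract"
    by (rule derivation_mult[OF dp])
  show "fract_derivation (partial k) (K_tau \<tau> m) = 0" for k m
    by (simp add: K_tau_def fract_derivation_emb[OF derivation_partial] partial_const emb_zero)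
  show "fract_derivation (partial False) (fract_derivation (partial True) x)
      = fract_derivation (partial True) (fract_derivation (partial False) x)" for x :: "'k poly3 fract"
    by (rule fract_derivation_commute[OF derivation_partial derivation_partial partial_commute])
  show "fract_derivation (partial False) (K_var 0 :: 'k poly3 fract) = 1"
    "fract_derivation (partial False) (K_var 1 :: 'k poly3 fract) = 0"
    "fract_derivation (partial False) (K_var 2 :: 'k poly3 fract) = 0"
    "fract_derivation (partial True) (K_var 0 :: 'k poly3 fract) = 0"
    "fract_derivation (partial True) (K_var 1 :: 'k poly3 fract) = 1"
    "fract_derivation (partial True) (K_var 2 :: 'k poly3 fract) = 0"
    unfolding K_var_def fract_derivation_emb[OF derivation_partial] partial_ratvar emb_one emb_zero by simp_all
  show "(K_var 2 :: 'k poly3 fract) \<noteq> 0"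
    unfolding K_var_def using emb_inject[of "ratvar 2 :: 'k poly3" 0] by (simp add: emb_zero ratvar_def)
  show "of_nat (Suc n) \<noteq> (0 :: 'k poly3 fract)" for n
    using emb_inject[of "of_nat (Suc n) :: 'k poly3" 0] by (simp add: emb_zero emb_of_nat del: of_nat_Suc)
qed

lemma L_lincomb: "L (lincomb a c) m' = (\<Sum>m\<in>mons a. c m * Lrow K_var (K_tau \<tau>) m m')"
  unfolding L_def lincomb_apply Lrow_def sum_distrib_left
  by (subst sum.swap) (simp add: ac_simps)

lemma Y_lincomb: "Y k (lincomb a c) m' = (\<Sum>m\<in>mons a. c m * K_tau \<tau> (m + var (if k then 1 else 0) + m'))"
  unfolding Y_def mv_def lincomb_apply by (simp add: ac_simps)

lemma Lrow_emb: "Lrow K_var (K_tau \<tau>) m m' = emb (Lrow ratvar (\<lambda>m. const3 (\<tau> m)) m m')"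
  unfolding Lrow_def K_var_def K_tau_def by (simp add: emb_sum emb_mult)

lemma eval_Lrow: "eval_at t (Lrow ratvar (\<lambda>m. const3 (\<tau> m)) m m') = Lrow t \<tau> m m'"
  unfolding Lrow_def by (simp add: eval_at_simps)

lemma three_socle_elements_over_K:
  assumes h: "\<forall>r<3::nat. a r \<le> e + 2 \<and> soc (a r) (z r) \<and> \<kappa> r \<in> A (e + 2 - a r) \<and> L (\<kappa> r) = 0
    \<and> (\<forall>q<3. a q = a r \<longrightarrow> pair (a r) (z r) (\<kappa> q) = (if q = r then 1 else 0))"
  shows "\<exists>\<alpha> \<zeta> \<omega> \<chi>. three_socle_elements (K_tau \<tau>) K_var e 1 \<alpha> \<zeta> \<omega> \<chi>"
proof -
  define \<alpha> where "\<alpha> r = a r - 1" for r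
  have one: "pair (a r) (z r) (\<kappa> r) = 1" if "r < 3" for r using h that by auto
  have pos: "a r = Suc (\<alpha> r)" if "r < 3" for r
    using one[OF that] unfolding \<alpha>_def by (cases "a r") (auto simp: pair_def)
  have le: "\<alpha> r \<le> e" and Nsub: "e + 2 - a r = Suc (e - \<alpha> r)" if r: "r < 3" for r
  proof -
    have "e + 2 - a r \<noteq> 0"
    proof
      assume "e + 2 - a r = 0"
      then have "\<kappa> r = 0" using h r by (metis A.simps(1) singletonD)
      then show False using one[OF r] by (simp add: pair_zero_right)
    qed
    then show "\<alpha> r \<le> e" "e + 2 - a r = Suc (e - \<alpha> r)" using pos[OF r] by auto
  qed
  have "\<forall>r. \<exists>c. r < 3 \<longrightarrow> z r = lincomb (\<alpha> r) c"
  proof (intro allI)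
    fix r show "\<exists>c. r < 3 \<longrightarrow> z r = lincomb (\<alpha> r) c"
      using h pos[of r] A_Suc_iff[of "z r" "\<alpha> r"] unfolding soc_def by (metis)
  qed
  then obtain \<zeta> where \<zeta>: "\<And>r. r < 3 \<Longrightarrow> z r = lincomb (\<alpha> r) (\<zeta> r)" by metis
  have "\<forall>r k. \<exists>c. r < 3 \<longrightarrow> Y k (z r) = L (lincomb (\<alpha> r) c)"
  proof (intro allI)
    fix r k
    show "\<exists>c. r < 3 \<longrightarrow> Y k (z r) = L (lincomb (\<alpha> r) c)"
    proof (cases "r < 3")
      case True
      then have "soc (a r) (z r)" using h by blast
      then have "Y k (z r) \<in> L ` A (a r)" unfolding soc_def by blast
      then obtain w where w: "w \<in> A (Suc (\<alpha> r))" "Y k (z r) = L w" using pos[OF True] by (auto simp del: A.simps)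
      then obtain c where "w = lincomb (\<alpha> r) c" using A_Suc_iff by blast
      then show ?thesis using w(2) by blast
    qed simp
  qed
  then obtain \<omega> where \<omega>: "\<And>r k. r < 3 \<Longrightarrow> Y k (z r) = L (lincomb (\<alpha> r) (\<omega> r k))" by metis
  have "\<forall>r. \<exists>c. r < 3 \<longrightarrow> \<kappa> r = lincomb (e - \<alpha> r) c"
  proof (intro allI)
    fix r show "\<exists>c. r < 3 \<longrightarrow> \<kappa> r = lincomb (e - \<alpha> r) c"
      using h Nsub[of r] A_Suc_iff[of "\<kappa> r" "e - \<alpha> r"] by metis
  qed
  then obtain \<chi> where \<chi>: "\<And>r. r < 3 \<Longrightarrow> \<kappa> r = lincomb (e - \<alpha> r) (\<chi> r)" by metis
  have "three_socle_elements (K_tau \<tau>) K_var e 1 \<alpha> \<zeta> \<omega> \<chi>"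
    unfolding three_socle_elements_def
  proof (intro allI impI conjI)
    fix r :: nat assume r: "r < 3"
    show "\<alpha> r \<le> e" by (rule le[OF r])
    show "(\<Sum>m\<in>mons (\<alpha> r). \<zeta> r m * K_tau \<tau> (m + var (if k then 1 else 0) + m'))
        = (\<Sum>m\<in>mons (\<alpha> r). \<omega> r k m * Lrow K_var (K_tau \<tau>) m m')" for k m'
      using fun_cong[OF \<omega>[OF r, of k], of m'] unfolding \<zeta>[OF r] Y_lincomb L_lincomb .
    have "L (\<kappa> r) = 0" using h r by blast
    from fun_cong[OF this] show "(\<Sum>m\<in>mons (e - \<alpha> r). \<chi> r m * Lrow K_var (K_tau \<tau>) m m') = 0" for m'
      unfolding \<chi>[OF r] L_lincomb by (simp add: zero_fun_def)
    fix q :: nat assume q: "q < 3" and eq: "\<alpha> q = \<alpha> r"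
    then have "a q = a r" using pos r by simp
    then have "pair (a r) (z r) (\<kappa> q) = (if q = r then 1 else 0)" using h r q by blast
    moreover have "\<kappa> q \<in> A (Suc (e - \<alpha> q))" using h q Nsub[OF q] by metis
    then have "pair (a r) (z r) (\<kappa> q) = (\<Sum>m\<in>mons (\<alpha> r). \<zeta> r m * \<kappa> q m)"
      unfolding pos[OF r] \<zeta>[OF r] by (intro pair_left) blast
    ultimately show "(\<Sum>m\<in>mons (\<alpha> r). \<zeta> r m * (\<Sum>m'\<in>mons (e - \<alpha> q). \<chi> q m' * K_tau \<tau> (m' + m)))
        = (if q = r then 1 else 0)"
      unfolding \<chi>[OF q] lincomb_apply by simp
  qed
  then show ?thesis by blast
qed

text \<open>Clear the denominators of all coefficients, and evaluate at a point where the common denominator does not vanish.\<close>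

lemma specialize_three_socle_elements:
  assumes K: "three_socle_elements (K_tau \<tau>) K_var e 1 \<alpha> \<zeta> \<omega> \<chi>"
  shows "\<exists>b. b \<noteq> 0 \<and> (\<forall>t. eval_at t b \<noteq> 0 \<longrightarrow>
    (\<exists>u \<zeta>' \<omega>' \<chi>'. u \<noteq> 0 \<and> three_socle_elements \<tau> t e u \<alpha> \<zeta>' \<omega>' \<chi>'))"
proof -
  define S where "S = (\<Union>r\<in>{..<3}. \<zeta> r ` mons (\<alpha> r) \<union> (\<Union>k. \<omega> r k ` mons (\<alpha> r)) \<union> \<chi> r ` mons (e - \<alpha> r))"
  have finS: "finite S" unfolding S_def by (intro finite_UN_I) (auto simp: finite_mons)
  obtain b where b: "b \<noteq> 0" "\<And>x. x \<in> S \<Longrightarrow> \<exists>a. x * emb b = emb a"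
    using common_denominator[OF finS] by blast
  define num where "num x = (SOME a. x * emb b = emb a)" for x
  have num: "x * emb b = emb (num x)" if "x \<in> S" for x
    unfolding num_def using b(2)[OF that] by (rule someI_ex)
  have S\<zeta>: "\<zeta> r m \<in> S" if "r < 3" "m \<in> mons (\<alpha> r)" for r m using that unfolding S_def by blast
  have S\<omega>: "\<omega> r k m \<in> S" if "r < 3" "m \<in> mons (\<alpha> r)" for r k m using that unfolding S_def by auto
  have S\<chi>: "\<chi> r m \<in> S" if "r < 3" "m \<in> mons (e - \<alpha> r)" for r m using that unfolding S_def by blast
  let ?\<tau> = "\<lambda>m. const3 (\<tau> m)"
  have P: "three_socle_elements ?\<tau> ratvar e (b * b) \<alpha> (\<lambda>r m. num (\<zeta> r m)) (\<lambda>r k m. num (\<omega> r k m)) (\<lambda>r m. num (\<chi> r m))"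
    unfolding three_socle_elements_def
  proof (intro allI impI conjI)
    fix r :: nat assume r: "r < 3"
    note Kr = K[unfolded three_socle_elements_def, THEN spec, THEN mp, OF r]
    have K0: "\<alpha> r \<le> e"
      and K1: "\<And>k m'. (\<Sum>m\<in>mons (\<alpha> r). \<zeta> r m * K_tau \<tau> (m + var (if k then 1 else 0) + m'))
        = (\<Sum>m\<in>mons (\<alpha> r). \<omega> r k m * Lrow K_var (K_tau \<tau>) m m')"
      and K2: "\<And>m'. (\<Sum>m\<in>mons (e - \<alpha> r). \<chi> r m * Lrow K_var (K_tau \<tau>) m m') = 0"
      and K3: "\<And>q. q < 3 \<Longrightarrow> \<alpha> q = \<alpha> r \<Longrightarrow>
        (\<Sum>m\<in>mons (\<alpha> r). \<zeta> r m * (\<Sum>m'\<in>mons (e - \<alpha> q). \<chi> q m' * K_tau \<tau> (m' + m)))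
        = (if q = r then 1 else 0)"
      by (rule Kr[THEN conjunct1], rule Kr[THEN conjunct2, THEN conjunct1, THEN spec, THEN spec],
        rule Kr[THEN conjunct2, THEN conjunct2, THEN conjunct1, THEN spec],
        rule Kr[THEN conjunct2, THEN conjunct2, THEN conjunct2, THEN spec, THEN mp, THEN mp])
    show "\<alpha> r \<le> e" by (rule K0)
    {
      fix k m'
      have "emb (\<Sum>m\<in>mons (\<alpha> r). num (\<zeta> r m) * ?\<tau> (m + var (if k then 1 else 0) + m'))
        = (\<Sum>m\<in>mons (\<alpha> r). \<zeta> r m * K_tau \<tau> (m + var (if k then 1 else 0) + m')) * emb b"
        unfolding emb_sum emb_mult sum_distrib_right K_tau_def
        by (rule sum.cong) (simp_all add: num[OF S\<zeta>[OF r], symmetric] ac_simps)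
      also have "\<dots> = (\<Sum>m\<in>mons (\<alpha> r). \<omega> r k m * Lrow K_var (K_tau \<tau>) m m') * emb b"
        by (simp only: K1)
      also have "\<dots> = emb (\<Sum>m\<in>mons (\<alpha> r). num (\<omega> r k m) * Lrow ratvar ?\<tau> m m')"
        unfolding emb_sum emb_mult sum_distrib_right Lrow_emb
        by (rule sum.cong) (simp_all add: num[OF S\<omega>[OF r], symmetric] ac_simps)
      finally show "(\<Sum>m\<in>mons (\<alpha> r). num (\<zeta> r m) * ?\<tau> (m + var (if k then 1 else 0) + m'))
        = (\<Sum>m\<in>mons (\<alpha> r). num (\<omega> r k m) * Lrow ratvar ?\<tau> m m')" unfolding emb_inject .
    }
    {
      fix m'
      have "emb (\<Sum>m\<in>mons (e - \<alpha> r). num (\<chi> r m) * Lrow ratvar ?\<tau> m m')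
        = (\<Sum>m\<in>mons (e - \<alpha> r). \<chi> r m * Lrow K_var (K_tau \<tau>) m m') * emb b"
        unfolding emb_sum emb_mult sum_distrib_right Lrow_emb
        by (rule sum.cong) (simp_all add: num[OF S\<chi>[OF r], symmetric] ac_simps)
      also have "\<dots> = emb 0" unfolding K2 by (simp add: emb_zero)
      finally show "(\<Sum>m\<in>mons (e - \<alpha> r). num (\<chi> r m) * Lrow ratvar ?\<tau> m m') = 0" unfolding emb_inject .
    }
    fix q :: nat assume q: "q < 3" and eq: "\<alpha> q = \<alpha> r"
    have inner: "emb (\<Sum>m'\<in>mons (e - \<alpha> q). num (\<chi> q m') * ?\<tau> (m' + m))
        = (\<Sum>m'\<in>mons (e - \<alpha> q). \<chi> q m' * K_tau \<tau> (m' + m)) * emb b" for m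
      unfolding emb_sum emb_mult sum_distrib_right K_tau_def
      by (rule sum.cong) (simp_all add: num[OF S\<chi>[OF q], symmetric] ac_simps)
    have "emb (\<Sum>m\<in>mons (\<alpha> r). num (\<zeta> r m) * (\<Sum>m'\<in>mons (e - \<alpha> q). num (\<chi> q m') * ?\<tau> (m' + m)))
      = (\<Sum>m\<in>mons (\<alpha> r). \<zeta> r m * (\<Sum>m'\<in>mons (e - \<alpha> q). \<chi> q m' * K_tau \<tau> (m' + m))) * (emb b * emb b)"
      unfolding emb_sum[of _ "mons (\<alpha> r)"] emb_mult inner sum_distrib_right[of _ "mons (\<alpha> r)"]
      by (rule sum.cong) (simp_all add: num[OF S\<zeta>[OF r], symmetric] ac_simps)
    also have "\<dots> = (if q = r then 1 else 0) * (emb b * emb b)" unfolding K3[OF q eq] ..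
    also have "\<dots> = emb (if q = r then b * b else 0)" by (simp add: emb_mult emb_zero)
    finally show "(\<Sum>m\<in>mons (\<alpha> r). num (\<zeta> r m) * (\<Sum>m'\<in>mons (e - \<alpha> q). num (\<chi> q m') * ?\<tau> (m' + m)))
        = (if q = r then b * b else 0)" unfolding emb_inject .
  qed
  have "three_socle_elements \<tau> t e (eval_at t b * eval_at t b) \<alpha> (\<lambda>r m. eval_at t (num (\<zeta> r m)))
      (\<lambda>r k m. eval_at t (num (\<omega> r k m))) (\<lambda>r m. eval_at t (num (\<chi> r m)))" for t
    unfolding three_socle_elements_def
  proof (intro allI impI conjI)
    fix r :: nat assume r: "r < 3"
    note Pr = P[unfolded three_socle_elements_def, THEN spec, THEN mp, OF r]
    have P0: "\<alpha> r \<le> e"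
      and P1: "\<And>k m'. (\<Sum>m\<in>mons (\<alpha> r). num (\<zeta> r m) * ?\<tau> (m + var (if k then 1 else 0) + m'))
        = (\<Sum>m\<in>mons (\<alpha> r). num (\<omega> r k m) * Lrow ratvar ?\<tau> m m')"
      and P2: "\<And>m'. (\<Sum>m\<in>mons (e - \<alpha> r). num (\<chi> r m) * Lrow ratvar ?\<tau> m m') = 0"
      and P3: "\<And>q. q < 3 \<Longrightarrow> \<alpha> q = \<alpha> r \<Longrightarrow>
        (\<Sum>m\<in>mons (\<alpha> r). num (\<zeta> r m) * (\<Sum>m'\<in>mons (e - \<alpha> q). num (\<chi> q m') * ?\<tau> (m' + m)))
        = (if q = r then b * b else 0)"
      by (rule Pr[THEN conjunct1], rule Pr[THEN conjunct2, THEN conjunct1, THEN spec, THEN spec],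
        rule Pr[THEN conjunct2, THEN conjunct2, THEN conjunct1, THEN spec],
        rule Pr[THEN conjunct2, THEN conjunct2, THEN conjunct2, THEN spec, THEN mp, THEN mp])
    show "\<alpha> r \<le> e" by (rule P0)
    {
      fix k m'
      show "(\<Sum>m\<in>mons (\<alpha> r). eval_at t (num (\<zeta> r m)) * \<tau> (m + var (if k then 1 else 0) + m'))
        = (\<Sum>m\<in>mons (\<alpha> r). eval_at t (num (\<omega> r k m)) * Lrow t \<tau> m m')"
        using arg_cong[OF P1[of k m'], of "eval_at t"] by (simp only: eval_at_simps eval_Lrow)
    }
    {
      fix m'
      show "(\<Sum>m\<in>mons (e - \<alpha> r). eval_at t (num (\<chi> r m)) * Lrow t \<tau> m m') = 0"
        using arg_cong[OF P2[of m'], of "eval_at t"] by (simp only: eval_at_simps eval_Lrow)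
    }
    fix q :: nat assume q: "q < 3" and eq: "\<alpha> q = \<alpha> r"
    have "eval_at t (if q = r then b * b else 0) = (if q = r then eval_at t b * eval_at t b else 0)"
      by (simp add: eval_at_simps)
    then show "(\<Sum>m\<in>mons (\<alpha> r). eval_at t (num (\<zeta> r m)) * (\<Sum>m'\<in>mons (e - \<alpha> q). eval_at t (num (\<chi> q m')) * \<tau> (m' + m)))
        = (if q = r then eval_at t b * eval_at t b else 0)"
      using arg_cong[OF P3[OF q eq], of "eval_at t"] by (simp only: eval_at_simps)
  qed
  then have "eval_at t b \<noteq> 0 \<Longrightarrow> \<exists>u \<zeta>' \<omega>' \<chi>'. u \<noteq> 0 \<and> three_socle_elements \<tau> t e u \<alpha> \<zeta>' \<omega>' \<chi>'" for t
    using no_zero_divisors[of "eval_at t b" "eval_at t b"] by blast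
  then show ?thesis using b(1) by blast
qed

text \<open>Injectivity says that the linear forms \<open>c \<mapsto> \<tau>(f\<^sub>c n)\<close>, for \<open>f\<^sub>c = \<Sum> c m m\<close>, vanish on the common kernel of the linear forms
\<open>c \<mapsto> \<tau>(L f\<^sub>c m')\<close>. So they are combinations of these, with rational functions as coefficients, and this can be evaluated at a point
where the denominator does not vanish.\<close>

lemma specialize_injectivity:
  assumes inj: "\<And>F. F \<in> A (Suc i) \<Longrightarrow> L F = 0 \<Longrightarrow> F = 0"
  shows "\<exists>b. b \<noteq> 0 \<and> (\<forall>t. eval_at t b \<noteq> 0 \<longrightarrow> (\<forall>c. (\<forall>m'. (\<Sum>m\<in>mons i. c m * Lrow t \<tau> m m') = 0) \<longrightarrow>
    (\<Sum>m\<in>mons i. c m * \<tau> (m + n)) = 0))"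
proof -
  have "\<exists>q. \<forall>c\<in>UNIV. (\<Sum>m\<in>mons i. c m * K_tau \<tau> (m + n))
      = (\<Sum>m'\<in>mons (e - i - 1). q m' * (\<Sum>m\<in>mons i. c m * Lrow K_var (K_tau \<tau>) m m'))"
  proof (rule inv.functional_in_span_of_kernels[OF finite_mons inv.subspace_UNIV])
    show "inv.lin_functional_on UNIV (\<lambda>c. \<Sum>m\<in>mons i. c m * Lrow K_var (K_tau \<tau>) m m')" for m'
      unfolding inv.lin_functional_on_def
      by (auto simp: sc_def plus_fun_def distrib_right sum.distrib sum_distrib_left mult.assoc)
    show "inv.lin_functional_on UNIV (\<lambda>c. \<Sum>m\<in>mons i. c m * K_tau \<tau> (m + n))"
      unfolding inv.lin_functional_on_def
      by (auto simp: sc_def plus_fun_def distrib_right sum.distrib sum_distrib_left mult.assoc)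
    fix c assume z: "\<And>m'. m' \<in> mons (e - i - 1) \<Longrightarrow> (\<Sum>m\<in>mons i. c m * Lrow K_var (K_tau \<tau>) m m') = 0"
    have "L (lincomb i c) = 0"
    proof (rule ext)
      fix m'
      have "L (lincomb i c) m' = 0"
      proof (rule ccontr)
        assume nz: "L (lincomb i c) m' \<noteq> 0"
        have "L (lincomb i c) \<in> A (Suc (Suc i))" using L_closed A_Suc_iff by blast
        from A_support[OF this nz] have "m' \<in> mons (e - i - 1)" unfolding mons_def by auto
        then show False using z nz unfolding L_lincomb by blast
      qed
      then show "L (lincomb i c) m' = 0 m'" by (simp add: zero_fun_def)
    qed
    then have "lincomb i c = 0" using inj A_Suc_iff by blast
    then show "(\<Sum>m\<in>mons i. c m * K_tau \<tau> (m + n)) = 0"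
      using lincomb_apply[of i c n] by (simp add: zero_fun_def)
  qed
  then obtain q where q: "\<And>c. (\<Sum>m\<in>mons i. c m * K_tau \<tau> (m + n))
      = (\<Sum>m'\<in>mons (e - i - 1). q m' * (\<Sum>m\<in>mons i. c m * Lrow K_var (K_tau \<tau>) m m'))" by blast
  have q1: "K_tau \<tau> (m + n) = (\<Sum>m'\<in>mons (e - i - 1). q m' * Lrow K_var (K_tau \<tau>) m m')" if "m \<in> mons i" for m
    using q[of "\<lambda>x. if x = m then 1 else 0"] that finite_mons
    by (simp add: if_distrib[of "\<lambda>x. x * _"] cong: if_cong)
  obtain b where b: "b \<noteq> 0" "\<And>x. x \<in> q ` mons (e - i - 1) \<Longrightarrow> \<exists>a. x * emb b = emb a"
    using common_denominator[of "q ` mons (e - i - 1)"] finite_mons by auto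
  define num where "num x = (SOME a. x * emb b = emb a)" for x
  have num: "q m' * emb b = emb (num (q m'))" if "m' \<in> mons (e - i - 1)" for m'
    unfolding num_def using b(2) that by (intro someI_ex[of "\<lambda>a. _ * emb b = emb a"]) blast
  let ?\<tau> = "\<lambda>m. const3 (\<tau> m)"
  have P: "?\<tau> (m + n) * b = (\<Sum>m'\<in>mons (e - i - 1). num (q m') * Lrow ratvar ?\<tau> m m')" if m: "m \<in> mons i" for m
  proof -
    have "emb (?\<tau> (m + n) * b) = (\<Sum>m'\<in>mons (e - i - 1). q m' * Lrow K_var (K_tau \<tau>) m m') * emb b"
      using q1[OF m] by (simp add: emb_mult K_tau_def)
    also have "\<dots> = emb (\<Sum>m'\<in>mons (e - i - 1). num (q m') * Lrow ratvar ?\<tau> m m')"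
      unfolding emb_sum emb_mult sum_distrib_right Lrow_emb
      by (rule sum.cong) (simp_all add: num[symmetric] ac_simps)
    finally show ?thesis unfolding emb_inject .
  qed
  have "(\<Sum>m\<in>mons i. c m * \<tau> (m + n)) = 0"
    if t: "eval_at t b \<noteq> 0" and c: "\<And>m'. (\<Sum>m\<in>mons i. c m * Lrow t \<tau> m m') = 0" for t c
  proof -
    have ev: "\<tau> (m + n) * eval_at t b = (\<Sum>m'\<in>mons (e - i - 1). eval_at t (num (q m')) * Lrow t \<tau> m m')" if "m \<in> mons i" for m
      using arg_cong[OF P[OF that], of "eval_at t"] by (simp add: eval_at_simps eval_Lrow)
    have "(\<Sum>m\<in>mons i. c m * \<tau> (m + n)) * eval_at t b
      = (\<Sum>m\<in>mons i. \<Sum>m'\<in>mons (e - i - 1). eval_at t (num (q m')) * (c m * Lrow t \<tau> m m'))"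
      unfolding sum_distrib_right
      by (rule sum.cong) (simp_all add: mult.assoc ev sum_distrib_left mult.left_commute)
    also have "\<dots> = (\<Sum>m'\<in>mons (e - i - 1). eval_at t (num (q m')) * (\<Sum>m\<in>mons i. c m * Lrow t \<tau> m m'))"
      by (subst sum.swap) (simp add: sum_distrib_left)
    finally show ?thesis using c t by simp
  qed
  then show ?thesis using b(1) by blast
qed

theorem generic_injectivity:
  assumes u: "u \<noteq> 0"
    and type: "\<And>t v \<alpha> \<zeta> \<omega> \<chi>. eval_at t u \<noteq> 0 \<Longrightarrow> v \<noteq> 0 \<Longrightarrow> \<not> three_socle_elements \<tau> t e v \<alpha> \<zeta> \<omega> \<chi>"
  shows "\<exists>t. \<forall>i c n. 2 * i + 1 \<le> e \<longrightarrow> (\<forall>m'. (\<Sum>m\<in>mons i. c m * Lrow t \<tau> m m') = 0) \<longrightarrow>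
    (\<Sum>m\<in>mons i. c m * \<tau> (m + n)) = 0"
proof -
  have type_two: "graded_duality_type_two sc (e + 2) A L Y pair D (\<lambda>k. fract_derivation (partial k))"
  proof (rule graded_duality_type_two.intro[OF graded_duality_axioms], rule graded_duality_type_two_axioms.intro)
    show "\<not> (\<exists>a z \<kappa>. \<forall>r<3::nat. a r \<le> e + 2 \<and> soc (a r) (z r) \<and> \<kappa> r \<in> A (e + 2 - a r) \<and> L (\<kappa> r) = 0
      \<and> (\<forall>q<3. a q = a r \<longrightarrow> pair (a r) (z r) (\<kappa> q) = (if q = r then 1 else 0)))"
    proof
      assume "\<exists>a z \<kappa>. \<forall>r<3::nat. a r \<le> e + 2 \<and> soc (a r) (z r) \<and> \<kappa> r \<in> A (e + 2 - a r) \<and> L (\<kappa> r) = 0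
      \<and> (\<forall>q<3. a q = a r \<longrightarrow> pair (a r) (z r) (\<kappa> q) = (if q = r then 1 else 0))"
      then obtain a z \<kappa> where h: "\<forall>r<3::nat. a r \<le> e + 2 \<and> soc (a r) (z r) \<and> \<kappa> r \<in> A (e + 2 - a r) \<and> L (\<kappa> r) = 0
      \<and> (\<forall>q<3. a q = a r \<longrightarrow> pair (a r) (z r) (\<kappa> q) = (if q = r then 1 else 0))" by (elim exE)
      obtain \<alpha> \<zeta> \<omega> \<chi> where ts: "three_socle_elements (K_tau \<tau>) K_var e 1 \<alpha> \<zeta> \<omega> \<chi>"
        using three_socle_elements_over_K[OF h] by (elim exE)
      obtain b where b: "b \<noteq> 0" "\<And>t. eval_at t b \<noteq> 0 \<Longrightarrow>
          \<exists>v \<zeta>' \<omega>' \<chi>'. v \<noteq> 0 \<and> three_socle_elements \<tau> t e v \<alpha> \<zeta>' \<omega>' \<chi>'"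
        using specialize_three_socle_elements[OF ts] by (elim exE conjE) blast
      obtain t where "eval_at t (u * b) \<noteq> 0" using ex_eval_at_nonzero[of "u * b"] u b(1) by auto
      then have "eval_at t u \<noteq> 0" "eval_at t b \<noteq> 0" by (auto simp: eval_at_simps)
      then show False using b(2) type by blast
    qed
  qed
  define R where "R i n b \<longleftrightarrow> b \<noteq> 0 \<and> (\<forall>t. eval_at t b \<noteq> 0 \<longrightarrow> (\<forall>c. (\<forall>m'. (\<Sum>m\<in>mons i. c m * Lrow t \<tau> m m') = 0) \<longrightarrow>
    (\<Sum>m\<in>mons i. c m * \<tau> (m + n)) = 0))" for i n b
  define b where "b i n = (SOME b. R i n b)" for i n
  have bR: "R i n (b i n)" if "2 * i + 1 \<le> e" for i n
  proof -
    have "\<exists>b. R i n b"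
      unfolding R_def
      by (rule specialize_injectivity)
        (use graded_duality_type_two.lower_half_injective[OF type_two, of "Suc i"] that in auto)
    then show ?thesis unfolding b_def by (rule someI_ex)
  qed
  have b: "b i n \<noteq> 0" if "2 * i + 1 \<le> e" for i n using bR[OF that, of n] unfolding R_def by blast
  define I where "I = {i. 2 * i + 1 \<le> e}"
  have finI: "finite I" unfolding I_def by (rule finite_subset[of _ "{..e}"]) auto
  define B where "B = (\<Prod>i\<in>I. \<Prod>n\<in>mons (e - i). b i n)"
  have "B \<noteq> 0" unfolding B_def using b finI finite_mons by (auto simp: I_def)
  then obtain t where "eval_at t B \<noteq> 0" using ex_eval_at_nonzero by blast
  then have t: "eval_at t (b i n) \<noteq> 0" if "i \<in> I" "n \<in> mons (e - i)" for i n
    using that finI finite_mons unfolding B_def by (auto simp: eval_at_simps)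
  have "(\<Sum>m\<in>mons i. c m * \<tau> (m + n)) = 0"
    if i: "2 * i + 1 \<le> e" and c: "\<forall>m'. (\<Sum>m\<in>mons i. c m * Lrow t \<tau> m m') = 0" for i c n
  proof (cases "n \<in> mons (e - i)")
    case True
    then show ?thesis using bR[OF i, of n] t[of i n] i c unfolding I_def R_def by blast
  next
    case False
    have "\<tau> (m + n) = 0" if "m \<in> mons i" for m
      using that False i by (intro tau_degree) (auto simp: mons_def monomial_degree_add)
    then show ?thesis by simp
  qed
  then show ?thesis by blast
qed

end

section \<open>Gorenstein ideals and their dual forms\<close>

abbreviation X :: "3 \<Rightarrow> (3, 'k::field) mpoly" where "X i \<equiv> Poly_Mapping.single (var i) 1"
abbreviation monomial :: "mon \<Rightarrow> (3, 'k::field) mpoly" where "monomial m \<equiv> Poly_Mapping.single m 1"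
abbreviation C :: "'k::field \<Rightarrow> (3, 'k) mpoly" where "C c \<equiv> Poly_Mapping.single 0 c"

definition hcomp :: "nat \<Rightarrow> (3, 'k::field) mpoly \<Rightarrow> (3, 'k) mpoly"
  where "hcomp j f = (\<Sum>m | m \<in> Poly_Mapping.keys f \<and> monomial_degree m = j. Poly_Mapping.single m (Poly_Mapping.lookup f m))"

lemma lookup_sum_single:
  "finite S \<Longrightarrow> Poly_Mapping.lookup (\<Sum>m\<in>S. Poly_Mapping.single m (c m)) n = (if n \<in> S then c n else 0)"
  by (simp add: lookup_sum lookup_single when_def)

lemma lookup_hcomp: "Poly_Mapping.lookup (hcomp j f) m = (if monomial_degree m = j then Poly_Mapping.lookup f m else 0)"
  unfolding hcomp_def by (subst lookup_sum_single) (auto simp: in_keys_iff)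

lemma expand_singles:
  assumes "finite S" "Poly_Mapping.keys f \<subseteq> S"
  shows "f = (\<Sum>m\<in>S. Poly_Mapping.single m (Poly_Mapping.lookup f m))"
  by (rule poly_mapping_eqI) (use assms in \<open>auto simp: lookup_sum_single in_keys_iff subset_iff\<close>)

lemma hcomp_add: "hcomp j (f + g) = hcomp j f + hcomp j g"
  by (rule poly_mapping_eqI) (simp add: lookup_hcomp lookup_add)

lemma hcomp_diff: "hcomp j (f - g) = hcomp j f - hcomp j g"
  by (rule poly_mapping_eqI) (simp add: lookup_hcomp lookup_minus)

lemma hcomp_zero: "hcomp j 0 = 0"
  by (rule poly_mapping_eqI) (simp add: lookup_hcomp)

lemma hcomp_sum: "hcomp j (sum f S) = (\<Sum>s\<in>S. hcomp j (f s))"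
  by (induction S rule: infinite_finite_induct) (auto simp: hcomp_zero hcomp_add)

lemma hcomp_single: "hcomp j (Poly_Mapping.single m c) = (if monomial_degree m = j then Poly_Mapping.single m c else 0)"
  by (rule poly_mapping_eqI) (auto simp: lookup_hcomp lookup_single when_def)

lemma hcomp_mult_single:
  "hcomp (j + monomial_degree m) (Poly_Mapping.single m c * f) = Poly_Mapping.single m c * hcomp j f"
proof -
  have "hcomp (j + monomial_degree m) (Poly_Mapping.single m c * f)
    = (\<Sum>n\<in>Poly_Mapping.keys f. hcomp (j + monomial_degree m) (Poly_Mapping.single m c * Poly_Mapping.single n (Poly_Mapping.lookup f n)))"
    by (subst expand_singles[OF finite_keys order_refl, of f]) (simp only: sum_distrib_left hcomp_sum)
  also have "\<dots> = (\<Sum>n\<in>Poly_Mapping.keys f. Poly_Mapping.single m c * hcomp j (Poly_Mapping.single n (Poly_Mapping.lookup f n)))"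
    by (rule sum.cong) (auto simp: mult_single hcomp_single monomial_degree_add)
  also have "\<dots> = Poly_Mapping.single m c * hcomp j f"
    by (subst (3) expand_singles[OF finite_keys order_refl, of f]) (simp only: sum_distrib_left hcomp_sum)
  finally show ?thesis .
qed

lemma hcomp_mult_C: "hcomp j (C c * f) = C c * hcomp j f"
proof -
  have "monomial_degree (0 :: mon) = 0" using monomial_degree_zero by blast
  then show ?thesis using hcomp_mult_single[of j 0 c f] by simp
qed

lemma forms_iff: "f \<in> forms (int j) \<longleftrightarrow> Poly_Mapping.keys f \<subseteq> mons j"
  unfolding forms_def mons_def by auto

lemma hcomp_forms: "hcomp j f \<in> forms (int j)"
  unfolding forms_iff mons_def by (auto simp: in_keys_iff lookup_hcomp split: if_splits)

lemma hcomp_form: "f \<in> forms (int i) \<Longrightarrow> hcomp j f = (if i = j then f else 0)"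
  by (rule poly_mapping_eqI) (auto simp: lookup_hcomp forms_def in_keys_iff)

lemma form_expand: "f \<in> forms (int j) \<Longrightarrow> f = (\<Sum>m\<in>mons j. Poly_Mapping.single m (Poly_Mapping.lookup f m))"
  by (rule expand_singles[OF finite_mons]) (simp add: forms_iff)

lemma sum_hcomp: "\<exists>n. f = (\<Sum>j<n. hcomp j f)"
proof -
  obtain n where n: "\<And>m. m \<in> Poly_Mapping.keys f \<Longrightarrow> monomial_degree m < n"
    using finite_nat_bounded[of "monomial_degree ` Poly_Mapping.keys f"] by auto
  have "f = (\<Sum>j<n. hcomp j f)"
    by (rule poly_mapping_eqI) (use n in \<open>auto simp: lookup_sum lookup_hcomp in_keys_iff\<close>)
  then show ?thesis by blast
qed

lemma X_pow: "X i ^ n = Poly_Mapping.single (Poly_Mapping.single i n) 1"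
  by (induction n) (auto simp: mult_single single_add[symmetric])

locale gorenstein_ideal =
  fixes I :: "(3, 'k::field_char_0) mpoly set"
  assumes I_zero: "0 \<in> I" and I_add: "f \<in> I \<Longrightarrow> g \<in> I \<Longrightarrow> f + g \<in> I" and I_mult: "f \<in> I \<Longrightarrow> g * f \<in> I"
    and I_comp: "f \<in> I \<Longrightarrow> hcomp j f \<in> I"
    and nilpotent: "\<exists>n. X i ^ n \<in> I"
    and socle_line: "\<exists>v. v \<notin> I \<and> (\<forall>i. X i * v \<in> I) \<and> (\<forall>a. (\<forall>i. X i * a \<in> I) \<longrightarrow> (\<exists>c. a - C c * v \<in> I))"
begin

lemma I_diff: "f \<in> I \<Longrightarrow> g \<in> I \<Longrightarrow> f - g \<in> I"
  using I_add[of f "- 1 * g"] I_mult[of g "- 1"] by simp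

lemma I_sum: "(\<And>s. s \<in> S \<Longrightarrow> f s \<in> I) \<Longrightarrow> sum f S \<in> I"
  by (induction S rule: infinite_finite_induct) (auto simp: I_zero I_add)

lemma ex_nilpotency_bound: "\<exists>n. \<forall>m. n \<le> monomial_degree m \<longrightarrow> monomial m \<in> I"
proof -
  obtain n where n: "\<And>i. X i ^ n i \<in> I" using nilpotent by metis
  define b where "b = n 0 + n 1 + n 2"
  have "monomial m \<in> I" if m: "b \<le> monomial_degree m" for m
  proof -
    have "\<exists>i. n i \<le> Poly_Mapping.lookup m i"
    proof (rule ccontr)
      assume "\<not> ?thesis"
      then have "Poly_Mapping.lookup m 0 < n 0" "Poly_Mapping.lookup m 1 < n 1" "Poly_Mapping.lookup m 2 < n 2"
        by (auto simp: not_le)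
      then show False using m unfolding b_def monomial_degree_def sum_three by simp
    qed
    then obtain i where i: "n i \<le> Poly_Mapping.lookup m i" by blast
    have "m = (m - Poly_Mapping.single i (n i)) + Poly_Mapping.single i (n i)"
      by (rule poly_mapping_eqI) (use i in \<open>auto simp: lookup_add lookup_minus lookup_single when_def\<close>)
    then have "monomial m = monomial (m - Poly_Mapping.single i (n i)) * X i ^ n i"
      unfolding X_pow by (simp add: mult_single)
    then show ?thesis by (rule ssubst) (rule I_mult[OF n])
  qed
  then show ?thesis by blast
qed

text \<open>Multiply by a monomial of the largest degree that does not lead into the ideal.\<close>

lemma socle_essential:
  assumes f: "f \<notin> I"
  shows "\<exists>m. monomial m * f \<notin> I \<and> (\<forall>i. X i * (monomial m * f) \<in> I)"
proof -
  obtain n where n: "\<And>m. n \<le> monomial_degree m \<Longrightarrow> monomial m \<in> I" using ex_nilpotency_bound by blast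
  define S where "S = {d. \<exists>m. monomial_degree m = d \<and> monomial m * f \<notin> I}"
  have "monomial_degree (0 :: mon) \<in> S" using f unfolding S_def by (auto intro!: exI[of _ 0])
  moreover have Sn: "S \<subseteq> {..n}"
  proof
    fix d assume "d \<in> S"
    then obtain m where m: "monomial_degree m = d" "monomial m * f \<notin> I" unfolding S_def by blast
    then have "monomial m \<notin> I" using I_mult[of "monomial m" f] by (auto simp: mult.commute)
    then show "d \<in> {..n}" using n[of m] m(1) by (cases "n \<le> monomial_degree m") auto
  qed
  ultimately have "Max S \<in> S" using Max_in[of S] finite_subset[OF Sn] by blast
  then obtain m where m: "monomial_degree m = Max S" "monomial m * f \<notin> I" unfolding S_def by blast
  have "X i * (monomial m * f) \<in> I" for i
  proof (rule ccontr)
    assume "X i * (monomial m * f) \<notin> I"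
    then have "monomial (m + var i) * f \<notin> I" by (simp add: mult.assoc[symmetric] mult_single add.commute)
    then have "monomial_degree (m + var i) \<in> S" unfolding S_def by blast
    then have "monomial_degree (m + var i) \<le> Max S" using finite_subset[OF Sn] by simp
    then show False using m monomial_degree_var[of i] by (simp add: monomial_degree_add)
  qed
  then show ?thesis using m(2) by blast
qed

text \<open>The homogeneous components of a socle generator are socle elements, hence multiples of it; one of them is not in the ideal and is a generator as well.\<close>

lemma homogeneous_socle:
  "\<exists>e v. v \<in> forms (int e) \<and> v \<notin> I \<and> (\<forall>i. X i * v \<in> I) \<and> (\<forall>a. (\<forall>i. X i * a \<in> I) \<longrightarrow> (\<exists>c. a - C c * v \<in> I))"
proof -
  obtain v where v: "v \<notin> I" "\<And>i. X i * v \<in> I" "\<And>a. (\<forall>i. X i * a \<in> I) \<Longrightarrow> \<exists>c. a - C c * v \<in> I"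
    using socle_line by blast
  obtain n where "v = (\<Sum>j<n. hcomp j v)" using sum_hcomp by blast
  then obtain e where e: "hcomp e v \<notin> I" using v(1) I_sum[of "{..<n}" "\<lambda>j. hcomp j v"] by metis
  have Xe: "X i * hcomp e v \<in> I" for i
    using I_comp[OF v(2)[of i], of "e + monomial_degree (var i)"] by (simp only: hcomp_mult_single)
  obtain a where a: "hcomp e v - C a * v \<in> I" using v(3) Xe by blast
  have a0: "a \<noteq> 0" using a e by auto
  have "\<exists>c. x - C c * hcomp e v \<in> I" if x: "\<forall>i. X i * x \<in> I" for x
  proof -
    obtain c where c: "x - C c * v \<in> I" using v(3)[OF x] by blast
    have "x - C (c / a) * hcomp e v = (x - C c * v) - C (c / a) * (hcomp e v - C a * v)"
      using a0 by (simp add: algebra_simps mult_single mult.assoc[symmetric])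
    then show ?thesis using I_diff[OF c I_mult[OF a]] by metis
  qed
  then show ?thesis using e Xe hcomp_forms[of e v] by blast
qed

end

locale gorenstein_generator = gorenstein_ideal I for I :: "(3, 'k::field_char_0) mpoly set" +
  fixes e :: nat and v :: "(3, 'k) mpoly"
  assumes v_form: "v \<in> forms (int e)" and v_notin: "v \<notin> I" and v_socle: "X i * v \<in> I"
    and socle_multiple: "(\<And>i. X i * a \<in> I) \<Longrightarrow> \<exists>c. a - C c * v \<in> I"
begin

lemma ex_coefficient: "\<exists>c. hcomp e f - C c * v \<in> I"
proof (cases "hcomp e f \<in> I")
  case True
  then show ?thesis by (intro exI[of _ 0]) simp
next
  case False
  then obtain m where m: "monomial m * hcomp e f \<notin> I" "\<And>i. X i * (monomial m * hcomp e f) \<in> I"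
    using socle_essential by blast
  have "monomial_degree m = 0"
  proof (rule ccontr)
    assume nz: "monomial_degree m \<noteq> 0"
    obtain c where "monomial m * hcomp e f - C c * v \<in> I" using socle_multiple m(2) by blast
    then have "hcomp (e + monomial_degree m) (monomial m * hcomp e f - C c * v) \<in> I" by (rule I_comp)
    moreover have "hcomp (e + monomial_degree m) (C c * v) = 0"
      using hcomp_form[OF v_form] nz by (simp add: hcomp_mult_C)
    moreover have "hcomp e (hcomp e f) = hcomp e f" by (rule poly_mapping_eqI) (simp add: lookup_hcomp)
    ultimately show False using m(1) by (simp add: hcomp_diff hcomp_mult_single)
  qed
  then have "m = 0" using monomial_degree_zero by blast
  then show ?thesis using socle_multiple[of "hcomp e f"] m(2) by simp
qed

text \<open>Modulo the ideal, the component of degree \<open>e\<close> of every polynomial is a multiple of the socle generator. The coefficient is the linear form that is dual to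
the ideal.\<close>

definition T :: "(3, 'k) mpoly \<Rightarrow> 'k" where "T f = (SOME c. hcomp e f - C c * v \<in> I)"

lemma T: "hcomp e f - C (T f) * v \<in> I"
  unfolding T_def using ex_coefficient by (rule someI_ex)

lemma T_unique:
  assumes "hcomp e f - C c * v \<in> I" shows "T f = c"
proof (rule ccontr)
  assume ne: "T f \<noteq> c"
  have "C (1 / (T f - c)) * ((hcomp e f - C c * v) - (hcomp e f - C (T f) * v)) \<in> I"
    by (rule I_mult[OF I_diff[OF assms T]])
  also have "(hcomp e f - C c * v) - (hcomp e f - C (T f) * v) = C (T f - c) * v"
    by (simp add: single_diff algebra_simps)
  also have "C (1 / (T f - c)) * (C (T f - c) * v) = v" using ne by (simp add: mult.assoc[symmetric] mult_single)
  finally show False using v_notin by blast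
qed

lemma T_add: "T (f + g) = T f + T g"
proof (rule T_unique)
  have "hcomp e (f + g) - C (T f + T g) * v = (hcomp e f - C (T f) * v) + (hcomp e g - C (T g) * v)"
    by (simp add: hcomp_add single_add algebra_simps)
  then show "hcomp e (f + g) - C (T f + T g) * v \<in> I" using I_add[OF T T] by simp
qed

lemma T_scale: "T (C c * f) = c * T f"
proof (rule T_unique)
  have "hcomp e (C c * f) - C (c * T f) * v = C c * (hcomp e f - C (T f) * v)"
    using mult_single[of "0 :: mon" c 0 "T f"] by (simp add: hcomp_mult_C right_diff_distrib mult.assoc[symmetric])
  then show "hcomp e (C c * f) - C (c * T f) * v \<in> I" using I_mult[OF T] by simp
qed

lemma T_I: "f \<in> I \<Longrightarrow> T f = 0"
  by (rule T_unique) (simp add: I_comp)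

lemma T_zero: "T 0 = 0" using T_I[OF I_zero] .

lemma T_diff: "T (f - g) = T f - T g"
  using T_add[of "f - g" g] by simp

lemma T_sum: "T (sum f S) = (\<Sum>s\<in>S. T (f s))"
  by (induction S rule: infinite_finite_induct) (auto simp: T_zero T_add)

definition \<tau> :: "mon \<Rightarrow> 'k" where "\<tau> m = T (monomial m)"

lemma T_single: "T (Poly_Mapping.single m c) = c * \<tau> m"
proof -
  have "Poly_Mapping.single m c = C c * monomial m" by (simp add: mult_single)
  then show ?thesis unfolding \<tau>_def by (simp only: T_scale)
qed

lemma \<tau>_degree: "monomial_degree m \<noteq> e \<Longrightarrow> \<tau> m = 0"
  unfolding \<tau>_def by (rule T_unique) (simp add: hcomp_single I_zero)

lemma in_I_iff: "f \<in> I \<longleftrightarrow> (\<forall>m. T (monomial m * f) = 0)"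
proof
  show "f \<in> I \<Longrightarrow> \<forall>m. T (monomial m * f) = 0" using T_I I_mult by blast
  assume z: "\<forall>m. T (monomial m * f) = 0"
  show "f \<in> I"
  proof (rule ccontr)
    assume "f \<notin> I"
    then obtain m where m: "monomial m * f \<notin> I" "\<And>i. X i * (monomial m * f) \<in> I" using socle_essential by blast
    obtain c where c: "monomial m * f - C c * v \<in> I" using socle_multiple m(2) by blast
    have "hcomp e (C c * v) = C c * v"
      using hcomp_form[OF v_form, of e] by (simp add: hcomp_mult_C)
    then have "hcomp e (monomial m * f) - C c * v \<in> I" using I_comp[OF c, of e] by (simp add: hcomp_diff)
    then have "c = 0" using T_unique z by metis
    then show False using c m(1) by simp
  qed
qed

definition poly_of :: "nat \<Rightarrow> (mon \<Rightarrow> 'k) \<Rightarrow> (3, 'k) mpoly"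
  where "poly_of j c = (\<Sum>m\<in>mons j. Poly_Mapping.single m (c m))"

lemma T_poly_of: "T (monomial n * poly_of j c) = (\<Sum>m\<in>mons j. c m * \<tau> (m + n))"
  unfolding poly_of_def by (simp add: sum_distrib_left T_sum mult_single T_single add.commute)

lemma T_X_poly_of: "T (monomial n * (X i * poly_of j c)) = (\<Sum>m\<in>mons j. c m * \<tau> (m + var i + n))"
  unfolding poly_of_def by (simp add: sum_distrib_left T_sum mult_single T_single ac_simps)

lemma T_linear_form:
  "T (monomial n * (linear_form t * poly_of j c)) = (\<Sum>m\<in>mons j. c m * Lrow t \<tau> m n)"
proof -
  have "monomial n * (linear_form t * poly_of j c) = (\<Sum>i\<in>UNIV. C (t i) * (monomial n * (X i * poly_of j c)))"
  proof -
    have "linear_form t = (\<Sum>i\<in>UNIV. C (t i) * X i)" unfolding linear_form_def by (simp add: mult_single)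
    then show ?thesis by (simp only: sum_distrib_left sum_distrib_right ac_simps)
  qed
  then have "T (monomial n * (linear_form t * poly_of j c)) = (\<Sum>i\<in>UNIV. t i * (\<Sum>m\<in>mons j. c m * \<tau> (m + var i + n)))"
    by (simp only: T_sum T_scale T_X_poly_of)
  also have "\<dots> = (\<Sum>m\<in>mons j. c m * Lrow t \<tau> m n)"
    unfolding Lrow_def sum_distrib_left by (subst sum.swap) (simp add: ac_simps)
  finally show ?thesis .
qed

lemma T_poly_of_poly_of:
  "T (poly_of i c * poly_of j c') = (\<Sum>m\<in>mons i. c m * (\<Sum>m'\<in>mons j. c' m' * \<tau> (m' + m)))"
proof -
  have "poly_of i c * poly_of j c' = (\<Sum>m\<in>mons i. C (c m) * (monomial m * poly_of j c'))"
    unfolding poly_of_def[of i] by (simp add: sum_distrib_right mult.assoc[symmetric] mult_single)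
  then show ?thesis by (simp only: T_sum T_scale T_poly_of)
qed

lemma poly_of_forms: "poly_of j c \<in> forms (int j)"
  unfolding forms_iff poly_of_def by (auto simp: in_keys_iff lookup_sum_single finite_mons split: if_splits)

lemma form_poly_of: "f \<in> forms (int j) \<Longrightarrow> f = poly_of j (Poly_Mapping.lookup f)"
  unfolding poly_of_def by (rule form_expand)

lemma poly_of_I: "poly_of j c \<in> I \<longleftrightarrow> (\<forall>n. (\<Sum>m\<in>mons j. c m * \<tau> (m + n)) = 0)"
  unfolding in_I_iff T_poly_of ..

lemma linear_poly_of_I: "linear_form t * poly_of j c \<in> I \<longleftrightarrow> (\<forall>n. (\<Sum>m\<in>mons j. c m * Lrow t \<tau> m n) = 0)"
  unfolding in_I_iff T_linear_form ..

text \<open>The functionals \<open>T(z\<^sub>r \<cdot>)\<close> on the annihilator of \<open>\<ell>\<close> kill the multiples of the variables, because \<open>z\<^sub>r\<close> times a variable is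
divisible by \<open>\<ell>\<close>. So their values are determined by the values at the two generators and the constant terms of the coefficients, and
the matrix \<open>T(z\<^sub>r \<kappa>\<^sub>q)\<close> has rank at most two. But it is \<open>u\<close> times the identity matrix.\<close>

lemma no_three_socle_elements:
  assumes t2: "t 2 \<noteq> 0" and u: "u \<noteq> 0"
    and g: "\<And>\<kappa>. linear_form t * \<kappa> \<in> I \<Longrightarrow> \<exists>a b. \<kappa> - (a * g1 + b * g2) \<in> I"
    and gI: "linear_form t * g1 \<in> I" "linear_form t * g2 \<in> I"
  shows "\<not> three_socle_elements \<tau> t e u \<alpha> \<zeta> \<omega> \<chi>"
proof
  assume ts: "three_socle_elements \<tau> t e u \<alpha> \<zeta> \<omega> \<chi>"
  define z where "z r = poly_of (\<alpha> r) (\<zeta> r)" for r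
  define k where "k r = poly_of (e - \<alpha> r) (\<chi> r)" for r
  let ?l = "linear_form t"
  have le: "\<alpha> r \<le> e" if "r < 3" for r using ts that unfolding three_socle_elements_def by blast
  have k: "?l * k r \<in> I" if "r < 3" for r
    using ts that unfolding three_socle_elements_def k_def linear_poly_of_I by blast
  have pair: "T (z r * k q) = (if q = r then u else 0)" if r: "r < 3" and q: "q < 3" for r q
  proof (cases "\<alpha> q = \<alpha> r")
    case True
    then show ?thesis using ts r q unfolding three_socle_elements_def z_def k_def T_poly_of_poly_of by blast
  next
    case False
    have "\<tau> (m' + m) = 0" if "m \<in> mons (\<alpha> r)" "m' \<in> mons (e - \<alpha> q)" for m m'
      using that le[OF r] le[OF q] False by (intro \<tau>_degree) (auto simp: mons_def monomial_degree_add)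
    then show ?thesis using False unfolding z_def k_def T_poly_of_poly_of by auto
  qed
  have soc01: "\<exists>w. X (if b then 1 else 0) * z r - ?l * w \<in> I" if r: "r < 3" for r b
  proof -
    have "(\<Sum>m\<in>mons (\<alpha> r). \<zeta> r m * \<tau> (m + var (if b then 1 else 0) + n)) = (\<Sum>m\<in>mons (\<alpha> r). \<omega> r b m * Lrow t \<tau> m n)" for n
      using ts r unfolding three_socle_elements_def by blast
    then have "X (if b then 1 else 0) * z r - ?l * poly_of (\<alpha> r) (\<omega> r b) \<in> I"
      unfolding in_I_iff z_def by (simp only: right_diff_distrib T_diff T_X_poly_of T_linear_form) simp
    then show ?thesis by blast
  qed
  \<comment> \<open>The variable with index 2 is a combination of the linear form and the other two variables.\<close>
  have soc: "\<exists>w. X i * z r - ?l * w \<in> I" if r: "r < 3" for r i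
  proof -
    obtain w0 w1 where w: "X 0 * z r - ?l * w0 \<in> I" "X 1 * z r - ?l * w1 \<in> I"
      using soc01[OF r, of False] soc01[OF r, of True] by auto
    define w2 where "w2 = C (1 / t 2) * (z r - C (t 0) * w0 - C (t 1) * w1)"
    have l: "?l = C (t 0) * X 0 + C (t 1) * X 1 + C (t 2) * X 2"
      unfolding linear_form_def sum_three by (simp add: mult_single)
    have c2: "C (1 / t 2) * C (t 2) = (1 :: (3, 'k) mpoly)" using t2 by (simp add: mult_single)
    have "X 2 * z r - ?l * w2
      = X 2 * z r - C (1 / t 2) * (?l * z r - C (t 0) * (?l * w0) - C (t 1) * (?l * w1))"
      unfolding w2_def by (simp add: algebra_simps)
    also have "\<dots> = X 2 * z r - C (1 / t 2) * C (t 2) * (X 2 * z r)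
      - C (1 / t 2) * C (t 0) * (X 0 * z r - ?l * w0) - C (1 / t 2) * C (t 1) * (X 1 * z r - ?l * w1)"
      unfolding l by (simp only: algebra_simps)
    also have "\<dots> = - (C (1 / t 2) * C (t 0) * (X 0 * z r - ?l * w0) + C (1 / t 2) * C (t 1) * (X 1 * z r - ?l * w1))"
      unfolding c2 by simp
    finally have "X 2 * z r - ?l * w2 \<in> I"
      using I_diff[OF I_zero I_add[OF I_mult[OF w(1)] I_mult[OF w(2)]]] by (metis diff_0)
    then show ?thesis using w exhaust_three[of i] by auto
  qed
  have kill: "T (z r * (a * \<kappa>)) = Poly_Mapping.lookup a 0 * T (z r * \<kappa>)" if r: "r < 3" and \<kappa>: "?l * \<kappa> \<in> I" for r a \<kappa>
  proof -
    have Xkill: "T (b * (X i * z r) * \<kappa>) = 0" for b i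
    proof -
      obtain w where w: "X i * z r - ?l * w \<in> I" using soc[OF r] by blast
      have "b * (X i * z r) * \<kappa> = (b * \<kappa>) * (X i * z r - ?l * w) + (b * w) * (?l * \<kappa>)"
        by (simp add: algebra_simps)
      then show ?thesis using T_I[OF I_add[OF I_mult[OF w] I_mult[OF \<kappa>]]] by simp
    qed
    have single: "T (Poly_Mapping.single m c * (z r * \<kappa>)) = (if m = 0 then c * T (z r * \<kappa>) else 0)" for m c
    proof (cases "m = 0")
      case True
      then show ?thesis using T_scale by simp
    next
      case False
      then obtain j where "monomial_degree m = Suc j" using monomial_degree_zero[of m] by (cases "monomial_degree m") auto
      then obtain i m' where "m = m' + var i" using split_var[of m j] unfolding mons_def by blast
      then have "Poly_Mapping.single m c = Poly_Mapping.single m' c * X i" by (simp add: mult_single)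
      then have "Poly_Mapping.single m c * (z r * \<kappa>) = Poly_Mapping.single m' c * (X i * z r) * \<kappa>"
        by (simp only: mult.assoc)
      then show ?thesis using Xkill False by (simp only: if_False)
    qed
    have "z r * (a * \<kappa>) = a * (z r * \<kappa>)" by (simp add: ac_simps)
    also have "\<dots> = (\<Sum>m\<in>Poly_Mapping.keys a. Poly_Mapping.single m (Poly_Mapping.lookup a m) * (z r * \<kappa>))"
      by (subst expand_singles[OF finite_keys order_refl, of a]) (simp only: sum_distrib_right)
    finally have "T (z r * (a * \<kappa>)) = (\<Sum>m\<in>Poly_Mapping.keys a. if m = 0 then Poly_Mapping.lookup a m * T (z r * \<kappa>) else 0)"
      by (simp only: T_sum single)
    also have "\<dots> = Poly_Mapping.lookup a 0 * T (z r * \<kappa>)"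
      by (auto simp: in_keys_iff)
    finally show ?thesis .
  qed
  have "\<exists>x y. \<forall>r<3. T (z r * k q) = x * T (z r * g1) + y * T (z r * g2)" if q: "q < 3" for q
  proof -
    obtain a b where ab: "k q - (a * g1 + b * g2) \<in> I" using g k[OF q] by blast
    have "T (z r * k q) = Poly_Mapping.lookup a 0 * T (z r * g1) + Poly_Mapping.lookup b 0 * T (z r * g2)" if r: "r < 3" for r
    proof -
      have "z r * k q = z r * (k q - (a * g1 + b * g2)) + (z r * (a * g1) + z r * (b * g2))"
        by (simp add: algebra_simps)
      then have "T (z r * k q) = T (z r * (k q - (a * g1 + b * g2))) + (T (z r * (a * g1)) + T (z r * (b * g2)))"
        by (simp only: T_add)
      then show ?thesis using T_I[OF I_mult[OF ab, of "z r"]] kill[OF r gI(1)] kill[OF r gI(2)] by simp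
    qed
    then show ?thesis by blast
  qed
  then have "\<forall>q. \<exists>x y. q < 3 \<longrightarrow> (\<forall>r<3. T (z r * k q) = x * T (z r * g1) + y * T (z r * g2))" by blast
  then obtain x y where xy: "\<And>q r. q < 3 \<Longrightarrow> r < 3 \<Longrightarrow> T (z r * k q) = x q * T (z r * g1) + y q * T (z r * g2)"
    by metis
  define M where "M r q = T (z r * k q)" for r q
  define p s where "p r = T (z r * g1)" and "s r = T (z r * g2)" for r
  have M: "M r q = x q * p r + y q * s r" if "q < 3" "r < 3" for r q
    using xy[OF that] unfolding M_def p_def s_def .
  have rank: "M 0 0 * (M 1 1 * M 2 2 - M 1 2 * M 2 1) - M 0 1 * (M 1 0 * M 2 2 - M 1 2 * M 2 0)
    + M 0 2 * (M 1 0 * M 2 1 - M 1 1 * M 2 0) = 0"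
    by (simp add: M algebra_simps)
  have "M 0 0 = u" "M 1 1 = u" "M 2 2 = u" "M 1 2 = 0" "M 0 1 = 0" "M 0 2 = 0"
    unfolding M_def by (simp_all add: pair)
  then show False using rank u by simp
qed

lemma Lrow_zero:
  assumes "monomial_degree m + monomial_degree n + 1 \<noteq> e" shows "Lrow t \<tau> m n = 0"
proof -
  have "\<tau> (m + var i + n) = 0" for i
    using assms monomial_degree_var[of i] by (intro \<tau>_degree) (simp add: monomial_degree_add)
  then show ?thesis unfolding Lrow_def by simp
qed

text \<open>A form that is not in the image of \<open>\<ell>\<close> is detected by the kernel of \<open>\<ell>\<close> in the dual degree.\<close>

lemma surjective_if_dual_injective:
  assumes inj: "\<And>c. linear_form t * poly_of j c \<in> I \<Longrightarrow> poly_of j c \<in> I"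
    and e: "Suc i + j = e" and f: "f \<in> forms (int (Suc i))"
  shows "\<exists>w\<in>forms (int i). f - linear_form t * w \<in> I"
proof -
  have "\<exists>q. \<forall>c\<in>UNIV. (\<Sum>m\<in>mons j. c m * T (monomial m * f)) = (\<Sum>n\<in>mons i. q n * (\<Sum>m\<in>mons j. c m * Lrow t \<tau> m n))"
  proof (rule inv.functional_in_span_of_kernels[OF finite_mons inv.subspace_UNIV])
    show "inv.lin_functional_on UNIV (\<lambda>c. \<Sum>m\<in>mons j. c m * Lrow t \<tau> m n)" for n
      unfolding inv.lin_functional_on_def
      by (auto simp: sc_def plus_fun_def distrib_right sum.distrib sum_distrib_left mult.assoc)
    show "inv.lin_functional_on UNIV (\<lambda>c. \<Sum>m\<in>mons j. c m * T (monomial m * f))"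
      unfolding inv.lin_functional_on_def
      by (auto simp: sc_def plus_fun_def distrib_right sum.distrib sum_distrib_left mult.assoc)
    fix c assume z: "\<And>n. n \<in> mons i \<Longrightarrow> (\<Sum>m\<in>mons j. c m * Lrow t \<tau> m n) = 0"
    have "(\<Sum>m\<in>mons j. c m * Lrow t \<tau> m n) = 0" for n
    proof (cases "n \<in> mons i")
      case False
      have "Lrow t \<tau> m n = 0" if "m \<in> mons j" for m
        using that False e by (intro Lrow_zero) (auto simp: mons_def)
      then show ?thesis by simp
    qed (rule z)
    then have "poly_of j c \<in> I" using inj linear_poly_of_I by blast
    then have "T (f * poly_of j c) = 0" using T_I I_mult by blast
    moreover have "f * poly_of j c = (\<Sum>m\<in>mons j. C (c m) * (monomial m * f))"
      unfolding poly_of_def sum_distrib_left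
      by (rule sum.cong) (simp_all add: mult_single mult.assoc[symmetric] mult.commute[of f])
    ultimately show "(\<Sum>m\<in>mons j. c m * T (monomial m * f)) = 0" by (simp only: T_sum T_scale)
  qed
  then obtain q where q: "\<And>c. (\<Sum>m\<in>mons j. c m * T (monomial m * f)) = (\<Sum>n\<in>mons i. q n * (\<Sum>m\<in>mons j. c m * Lrow t \<tau> m n))" by blast
  have q1: "T (monomial m * f) = (\<Sum>n\<in>mons i. q n * Lrow t \<tau> m n)" if "m \<in> mons j" for m
    using q[of "\<lambda>x. if x = m then 1 else 0"] that finite_mons
    by (simp add: if_distrib[of "\<lambda>x. x * _"] cong: if_cong)
  have sym: "Lrow t \<tau> m n = Lrow t \<tau> n m" for m n unfolding Lrow_def by (simp add: ac_simps)
  have "T (monomial m * (f - linear_form t * poly_of i q)) = 0" for m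
  proof (cases "m \<in> mons j")
    case True
    then show ?thesis using q1[OF True] T_linear_form[of m t i q]
      by (simp add: right_diff_distrib T_diff sym[of m])
  next
    case False
    have "T (monomial m * f) = (\<Sum>n\<in>mons (Suc i). Poly_Mapping.lookup f n * \<tau> (n + m))"
      using T_poly_of[of m "Suc i" "Poly_Mapping.lookup f"] form_poly_of[OF f] by simp
    also have "\<dots> = 0"
    proof -
      have "\<tau> (n + m) = 0" if "n \<in> mons (Suc i)" for n
        using that False e by (intro \<tau>_degree) (auto simp: mons_def monomial_degree_add)
      then show ?thesis by simp
    qed
    finally have "T (monomial m * f) = 0" .
    moreover have "Lrow t \<tau> n m = 0" if "n \<in> mons i" for n
      using that False e by (intro Lrow_zero) (auto simp: mons_def)
    ultimately show ?thesis using T_linear_form[of m t i q] by (simp add: right_diff_distrib T_diff)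
  qed
  then have "f - linear_form t * poly_of i q \<in> I" unfolding in_I_iff by blast
  then show ?thesis using poly_of_forms by blast
qed

lemma forms_above_socle_degree:
  assumes "f \<in> forms (int j)" "e < j" shows "f \<in> I"
proof -
  have "poly_of j (Poly_Mapping.lookup f) \<in> I"
    unfolding poly_of_I using assms(2)
    by (auto simp: mons_def monomial_degree_add intro!: sum.neutral \<tau>_degree)
  then show ?thesis using form_poly_of[OF assms(1)] by simp
qed

text \<open>Injectivity of the specialized linear form in the lower half of the degrees gives surjectivity in the upper half by duality. The point at which to
specialize must avoid two conditions besides that of the open set: the vanishing of the coefficient with index 2, and that of the denominators; each is a polynomial condition, so a
common point exists.\<close>

theorem lefschetz_form:
  assumes U: "zariski_open U" "U \<noteq> {}"
    and gen: "\<And>c. c \<in> U \<Longrightarrow> \<exists>g1 g2. linear_form c * g1 \<in> I \<and> linear_form c * g2 \<in> I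
      \<and> (\<forall>\<kappa>. linear_form c * \<kappa> \<in> I \<longrightarrow> (\<exists>a b. \<kappa> - (a * g1 + b * g2) \<in> I))"
  shows "\<exists>t. \<forall>i. (\<forall>p\<in>forms (int i). linear_form t * p \<in> I \<longrightarrow> p \<in> I)
    \<or> (\<forall>f\<in>forms (int (Suc i)). \<exists>w\<in>forms (int i). f - linear_form t * w \<in> I)"
proof -
  obtain F where F: "U = {c. \<exists>f\<in>F. eval_poly f c \<noteq> 0}" using U(1) unfolding zariski_open_def by blast
  obtain c0 f where f: "f \<in> F" "eval_poly f c0 \<noteq> 0" using U(2) unfolding F by blast
  define F3 where "F3 = (\<Sum>m\<in>Poly_Mapping.keys f. const3 (Poly_Mapping.lookup f m) * (\<Prod>i\<in>UNIV. ratvar i ^ Poly_Mapping.lookup m i))"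
  have ev: "eval_at t F3 = eval_poly f t" for t
    unfolding F3_def eval_poly_def by (simp add: eval_at_simps)
  have "F3 \<noteq> 0" using ev[of c0] f(2) by (auto simp: eval_at_simps)
  moreover have "(ratvar 2 :: 'k poly3) \<noteq> 0" by (simp add: ratvar_def)
  ultimately have nz: "F3 * ratvar 2 \<noteq> 0" by simp
  interpret generic_form \<tau> e by unfold_locales (rule \<tau>_degree)
  have "\<not> three_socle_elements \<tau> t e v \<alpha> \<zeta> \<omega> \<chi>"
    if "eval_at t (F3 * ratvar 2) \<noteq> 0" "v \<noteq> 0" for t v \<alpha> \<zeta> \<omega> \<chi>
  proof -
    have t: "eval_poly f t \<noteq> 0" "t 2 \<noteq> 0" using that(1) by (auto simp: eval_at_simps ev)
    then have "t \<in> U" unfolding F using f(1) by blast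
    then obtain g1 g2 where g: "linear_form t * g1 \<in> I" "linear_form t * g2 \<in> I"
      "\<And>\<kappa>. linear_form t * \<kappa> \<in> I \<Longrightarrow> \<exists>a b. \<kappa> - (a * g1 + b * g2) \<in> I" using gen by blast
    show ?thesis by (rule no_three_socle_elements[OF t(2) that(2) g(3) g(1,2)])
  qed
  then obtain t where t: "\<And>i c n. 2 * i + 1 \<le> e \<Longrightarrow> (\<forall>m'. (\<Sum>m\<in>mons i. c m * Lrow t \<tau> m m') = 0) \<Longrightarrow>
    (\<Sum>m\<in>mons i. c m * \<tau> (m + n)) = 0"
    using generic_injectivity[OF nz] by blast
  have inj: "poly_of i c \<in> I" if "2 * i + 1 \<le> e" "linear_form t * poly_of i c \<in> I" for i c
    using t[OF that(1)] that(2) unfolding linear_poly_of_I poly_of_I by blast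
  have "(\<forall>p\<in>forms (int i). linear_form t * p \<in> I \<longrightarrow> p \<in> I)
    \<or> (\<forall>f\<in>forms (int (Suc i)). \<exists>w\<in>forms (int i). f - linear_form t * w \<in> I)" for i
  proof (cases "2 * i + 1 \<le> e")
    case True
    then have "\<forall>p\<in>forms (int i). linear_form t * p \<in> I \<longrightarrow> p \<in> I"
      using inj form_poly_of by metis
    then show ?thesis by blast
  next
    case False
    have "\<exists>w\<in>forms (int i). f - linear_form t * w \<in> I" if f: "f \<in> forms (int (Suc i))" for f
    proof (cases "Suc i \<le> e")
      case True
      show ?thesis
        by (rule surjective_if_dual_injective[OF _ _ f, of _ "e - Suc i"]) (use inj True False in auto)
    next
      case False
      then have "f \<in> I" using forms_above_socle_degree[OF f] by simp
      then show ?thesis by (intro bexI[of _ 0]) (auto simp: forms_def)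
    qed
    then show ?thesis by blast
  qed
  then show ?thesis by blast
qed

end

section \<open>Graded quotients of the polynomial ring\<close>

lemma poly_ring_simps [simp]:
  "carrier poly_ring = UNIV" "monoid.mult poly_ring = (*)" "monoid.one poly_ring = 1"
  "ring.zero poly_ring = 0" "ring.add poly_ring = (+)"
  unfolding poly_ring_def by simp_all

lemma poly_ring_cring: "cring (poly_ring :: ('x, 'k::field) mpoly ring)"
proof (rule cringI)
  show "abelian_group (poly_ring :: ('x, 'k::field) mpoly ring)"
  proof (rule abelian_groupI)
    fix x :: "('x, 'k) mpoly"
    show "\<exists>y\<in>carrier poly_ring. y \<oplus>\<^bsub>poly_ring\<^esub> x = \<zero>\<^bsub>poly_ring\<^esub>"
      by (rule bexI[of _ "- x"]) simp_all
  qed (simp_all add: add_ac)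
  show "comm_monoid (poly_ring :: ('x, 'k::field) mpoly ring)"
    by (rule comm_monoidI) (simp_all add: mult_ac)
qed (simp_all add: distrib_right)

interpretation poly_ring: cring "poly_ring :: ('x, 'k::field) mpoly ring" by (rule poly_ring_cring)

lemma quot_algebra_simps [simp]:
  "carrier (quot_algebra I) = carrier (poly_ring Quot I)" "monoid.mult (quot_algebra I) = monoid.mult (poly_ring Quot I)"
  "monoid.one (quot_algebra I) = monoid.one (poly_ring Quot I)" "ring.zero (quot_algebra I) = ring.zero (poly_ring Quot I)"
  "ring.add (quot_algebra I) = ring.add (poly_ring Quot I)"
  "module.smult (quot_algebra I) p a = (I +>\<^bsub>poly_ring\<^esub> p) \<otimes>\<^bsub>poly_ring Quot I\<^esub> a"
  unfolding quot_algebra_def by (simp_all add: ring.defs module.defs)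

lemma coset_alt: "I +>\<^bsub>poly_ring\<^esub> p = {f. f - p \<in> I}"
  unfolding a_r_coset_def r_coset_def by (auto simp: algebra_simps)

locale poly_ideal =
  fixes I :: "(3, 'k::field_char_0) mpoly set"
  assumes homogeneous: "homogeneous_ideal I"
begin

sublocale ideal I poly_ring using homogeneous unfolding homogeneous_ideal_def by blast

abbreviation Q where "Q \<equiv> quot_algebra I"
abbreviation cls where "cls p \<equiv> I +>\<^bsub>poly_ring\<^esub> p"

lemma I0: "0 \<in> I" using zero_closed by simp
lemma Iadd: "f \<in> I \<Longrightarrow> g \<in> I \<Longrightarrow> f + g \<in> I" using a_closed by simp
lemma Imult: "f \<in> I \<Longrightarrow> g * f \<in> I" using I_l_closed by simp
lemma Idiff: "f \<in> I \<Longrightarrow> g \<in> I \<Longrightarrow> f - g \<in> I" using Iadd[of f "- 1 * g"] Imult[of g "- 1"] by simp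

lemma cls_eq: "cls p = cls q \<longleftrightarrow> p - q \<in> I"
proof
  assume "cls p = cls q"
  then have "p \<in> cls q" unfolding coset_alt using I0 by auto
  then show "p - q \<in> I" unfolding coset_alt by simp
next
  assume pq: "p - q \<in> I"
  have "f - p \<in> I \<longleftrightarrow> f - q \<in> I" for f
    using Iadd[OF _ pq, of "f - p"] Idiff[OF _ pq, of "f - q"] by auto
  then show "cls p = cls q" unfolding coset_alt by simp
qed

lemma cls_zero: "cls 0 = I" unfolding coset_alt by simp

lemma carrier_Q: "carrier (poly_ring Quot I) = range cls"
  unfolding FactRing_def A_RCOSETS_def RCOSETS_def a_r_coset_def by auto

lemma zero_Q: "\<zero>\<^bsub>poly_ring Quot I\<^esub> = cls 0" unfolding FactRing_def cls_zero by simp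

lemma one_Q: "\<one>\<^bsub>poly_ring Quot I\<^esub> = cls 1" unfolding FactRing_def by simp

lemma mult_Q: "cls p \<otimes>\<^bsub>poly_ring Quot I\<^esub> cls q = cls (p * q)"
  unfolding FactRing_def using rcoset_mult_add[of p q] by simp

lemma add_Q: "cls p \<oplus>\<^bsub>poly_ring Quot I\<^esub> cls q = cls (p + q)"
proof -
  have "cls p \<oplus>\<^bsub>poly_ring Quot I\<^esub> cls q = {f. \<exists>g h. g - p \<in> I \<and> h - q \<in> I \<and> f = g + h}"
    unfolding FactRing_def set_add_def set_mult_def coset_alt by auto
  also have "\<dots> = cls (p + q)"
    unfolding coset_alt
  proof (intro equalityI subsetI)
    fix f assume "f \<in> {f. \<exists>g h. g - p \<in> I \<and> h - q \<in> I \<and> f = g + h}"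
    then obtain g h where "g - p \<in> I" "h - q \<in> I" "f = g + h" by blast
    then show "f \<in> {f. f - (p + q) \<in> I}" using Iadd[of "g - p" "h - q"] by (simp add: algebra_simps)
  next
    fix f assume "f \<in> {f. f - (p + q) \<in> I}"
    then have "(f - q) - p \<in> I" "q - q \<in> I" "f = (f - q) + q" using I0 by (auto simp: algebra_simps)
    then show "f \<in> {f. \<exists>g h. g - p \<in> I \<and> h - q \<in> I \<and> f = g + h}" by blast
  qed
  finally show ?thesis .
qed

lemma Q_cring: "cring Q"
proof (rule cringI)
  show "abelian_group Q"
  proof (rule abelian_groupI)
    fix x assume "x \<in> carrier Q"
    then obtain p where p: "x = cls p" by (auto simp: carrier_Q)
    show "\<exists>y\<in>carrier Q. y \<oplus>\<^bsub>Q\<^esub> x = \<zero>\<^bsub>Q\<^esub>"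
      by (rule bexI[of _ "cls (- p)"]) (simp_all add: p add_Q zero_Q carrier_Q)
  qed (auto simp: carrier_Q add_Q zero_Q add_ac)
  show "comm_monoid Q"
    by (rule comm_monoidI) (auto simp: carrier_Q mult_Q one_Q mult_ac)
  show "\<And>x y z. x \<in> carrier Q \<Longrightarrow> y \<in> carrier Q \<Longrightarrow> z \<in> carrier Q \<Longrightarrow>
    (x \<oplus>\<^bsub>Q\<^esub> y) \<otimes>\<^bsub>Q\<^esub> z = x \<otimes>\<^bsub>Q\<^esub> z \<oplus>\<^bsub>Q\<^esub> y \<otimes>\<^bsub>Q\<^esub> z"
    by (auto simp: carrier_Q mult_Q add_Q distrib_right)
qed

sublocale Q: cring Q by (rule Q_cring)

lemma neg_Q: "\<ominus>\<^bsub>Q\<^esub> cls p = cls (- p)"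
  by (rule Q.minus_equality) (auto simp: carrier_Q add_Q zero_Q)

text \<open>The polynomials all of whose homogeneous components lie in the ideal form an ideal that contains the homogeneous generators.\<close>

lemma hcomp_I:
  assumes "f \<in> I" shows "hcomp j f \<in> I"
proof -
  obtain S where S: "S \<subseteq> (\<Union>d. forms d)" "I = genideal poly_ring S"
    using homogeneous unfolding homogeneous_ideal_def by blast
  define J where "J = {f. \<forall>j. hcomp j f \<in> I}"
  have mult: "h * f \<in> J" if "f \<in> J" for f h
  proof -
    have single: "hcomp j (Poly_Mapping.single m c * f) \<in> I" for j m c
    proof (cases "monomial_degree m \<le> j")
      case True
      then have "hcomp j (Poly_Mapping.single m c * f) = Poly_Mapping.single m c * hcomp (j - monomial_degree m) f"
        using hcomp_mult_single[of "j - monomial_degree m" m c f] by simp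
      then show ?thesis using Imult \<open>f \<in> J\<close> unfolding J_def by simp
    next
      case False
      have "hcomp j (Poly_Mapping.single m c * f)
        = (\<Sum>n\<in>Poly_Mapping.keys f. hcomp j (Poly_Mapping.single (m + n) (c * Poly_Mapping.lookup f n)))"
        by (subst expand_singles[OF finite_keys order_refl, of f]) (simp only: sum_distrib_left hcomp_sum mult_single)
      also have "\<dots> = 0" using False by (intro sum.neutral) (auto simp: hcomp_single monomial_degree_add)
      finally show ?thesis using I0 by simp
    qed
    have "hcomp j (h * f) = (\<Sum>m\<in>Poly_Mapping.keys h. hcomp j (Poly_Mapping.single m (Poly_Mapping.lookup h m) * f))" for j
      by (subst expand_singles[OF finite_keys order_refl, of h]) (simp only: sum_distrib_right hcomp_sum)
    moreover have "(\<Sum>m\<in>T. g m) \<in> I" if "\<And>m. g m \<in> I" for T :: "mon set" and g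
      using that by (induction T rule: infinite_finite_induct) (auto intro: I0 Iadd)
    ultimately show ?thesis using single unfolding J_def by simp
  qed
  have "ideal J poly_ring"
  proof (rule idealI)
    show "ring (poly_ring :: (3, 'k) mpoly ring)" by (rule poly_ring.ring_axioms)
    have J0: "0 \<in> J" unfolding J_def by (simp add: hcomp_zero I0)
    have Jadd: "f + g \<in> J" if "f \<in> J" "g \<in> J" for f g using that unfolding J_def by (simp add: hcomp_add Iadd)
    have neg: "inv\<^bsub>add_monoid poly_ring\<^esub> f = - f" for f :: "(3, 'k) mpoly"
      using poly_ring.minus_equality[of "- f" f] unfolding a_inv_def by simp
    show "subgroup J (add_monoid poly_ring)"
    proof (rule subgroup.intro)
      show "inv\<^bsub>add_monoid poly_ring\<^esub> x \<in> J" if "x \<in> J" for x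
        unfolding neg using mult[OF that, of "- 1"] by simp
    qed (use J0 Jadd in auto)
  qed (use mult in \<open>auto simp: mult.commute\<close>)
  moreover have "S \<subseteq> J"
  proof
    fix f assume f: "f \<in> S"
    then have fI: "f \<in> I" using S(2) poly_ring.genideal_self[of S] by auto
    obtain d where d: "f \<in> forms d" using S(1) f by blast
    have "hcomp j f \<in> I" for j
    proof (cases "d \<ge> 0")
      case True
      then have "f \<in> forms (int (nat d))" using d by simp
      then show ?thesis using hcomp_form[of f "nat d" j] fI I0 by simp
    next
      case False
      then have "Poly_Mapping.keys f = {}" using d unfolding forms_def by force
      then show ?thesis using I0 by (simp add: hcomp_zero)
    qed
    then show "f \<in> J" unfolding J_def by blast
  qed
  ultimately have "I \<subseteq> J" unfolding S(2) by (rule poly_ring.genideal_minimal)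
  then show ?thesis using assms unfolding J_def by blast
qed

lemma primeideal_Q:
  assumes sub: "I \<subseteq> M" and M0: "0 \<in> M" and Madd: "\<And>f g. f \<in> M \<Longrightarrow> g \<in> M \<Longrightarrow> f + g \<in> M"
    and Mmult: "\<And>f g. f \<in> M \<Longrightarrow> g * f \<in> M" and M1: "1 \<notin> M"
    and prime: "\<And>f g. f * g \<in> M \<Longrightarrow> f \<in> M \<or> g \<in> M"
  shows "primeideal (cls ` M) Q"
proof (rule primeidealI)
  have mem: "cls f \<in> cls ` M \<longleftrightarrow> f \<in> M" for f
  proof
    assume "cls f \<in> cls ` M"
    then obtain g where "g \<in> M" "f - g \<in> I" using cls_eq by auto
    then show "f \<in> M" using Madd[of "f - g" g] sub by auto
  qed simp
  have neg: "inv\<^bsub>add_monoid Q\<^esub> cls f = cls (- f)" for f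
    using neg_Q[of f] unfolding a_inv_def .
  show "ideal (cls ` M) Q"
  proof (rule idealI)
    show "ring Q" by (rule Q.ring_axioms)
    show "subgroup (cls ` M) (add_monoid Q)"
    proof (rule subgroup.intro)
      show "cls ` M \<subseteq> carrier (add_monoid Q)" by (auto simp: carrier_Q)
      show "x \<otimes>\<^bsub>add_monoid Q\<^esub> y \<in> cls ` M" if "x \<in> cls ` M" "y \<in> cls ` M" for x y
        using that Madd by (auto simp: add_Q)
      show "\<one>\<^bsub>add_monoid Q\<^esub> \<in> cls ` M" using M0 by (simp add: zero_Q)
      show "inv\<^bsub>add_monoid Q\<^esub> x \<in> cls ` M" if x: "x \<in> cls ` M" for x
      proof -
        obtain p where p: "p \<in> M" "x = cls p" using x by blast
        show ?thesis unfolding p(2) neg using Mmult[OF p(1), of "- 1"] by simp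
      qed
    qed
    show "x \<otimes>\<^bsub>Q\<^esub> a \<in> cls ` M" if "a \<in> cls ` M" "x \<in> carrier Q" for a x
      using that Mmult by (auto simp: carrier_Q mult_Q)
    show "a \<otimes>\<^bsub>Q\<^esub> x \<in> cls ` M" if "a \<in> cls ` M" "x \<in> carrier Q" for a x
      using that Mmult by (auto simp: carrier_Q mult_Q mult.commute)
  qed
  show "cring Q" by (rule Q_cring)
  show "carrier Q \<noteq> cls ` M" using mem[of 1] M1 by (auto simp: carrier_Q)
  show "a \<in> cls ` M \<or> b \<in> cls ` M" if ab: "a \<in> carrier Q" "b \<in> carrier Q" "a \<otimes>\<^bsub>Q\<^esub> b \<in> cls ` M" for a b
  proof -
    obtain p q where pq: "a = cls p" "b = cls q" using ab(1,2) by (auto simp: carrier_Q)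
    then have "p * q \<in> M" using ab(3) mem[of "p * q"] by (simp only: quot_algebra_simps mult_Q)
    then show ?thesis using prime unfolding pq mem by blast
  qed
qed

end

lemma const_coeff_mult: "Poly_Mapping.lookup (f * g) 0 = Poly_Mapping.lookup f 0 * Poly_Mapping.lookup g (0 :: mon)"
  for f g :: "(3, 'k::field) mpoly"
proof -
  have sum0: "m + n = 0 \<longleftrightarrow> m = 0 \<and> n = 0" for m n :: mon
    using monomial_degree_add[of m n] monomial_degree_zero by (metis add_eq_0_iff_both_eq_0 add_0)
  have single: "Poly_Mapping.lookup (Poly_Mapping.single m a * g) 0 = (if m = 0 then a * Poly_Mapping.lookup g 0 else 0)" for m a
  proof -
    have "Poly_Mapping.lookup (Poly_Mapping.single m a * g) 0
      = (\<Sum>n\<in>insert 0 (Poly_Mapping.keys g). Poly_Mapping.lookup (Poly_Mapping.single (m + n) (a * Poly_Mapping.lookup g n)) 0)"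
      by (subst expand_singles[of "insert 0 (Poly_Mapping.keys g)" g]) (auto simp: sum_distrib_left lookup_sum mult_single)
    also have "\<dots> = (\<Sum>n\<in>insert 0 (Poly_Mapping.keys g). if n = 0 then (if m = 0 then a * Poly_Mapping.lookup g 0 else 0) else 0)"
      by (rule sum.cong) (auto simp: lookup_single when_def sum0)
    finally show ?thesis by (simp add: sum.delta)
  qed
  have "Poly_Mapping.lookup (f * g) 0
    = (\<Sum>m\<in>insert 0 (Poly_Mapping.keys f). Poly_Mapping.lookup (Poly_Mapping.single m (Poly_Mapping.lookup f m) * g) 0)"
    by (subst expand_singles[of "insert 0 (Poly_Mapping.keys f)" f]) (auto simp: sum_distrib_right lookup_sum)
  also have "\<dots> = Poly_Mapping.lookup f 0 * Poly_Mapping.lookup g 0"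
    unfolding single by (simp add: sum.delta)
  finally show ?thesis .
qed

context poly_ideal
begin

text \<open>If no power of \<open>X\<^sub>i\<close> lies in the ideal, then an ideal that is maximal among those avoiding the
  elements \<open>X\<^sub>i\<^sup>n b\<close> with \<open>b(0) \<noteq> 0\<close> is a prime strictly below the irrelevant maximal ideal. Allowing
  the factors \<open>b\<close> is what forces this prime into the irrelevant ideal.\<close>

lemma variable_nilpotent:
  assumes dim: "has_krull_dim Q 0" shows "\<exists>n. X i ^ n \<in> I"
proof (rule ccontr)
  assume no: "\<not> ?thesis"
  let ?c = "\<lambda>f :: (3, 'k) mpoly. Poly_Mapping.lookup f 0"
  define S where "S = {X i ^ n * b | n b. ?c b \<noteq> 0}"
  have S_mult: "f * g \<in> S" if fg: "f \<in> S" "g \<in> S" for f g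
  proof -
    obtain n b n' b' where "f = X i ^ n * b" "?c b \<noteq> 0" "g = X i ^ n' * b'" "?c b' \<noteq> 0"
      using fg unfolding S_def by blast
    then have "f * g = X i ^ (n + n') * (b * b')" "?c (b * b') \<noteq> 0"
      by (simp_all add: power_add ac_simps const_coeff_mult)
    then show ?thesis unfolding S_def by blast
  qed
  have IS: "I \<inter> S = {}"
  proof (rule ccontr)
    assume "I \<inter> S \<noteq> {}"
    then obtain n b where nb: "X i ^ n * b \<in> I" "?c b \<noteq> 0" unfolding S_def by blast
    have deg: "monomial_degree (Poly_Mapping.single i n) = n"
      unfolding monomial_degree_def by (simp add: lookup_single when_def)
    have h0: "hcomp 0 b = C (?c b)"
      by (rule poly_mapping_eqI) (auto simp: lookup_hcomp monomial_degree_zero lookup_single when_def)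
    have "X i ^ n * C (?c b) \<in> I"
      using hcomp_I[OF nb(1), of n] hcomp_mult_single[of 0 "Poly_Mapping.single i n" 1 b]
      unfolding X_pow deg h0 by simp
    then have "C (1 / ?c b) * (X i ^ n * C (?c b)) \<in> I" by (rule Imult)
    also have "C (1 / ?c b) * (X i ^ n * C (?c b)) = X i ^ n" using nb(2) unfolding X_pow by (simp add: mult_single)
    finally show False using no by blast
  qed
  define Z where "Z = {J. I \<subseteq> J \<and> (\<forall>f\<in>J. \<forall>g\<in>J. f + g \<in> J) \<and> (\<forall>f\<in>J. \<forall>g. g * f \<in> J) \<and> J \<inter> S = {}}"
  have Z_I: "I \<subseteq> J" and Z_add: "f \<in> J \<Longrightarrow> g \<in> J \<Longrightarrow> f + g \<in> J" and Z_mult: "f \<in> J \<Longrightarrow> g * f \<in> J"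
    and Z_S: "J \<inter> S = {}" if "J \<in> Z" for J f g
    using that unfolding Z_def by auto
  have "\<exists>M\<in>Z. \<forall>J\<in>Z. M \<subseteq> J \<longrightarrow> J = M"
  proof (rule subset_Zorn_nonempty)
    have "I \<in> Z" unfolding Z_def using IS Iadd Imult by blast
    then show "Z \<noteq> {}" by blast
    fix Ch assume Ch: "Ch \<noteq> {}" "subset.chain Z Ch"
    have ChZ: "J \<in> Z" if "J \<in> Ch" for J using Ch(2) that unfolding subset_chain_def by blast
    have "f + g \<in> \<Union> Ch" if fg: "f \<in> \<Union> Ch" "g \<in> \<Union> Ch" for f g
    proof -
      obtain J J' where J: "J \<in> Ch" "f \<in> J" "J' \<in> Ch" "g \<in> J'" using fg by blast
      then have "J \<subseteq> J' \<or> J' \<subseteq> J" using Ch(2) unfolding subset_chain_def by blast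
      then show ?thesis
      proof
        assume "J \<subseteq> J'"
        then have "f + g \<in> J'" using Z_add[OF ChZ[OF J(3)] _ J(4)] J(2) by blast
        then show ?thesis using J(3) by blast
      next
        assume "J' \<subseteq> J"
        then have "f + g \<in> J" using Z_add[OF ChZ[OF J(1)] J(2)] J(4) by blast
        then show ?thesis using J(1) by blast
      qed
    qed
    moreover have "I \<subseteq> \<Union> Ch" using Ch(1) Z_I[OF ChZ] by blast
    moreover have "g * f \<in> \<Union> Ch" if f: "f \<in> \<Union> Ch" for f g
    proof -
      obtain J where J: "J \<in> Ch" "f \<in> J" using f by blast
      then show ?thesis using Z_mult[OF ChZ[OF J(1)] J(2), of g] by blast
    qed
    moreover have "\<Union> Ch \<inter> S = {}" using Z_S[OF ChZ] by blast
    ultimately show "\<Union> Ch \<in> Z" unfolding Z_def by blast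
  qed
  then obtain M where M: "M \<in> Z" and max: "\<And>J. J \<in> Z \<Longrightarrow> M \<subseteq> J \<Longrightarrow> J = M" by blast
  have IM: "I \<subseteq> M" and Madd: "\<And>f g. f \<in> M \<Longrightarrow> g \<in> M \<Longrightarrow> f + g \<in> M"
    and Mmult: "\<And>f g. f \<in> M \<Longrightarrow> g * f \<in> M" and MS: "M \<inter> S = {}"
    using M unfolding Z_def by auto
  have M0: "0 \<in> M" using IM I0 by blast
  have meets: "\<exists>m\<in>M. \<exists>r. m + r * a \<in> S" if a: "a \<notin> M" for a
  proof (rule ccontr)
    assume no: "\<not> ?thesis"
    define J where "J = {m + r * a | m r. m \<in> M}"
    have MJ: "M \<subseteq> J"
    proof
      fix m assume "m \<in> M"
      then show "m \<in> J" unfolding J_def by (intro CollectI exI[of _ m] exI[of _ 0]) simp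
    qed
    have Jadd: "f + g \<in> J" if fg: "f \<in> J" "g \<in> J" for f g
    proof -
      obtain m r m' r' where "m \<in> M" "f = m + r * a" "m' \<in> M" "g = m' + r' * a"
        using fg unfolding J_def by blast
      then have "f + g = (m + m') + (r + r') * a" "m + m' \<in> M" using Madd by (auto simp: algebra_simps)
      then show ?thesis unfolding J_def by blast
    qed
    have Jmult: "g * f \<in> J" if f: "f \<in> J" for f g
    proof -
      obtain m r where "m \<in> M" "f = m + r * a" using f unfolding J_def by blast
      then have "g * f = g * m + (g * r) * a" "g * m \<in> M" using Mmult by (simp_all add: distrib_left mult.assoc)
      then show ?thesis unfolding J_def by blast
    qed
    have "J \<inter> S = {}" using no unfolding J_def by blast
    then have "J \<in> Z" unfolding Z_def using MJ IM Jadd Jmult by blast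
    then have "J = M" using max MJ by blast
    moreover have "a \<in> J" unfolding J_def using M0 by (intro CollectI exI[of _ 0] exI[of _ 1]) simp
    ultimately show False using a by blast
  qed
  have prime: "a \<in> M \<or> b \<in> M" if ab: "a * b \<in> M" for a b
  proof (rule ccontr)
    assume "\<not> ?thesis"
    then obtain m r m' r' where mr: "m \<in> M" "m + r * a \<in> S" "m' \<in> M" "m' + r' * b \<in> S"
      using meets[of a] meets[of b] by blast
    have "(m + r * a) * (m' + r' * b) = ((m' + r' * b) * m + (r * a) * m') + (r * r') * (a * b)"
      by (simp add: algebra_simps)
    also have "\<dots> \<in> M" using Madd Mmult mr ab by simp
    finally show False using S_mult[OF mr(2,4)] MS by blast
  qed
  have one_S: "f \<in> S" if "?c f \<noteq> 0" for f
    unfolding S_def using that by (intro CollectI exI[of _ 0] exI[of _ f]) simp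
  have c1: "?c 1 = 1" by (simp add: lookup_one)
  then have M1: "1 \<notin> M" using one_S[of 1] MS by auto
  define \<mm> where "\<mm> = {f :: (3, 'k) mpoly. ?c f = 0}"
  have Mm: "M \<subseteq> \<mm>" unfolding \<mm>_def using one_S MS by blast
  have Xm: "X i \<in> \<mm>" unfolding \<mm>_def by (simp add: lookup_single when_def) (metis Zero_not_Suc lookup_single_eq lookup_zero)
  have "X i ^ 1 * 1 \<in> S" unfolding S_def using c1 by (metis (mono_tags, lifting) mem_Collect_eq zero_neq_one)
  then have XM: "X i \<notin> M" using MS by auto
  define P where "P = (\<lambda>n::nat. if n = 0 then cls ` M else cls ` \<mm>)"
  have "primeideal (cls ` M) Q" by (rule primeideal_Q[OF IM M0 Madd Mmult M1 prime])
  moreover have "primeideal (cls ` \<mm>) Q"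
    by (rule primeideal_Q) (use IM Mm c1 in \<open>auto simp: \<mm>_def lookup_add const_coeff_mult\<close>)
  moreover have "cls ` M \<subset> cls ` \<mm>"
  proof -
    have "cls (X i) \<notin> cls ` M"
    proof
      assume "cls (X i) \<in> cls ` M"
      then obtain g where "g \<in> M" "X i - g \<in> I" using cls_eq by auto
      then show False using Madd[of "X i - g" g] IM XM by auto
    qed
    then show ?thesis using Mm Xm by blast
  qed
  ultimately have "prime_chain Q 1 P"
    unfolding prime_chain_def P_def by auto
  then show False using dim unfolding has_krull_dim_def by (metis not_one_le_zero)
qed

lemma one_forms: "C c \<in> forms 0"
  unfolding forms_def using monomial_degree_zero by (auto split: if_splits)

lemma X_forms: "X i \<in> forms 1"
  unfolding forms_def using monomial_degree_var[of i] by auto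

lemma form_zero: "f \<in> forms 0 \<Longrightarrow> \<exists>c. f = C c"
proof -
  assume f: "f \<in> forms 0"
  have "f = C (Poly_Mapping.lookup f 0)"
    by (rule poly_mapping_eqI) (use f in \<open>auto simp: forms_def monomial_degree_zero lookup_single when_def in_keys_iff\<close>)
  then show ?thesis by blast
qed

lemma positive_form_kills:
  assumes a: "\<And>i. X i * a \<in> I" and b: "b \<in> forms d" and d: "d > 0" shows "b * a \<in> I"
proof -
  have single: "Poly_Mapping.single m c * a \<in> I" if m: "m \<in> Poly_Mapping.keys b" for m c
  proof -
    have "int (monomial_degree m) = d" using b m unfolding forms_def by blast
    then obtain j where "monomial_degree m = Suc j" using d by (cases "monomial_degree m") auto
    then obtain i m' where m': "m = m' + var i" using split_var[of m j] unfolding mons_def by blast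
    have "Poly_Mapping.single m c = Poly_Mapping.single m' c * X i" unfolding m' by (simp add: mult_single)
    then have "Poly_Mapping.single m c * a = Poly_Mapping.single m' c * (X i * a)" by (simp only: mult.assoc)
    then show ?thesis by (rule ssubst) (rule Imult[OF a])
  qed
  have "b * a = (\<Sum>m\<in>Poly_Mapping.keys b. Poly_Mapping.single m (Poly_Mapping.lookup b m) * a)"
    by (subst expand_singles[OF finite_keys order_refl, of b]) (simp only: sum_distrib_right)
  moreover have "(\<Sum>m\<in>T. g m) \<in> I" if "\<And>m. m \<in> T \<Longrightarrow> g m \<in> I" for T :: "mon set" and g
    using that by (induction T rule: infinite_finite_induct) (auto intro: I0 Iadd)
  ultimately show ?thesis using single by simp
qed

lemma in_socle: "cls a \<in> graded_socle Q (quot_component I) \<longleftrightarrow> (\<forall>i. X i * a \<in> I)"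
proof
  assume s: "cls a \<in> graded_socle Q (quot_component I)"
  show "\<forall>i. X i * a \<in> I"
  proof
    fix i
    have "cls (X i) \<in> quot_component I 1" unfolding quot_component_def using X_forms by blast
    moreover have "\<forall>d>0. \<forall>b\<in>quot_component I d. b \<otimes>\<^bsub>Q\<^esub> cls a = \<zero>\<^bsub>Q\<^esub>"
      using s unfolding graded_socle_def by blast
    ultimately have "cls (X i) \<otimes>\<^bsub>Q\<^esub> cls a = \<zero>\<^bsub>Q\<^esub>" by (meson zero_less_one)
    then show "X i * a \<in> I" by (simp add: mult_Q zero_Q cls_eq)
  qed
next
  assume a: "\<forall>i. X i * a \<in> I"
  show "cls a \<in> graded_socle Q (quot_component I)"
    unfolding graded_socle_def quot_component_def
    using positive_form_kills[of a] a by (auto simp: carrier_Q mult_Q zero_Q cls_eq)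
qed

lemma socle_generator:
  assumes dim: "ring.dimension Q 1 (quot_component I 0) (graded_socle Q (quot_component I))"
  shows "\<exists>v. v \<notin> I \<and> (\<forall>i. X i * v \<in> I) \<and> (\<forall>a. (\<forall>i. X i * a \<in> I) \<longrightarrow> (\<exists>c. a - C c * v \<in> I))"
proof -
  let ?K = "quot_component I 0"
  have "\<exists>x E. x \<in> carrier Q \<and> x \<notin> E \<and> Q.dimension 0 ?K E \<and> graded_socle Q (quot_component I) = Q.line_extension ?K x E"
    using dim by (cases rule: Q.dimension.cases) auto
  then obtain x E where x: "x \<in> carrier Q" "x \<notin> E" "Q.dimension 0 ?K E"
    "graded_socle Q (quot_component I) = Q.line_extension ?K x E" by blast
  have E: "E = {\<zero>\<^bsub>Q\<^esub>}" using x(3) by (cases rule: Q.dimension.cases) auto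
  obtain v where v: "x = cls v" using x(1) by (auto simp: carrier_Q)
  have vI: "v \<notin> I" using x(2) unfolding E v by (simp add: zero_Q cls_eq)
  have socle: "graded_socle Q (quot_component I) = {cls (C c * v) | c. True}"
  proof -
    have "cls f \<otimes>\<^bsub>Q\<^esub> cls v \<oplus>\<^bsub>Q\<^esub> \<zero>\<^bsub>Q\<^esub> = cls (f * v)" for f by (simp add: mult_Q zero_Q add_Q)
    then have "graded_socle Q (quot_component I) = {cls (f * v) | f. f \<in> forms 0}"
      unfolding x(4) E v Q.line_extension_def set_add_def set_mult_def r_coset_def quot_component_def
      by (auto simp: mult_Q zero_Q add_Q)
    also have "\<dots> = {cls (C c * v) | c. True}" using form_zero one_forms by blast
    finally show ?thesis .
  qed
  have "cls v = cls (C 1 * v)" by simp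
  then have "cls v \<in> graded_socle Q (quot_component I)" unfolding socle by blast
  then have "\<forall>i. X i * v \<in> I" unfolding in_socle .
  moreover have "\<exists>c. a - C c * v \<in> I" if "\<forall>i. X i * a \<in> I" for a
  proof -
    have "cls a \<in> graded_socle Q (quot_component I)" using that in_socle by blast
    then obtain c where "cls a = cls (C c * v)" unfolding socle by blast
    then show ?thesis unfolding cls_eq by blast
  qed
  ultimately show ?thesis using vI by blast
qed

lemma annihilated_iff: "cls \<kappa> \<in> annihilated Q x \<longleftrightarrow> x * \<kappa> \<in> I"
  unfolding annihilated_def by (auto simp: carrier_Q mult_Q zero_Q cls_eq)

lemma span_submodule: "submodule {cls (a * g1 + b * g2) | a b. True} poly_ring Q"
proof (rule submodule.intro)
  have neg: "inv\<^bsub>add_monoid Q\<^esub> cls f = cls (- f)" for f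
    using neg_Q[of f] unfolding a_inv_def .
  let ?H = "{cls (a * g1 + b * g2) | a b. True}"
  have 1: "cls (a * g1 + b * g2) \<in> ?H" for a b by blast
  show "subgroup ?H (add_monoid Q)"
  proof (rule subgroup.intro)
    show "?H \<subseteq> carrier (add_monoid Q)" by (auto simp: carrier_Q)
    show "x \<otimes>\<^bsub>add_monoid Q\<^esub> y \<in> ?H" if xy: "x \<in> ?H" "y \<in> ?H" for x y
    proof -
      obtain a b a' b' where "x = cls (a * g1 + b * g2)" "y = cls (a' * g1 + b' * g2)" using xy by blast
      then have "x \<otimes>\<^bsub>add_monoid Q\<^esub> y = cls ((a + a') * g1 + (b + b') * g2)" by (simp add: add_Q algebra_simps)
      then show ?thesis by (rule ssubst) (rule 1)
    qed
    show "\<one>\<^bsub>add_monoid Q\<^esub> \<in> ?H" using 1[of 0 0] by (simp add: zero_Q)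
    show "inv\<^bsub>add_monoid Q\<^esub> x \<in> ?H" if x: "x \<in> ?H" for x
    proof -
      obtain a b where "x = cls (a * g1 + b * g2)" using x by blast
      then have "inv\<^bsub>add_monoid Q\<^esub> x = cls (- (a * g1 + b * g2))" by (simp only: neg)
      also have "- (a * g1 + b * g2) = (- a) * g1 + (- b) * g2" by simp
      finally show ?thesis by (rule ssubst) (rule 1)
    qed
  qed
  show "submodule_axioms ?H poly_ring Q"
  proof
    fix p x assume "x \<in> ?H"
    then obtain a b where "x = cls (a * g1 + b * g2)" by blast
    then have "p \<odot>\<^bsub>Q\<^esub> x = cls ((p * a) * g1 + (p * b) * g2)" by (simp add: mult_Q algebra_simps)
    then show "p \<odot>\<^bsub>Q\<^esub> x \<in> ?H" by (rule ssubst) (rule 1)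
  qed
qed

text \<open>If the minimum over an empty family of generating sets is taken, it is infinite; so the bound provides a generating set with at most two elements.\<close>

lemma two_generators:
  assumes "min_num_generators poly_ring Q (annihilated Q l) \<le> 2"
  shows "\<exists>g1 g2. l * g1 \<in> I \<and> l * g2 \<in> I \<and> (\<forall>\<kappa>. l * \<kappa> \<in> I \<longrightarrow> (\<exists>a b. \<kappa> - (a * g1 + b * g2) \<in> I))"
proof -
  let ?N = "annihilated Q l"
  have "\<exists>S. finite S \<and> S \<subseteq> carrier Q \<and> generated_submodule poly_ring Q S = ?N \<and> card S \<le> 2"
  proof (rule ccontr)
    assume no: "\<not> ?thesis"
    have "3 \<le> min_num_generators poly_ring Q ?N"
      unfolding min_num_generators_def
    proof (rule INF_greatest)
      fix S assume "S \<in> {S. finite S \<and> S \<subseteq> carrier Q \<and> generated_submodule poly_ring Q S = ?N}"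
      then have "\<not> card S \<le> 2" using no by blast
      then have "3 \<le> card S" by simp
      then show "(3::enat) \<le> enat (card S)" by (metis enat_ord_simps(1) of_nat_eq_enat of_nat_numeral)
    qed
    then have "(3::enat) \<le> 2" using assms by (rule order_trans)
    then show False by simp
  qed
  then obtain S where S: "finite S" "S \<subseteq> carrier Q" "generated_submodule poly_ring Q S = ?N" "card S \<le> 2" by blast
  have SN: "S \<subseteq> ?N" unfolding S(3)[symmetric] generated_submodule_def by blast
  have zero: "cls 0 \<in> ?N" unfolding annihilated_iff using I0 by simp
  obtain x1 x2 where x: "S \<subseteq> {x1, x2}" "x1 \<in> ?N" "x2 \<in> ?N"
  proof -
    consider "card S = 0" | "card S = 1" | "card S = 2" using S(4) by linarith
    then show thesis
    proof cases
      case 1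
      then show thesis using that[of "cls 0" "cls 0"] S(1) zero by auto
    next
      case 2
      then obtain y where "S = {y}" by (auto simp: card_1_singleton_iff)
      then show thesis using that[of y y] SN by auto
    next
      case 3
      then obtain y z where "S = {y, z}" by (auto simp: card_2_iff)
      then show thesis using that[of y z] SN by auto
    qed
  qed
  obtain g1 g2 where g: "x1 = cls g1" "x2 = cls g2"
    using x unfolding annihilated_def by (auto simp: carrier_Q)
  have sub: "?N \<subseteq> {cls (a * g1 + b * g2) | a b. True}"
  proof -
    have e: "cls g1 = cls (1 * g1 + 0 * g2)" "cls g2 = cls (0 * g1 + 1 * g2)" by simp_all
    have "S \<subseteq> {cls (a * g1 + b * g2) | a b. True}" using x(1) unfolding g using e by blast
    then show ?thesis unfolding S(3)[symmetric] generated_submodule_def using span_submodule by blast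
  qed
  have "\<exists>a b. \<kappa> - (a * g1 + b * g2) \<in> I" if "l * \<kappa> \<in> I" for \<kappa>
  proof -
    have "cls \<kappa> \<in> ?N" using that annihilated_iff by blast
    then obtain a b where "cls \<kappa> = cls (a * g1 + b * g2)" using sub by blast
    then show ?thesis unfolding cls_eq by blast
  qed
  then show ?thesis using x(2,3) unfolding g annihilated_iff by blast
qed

lemma weak_lefschetz_if:
  assumes t: "\<And>i. (\<forall>p\<in>forms (int i). linear_form t * p \<in> I \<longrightarrow> p \<in> I)
    \<or> (\<forall>f\<in>forms (int (Suc i)). \<exists>w\<in>forms (int i). f - linear_form t * w \<in> I)"
  shows "weak_lefschetz Q (quot_component I)"
  unfolding weak_lefschetz_def
proof (intro bexI allI)
  let ?l = "linear_form t"
  have lform: "?l = (\<Sum>i\<in>UNIV. Poly_Mapping.single (var i) (t i))" unfolding linear_form_def by simp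
  have l1: "?l \<in> forms 1"
  proof -
    have "hcomp 1 ?l = ?l" unfolding lform hcomp_sum hcomp_single monomial_degree_var by simp
    then show ?thesis using hcomp_forms[of 1 ?l] by simp
  qed
  then show "cls ?l \<in> quot_component I 1" unfolding quot_component_def by blast
  fix d :: int
  show "inj_on (\<lambda>a. cls ?l \<otimes>\<^bsub>Q\<^esub> a) (quot_component I d) \<or>
    (\<lambda>a. cls ?l \<otimes>\<^bsub>Q\<^esub> a) ` quot_component I d = quot_component I (d + 1)"
  proof (cases "d < 0")
    case True
    have "f = 0" if f: "f \<in> forms d" for f :: "(3, 'k) mpoly"
    proof -
      have "Poly_Mapping.keys f = {}" using f True unfolding forms_def by force
      then show ?thesis by simp
    qed
    then have "x = cls 0" if "x \<in> quot_component I d" for x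
      using that unfolding quot_component_def by blast
    then show ?thesis unfolding inj_on_def by metis
  next
    case False
    define i where "i = nat d"
    have d: "d = int i" "d + 1 = int (Suc i)" unfolding i_def using False by auto
    have forms_diff: "p - q \<in> forms d" if "p \<in> forms d" "q \<in> forms d" for p q :: "(3, 'k) mpoly"
    proof -
      have "hcomp i (p - q) = p - q" using that hcomp_form[of p i i] hcomp_form[of q i i] unfolding d hcomp_diff by simp
      then show ?thesis using hcomp_forms[of i "p - q"] unfolding d by simp
    qed
    have l_forms: "?l * w \<in> forms (d + 1)" if w: "w \<in> forms d" for w
    proof -
      have "w = (\<Sum>m\<in>mons i. Poly_Mapping.single m (Poly_Mapping.lookup w m))" using form_expand w unfolding d by blast
      then have "?l * w = (\<Sum>j\<in>UNIV. \<Sum>m\<in>mons i. Poly_Mapping.single (var j + m) (t j * Poly_Mapping.lookup w m))"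
      proof -
        have "?l * w = ?l * (\<Sum>m\<in>mons i. Poly_Mapping.single m (Poly_Mapping.lookup w m))"
          using \<open>w = _\<close> by (rule arg_cong)
        then show ?thesis unfolding lform sum_product mult_single .
      qed
      moreover have "hcomp (Suc i) (\<Sum>j\<in>UNIV. \<Sum>m\<in>mons i. Poly_Mapping.single (var j + m) (t j * Poly_Mapping.lookup w m))
        = (\<Sum>j\<in>UNIV. \<Sum>m\<in>mons i. Poly_Mapping.single (var j + m) (t j * Poly_Mapping.lookup w m))"
        unfolding hcomp_sum hcomp_single
        by (intro sum.cong refl) (auto simp: monomial_degree_add monomial_degree_var[unfolded One_nat_def] mons_def)
      ultimately have "hcomp (Suc i) (?l * w) = ?l * w" by (simp only:)
      then show ?thesis using hcomp_forms[of "Suc i" "?l * w"] unfolding d(2) by (simp only:)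
    qed
    from t[of i] show ?thesis
    proof
      assume inj: "\<forall>p\<in>forms (int i). ?l * p \<in> I \<longrightarrow> p \<in> I"
      have "inj_on (\<lambda>a. cls ?l \<otimes>\<^bsub>Q\<^esub> a) (quot_component I d)"
      proof (rule inj_onI)
        fix x y assume "x \<in> quot_component I d" "y \<in> quot_component I d"
          and eq: "cls ?l \<otimes>\<^bsub>Q\<^esub> x = cls ?l \<otimes>\<^bsub>Q\<^esub> y"
        then obtain p q where pq: "p \<in> forms d" "q \<in> forms d" "x = cls p" "y = cls q"
          unfolding quot_component_def by blast
        have "?l * (p - q) \<in> I" using eq unfolding pq by (simp add: mult_Q cls_eq right_diff_distrib)
        then have "p - q \<in> I" using inj forms_diff[OF pq(1,2)] unfolding d by blast
        then show "x = y" unfolding pq cls_eq .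
      qed
      then show ?thesis by blast
    next
      assume surj: "\<forall>f\<in>forms (int (Suc i)). \<exists>w\<in>forms (int i). f - ?l * w \<in> I"
      have "(\<lambda>a. cls ?l \<otimes>\<^bsub>Q\<^esub> a) ` quot_component I d = quot_component I (d + 1)"
      proof (intro equalityI subsetI)
        fix x assume "x \<in> (\<lambda>a. cls ?l \<otimes>\<^bsub>Q\<^esub> a) ` quot_component I d"
        then obtain w where "w \<in> forms d" "x = cls (?l * w)" unfolding quot_component_def by (auto simp: mult_Q)
        then show "x \<in> quot_component I (d + 1)" unfolding quot_component_def using l_forms by blast
      next
        fix x assume "x \<in> quot_component I (d + 1)"
        then obtain f where f: "f \<in> forms (int (Suc i))" "x = cls f" unfolding quot_component_def d(2) by blast
        then obtain w where w: "w \<in> forms (int i)" "f - ?l * w \<in> I" using surj by blast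
        then have "x = cls ?l \<otimes>\<^bsub>Q\<^esub> cls w" using f(2) by (simp add: mult_Q cls_eq)
        then show "x \<in> (\<lambda>a. cls ?l \<otimes>\<^bsub>Q\<^esub> a) ` quot_component I d"
          unfolding quot_component_def d using w(1) by blast
      qed
      then show ?thesis by blast
    qed
  qed
qed

end

theorem theorem5p11:
  fixes I :: "(3, 'k::field_char_0) mpoly set"
  assumes "homogeneous_ideal I"
    and "gorenstein_dim_zero (quot_algebra I) (quot_component I)"
    and "for_general_linear_form (\<lambda>x.
      min_num_generators poly_ring (quot_algebra I) (annihilated (quot_algebra I) x) \<le> 2)"
  shows "weak_lefschetz (quot_algebra I) (quot_component I)"
proof -
  interpret poly_ideal I by unfold_locales (rule assms(1))
  have dim: "has_krull_dim (quot_algebra I) 0"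
    and socle: "ring.dimension (quot_algebra I) 1 (quot_component I 0) (graded_socle (quot_algebra I) (quot_component I))"
    using assms(2) unfolding gorenstein_dim_zero_def by blast+
  interpret gorenstein_ideal I
    by unfold_locales (use I0 Iadd Imult hcomp_I variable_nilpotent[OF dim] socle_generator[OF socle] in auto)
  obtain e v where "v \<in> forms (int e)" "v \<notin> I" "\<forall>i. X i * v \<in> I"
    "\<forall>a. (\<forall>i. X i * a \<in> I) \<longrightarrow> (\<exists>c. a - C c * v \<in> I)"
    using homogeneous_socle by blast
  then interpret gorenstein_generator I e v by unfold_locales auto
  obtain U where U: "zariski_open U" "U \<noteq> {}"
    "\<And>c. c \<in> U \<Longrightarrow> min_num_generators poly_ring (quot_algebra I) (annihilated (quot_algebra I) (linear_form c)) \<le> 2"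
    using assms(3) unfolding for_general_linear_form_def by blast
  obtain t where "\<And>i. (\<forall>p\<in>forms (int i). linear_form t * p \<in> I \<longrightarrow> p \<in> I)
    \<or> (\<forall>f\<in>forms (int (Suc i)). \<exists>w\<in>forms (int i). f - linear_form t * w \<in> I)"
    using lefschetz_form[OF U(1,2) two_generators[OF U(3)]] by blast
  then show ?thesis by (rule weak_lefschetz_if)
qed

end
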